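(* Let $\mathcal A$ and $\mathcal B$ be locally small abelian categories with enough projectives, let $F:\mathcal A\to\mathcal B$ and $G:\mathcal B\to\mathcal A$ be additive functors such that $(F,G)$ is a Frobenius pair, and let $X\in\mathcal A$. (1) If $X\in\mathcal T^n(\mathcal A)$, then $F(X)\in\mathcal T^n(\mathcal B)$, for any $n\ge1$. (2) If $X\in\mathcal T^\infty(\mathcal A)$, then $F(X)\in\mathcal T^\infty(\mathcal B)$. (3) If $X$ is Gorenstein projective in $\mathcal A$, then $F(X)$ is Gorenstein projective in $\mathcal B$. Moreover, if the Frobenius functor $F$ is faithful, then each implication in (1)--(3) is an equivalence. That is, every Frobenius functor preserves finite and infinite torsionfreeness and Gorenstein projectivity, and a faithful Frobenius functor also reflects these properties.
   Context: Frobenius pairs: given autoequivalences $\alpha:\mathcal A\to\mathcal A$ and $\beta:\mathcal B\to\mathcal B$, the pair $(F,G)$ is a Frobenius pair of type $(\alpha,\beta)$ if both $(F,G)$ and $(G,\beta F\alpha)$ are adjoint pairs (left adjoint written first). $(F,G)$ is a Frobenius pair if it is one of some type; a functor is a Frobenius functor if it fits as $F$ into a Frobenius pair $(F,G)$ (then $G$ is also a Frobenius functor). Torsionfreeness: $\mathcal P(\mathcal A)$ is the full subcategory of projectives. A morphism $f:M\to P$ with $P$ projective is a left projective approximation if every morphism from $M$ to a projective object factors through $f$. For $n\ge1$, $M$ is $n$-torsionfree if there is an exact sequence $0\to M\xrightarrow{f_1}P_1\xrightarrow{f_2}\cdots\xrightarrow{f_n}P_n$ with all $P_i$ projective such that each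 inclusion $\mathrm{Im} f_i\to P_i$ is a left projective approximation ($1\le i\le n$); $\mathcal T^n(\mathcal A)$ is the full subcategory of such objects and $\mathcal T^\infty(\mathcal A)=\bigcap_{n\ge1}\mathcal T^n(\mathcal A)$. An object $M$ is Gorenstein projective if it is isomorphic to the zeroth cocycle of a totally acyclic complex, i.e. of an acyclic complex of projectives, unbounded in both directions, that remains acyclic after applying $\mathrm{Hom}_{\mathcal A}(-,P)$ for every projective $P$. *)

theory Defs
  imports "HOL-Algebra.Coset"
begin

text \<open>
  A category lives on a set of objects and a set of morphisms, so it has small hom-sets; the types
  of objects and morphisms are arbitrary.  In a preadditive category the addition \<open>madd\<close> is only
  meaningful on parallel morphisms.
\<close>

record ('o, 'm) cat =
  obj :: "'o set"
  arr :: "'m set"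
  src :: "'m \<Rightarrow> 'o"
  tgt :: "'m \<Rightarrow> 'o"
  idm :: "'o \<Rightarrow> 'm"
  cmp :: "'m \<Rightarrow> 'm \<Rightarrow> 'm"  (infixl \<open>\<cdot>\<index>\<close> 70)

record ('o, 'm) addcat = "('o, 'm) cat" +
  madd :: "'m \<Rightarrow> 'm \<Rightarrow> 'm"
  mzero :: "'o \<Rightarrow> 'o \<Rightarrow> 'm"

definition Mor :: "('o, 'm, 'x) cat_scheme \<Rightarrow> 'o \<Rightarrow> 'o \<Rightarrow> 'm set" where
  "Mor C X Y = {f \<in> arr C. src C f = X \<and> tgt C f = Y}"

locale category =
  fixes C :: "('o, 'm, 'x) cat_scheme" (structure)
  assumes src_in: "f \<in> arr C \<Longrightarrow> src C f \<in> obj C"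
    and tgt_in: "f \<in> arr C \<Longrightarrow> tgt C f \<in> obj C"
    and id_in: "X \<in> obj C \<Longrightarrow> idm C X \<in> Mor C X X"
    and comp_in: "\<lbrakk>f \<in> Mor C X Y; g \<in> Mor C Y Z\<rbrakk> \<Longrightarrow> g \<cdot> f \<in> Mor C X Z"
    and id_left: "f \<in> Mor C X Y \<Longrightarrow> idm C Y \<cdot> f = f"
    and id_right: "f \<in> Mor C X Y \<Longrightarrow> f \<cdot> idm C X = f"
    and assoc: "\<lbrakk>f \<in> Mor C W X; g \<in> Mor C X Y; h \<in> Mor C Y Z\<rbrakk> \<Longrightarrow> (h \<cdot> g) \<cdot> f = h \<cdot> (g \<cdot> f)"

record ('o, 'm, 'p, 'n) func =
  fob :: "'o \<Rightarrow> 'p"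
  far :: "'m \<Rightarrow> 'n"

definition is_functor ::
  "('o, 'm, 'x) cat_scheme \<Rightarrow> ('p, 'n, 'y) cat_scheme \<Rightarrow> ('o, 'm, 'p, 'n) func \<Rightarrow> bool" where
  "is_functor C D F \<longleftrightarrow>
     (\<forall>X\<in>obj C. fob F X \<in> obj D \<and> far F (idm C X) = idm D (fob F X)) \<and>
     (\<forall>X\<in>obj C. \<forall>Y\<in>obj C. \<forall>f\<in>Mor C X Y. far F f \<in> Mor D (fob F X) (fob F Y)) \<and>
     (\<forall>X\<in>obj C. \<forall>Y\<in>obj C. \<forall>Z\<in>obj C. \<forall>f\<in>Mor C X Y. \<forall>g\<in>Mor C Y Z.
        far F (g \<cdot>\<^bsub>C\<^esub> f) = far F g \<cdot>\<^bsub>D\<^esub> far F f)"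

definition id_func :: "('o, 'm, 'o, 'm) func" where
  "id_func = \<lparr>fob = (\<lambda>X. X), far = (\<lambda>f. f)\<rparr>"

definition comp_func ::
  "('p, 'n, 'q, 'k) func \<Rightarrow> ('o, 'm, 'p, 'n) func \<Rightarrow> ('o, 'm, 'q, 'k) func"  (infixr \<open>\<circ>\<^sub>F\<close> 55) where
  "G \<circ>\<^sub>F F = \<lparr>fob = fob G \<circ> fob F, far = far G \<circ> far F\<rparr>"

definition faithful ::
  "('o, 'm, 'x) cat_scheme \<Rightarrow> ('p, 'n, 'y) cat_scheme \<Rightarrow> ('o, 'm, 'p, 'n) func \<Rightarrow> bool" where
  "faithful C D F \<longleftrightarrow> (\<forall>X\<in>obj C. \<forall>Y\<in>obj C. inj_on (far F) (Mor C X Y))"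

definition is_iso :: "('o, 'm, 'x) cat_scheme \<Rightarrow> 'm \<Rightarrow> bool" where
  "is_iso C f \<longleftrightarrow> f \<in> arr C \<and>
     (\<exists>g\<in>Mor C (tgt C f) (src C f). g \<cdot>\<^bsub>C\<^esub> f = idm C (src C f) \<and> f \<cdot>\<^bsub>C\<^esub> g = idm C (tgt C f))"

definition isomorphic :: "('o, 'm, 'x) cat_scheme \<Rightarrow> 'o \<Rightarrow> 'o \<Rightarrow> bool" where
  "isomorphic C X Y \<longleftrightarrow> (\<exists>f\<in>Mor C X Y. is_iso C f)"

definition nat_isomorphic ::
  "('o, 'm, 'x) cat_scheme \<Rightarrow> ('p, 'n, 'y) cat_scheme \<Rightarrow>
   ('o, 'm, 'p, 'n) func \<Rightarrow> ('o, 'm, 'p, 'n) func \<Rightarrow> bool" where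
  "nat_isomorphic C D F G \<longleftrightarrow>
     (\<exists>\<eta>. (\<forall>X\<in>obj C. \<eta> X \<in> Mor D (fob F X) (fob G X) \<and> is_iso D (\<eta> X)) \<and>
          (\<forall>X\<in>obj C. \<forall>Y\<in>obj C. \<forall>f\<in>Mor C X Y.
             far G f \<cdot>\<^bsub>D\<^esub> \<eta> X = \<eta> Y \<cdot>\<^bsub>D\<^esub> far F f))"

definition equivalence ::
  "('o, 'm, 'x) cat_scheme \<Rightarrow> ('p, 'n, 'y) cat_scheme \<Rightarrow> ('o, 'm, 'p, 'n) func \<Rightarrow> bool" where
  "equivalence C D F \<longleftrightarrow> is_functor C D F \<and>
     (\<exists>S. is_functor D C S \<and>
          nat_isomorphic C C (S \<circ>\<^sub>F F) id_func \<and> nat_isomorphic D D (F \<circ>\<^sub>F S) id_func)"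

abbreviation autoequivalence :: "('o, 'm, 'x) cat_scheme \<Rightarrow> ('o, 'm, 'o, 'm) func \<Rightarrow> bool" where
  "autoequivalence C F \<equiv> equivalence C C F"

text \<open>In \<open>adjoint_pair C D F G\<close> the functor \<open>F\<close> from \<open>C\<close> to \<open>D\<close> is the left adjoint.\<close>

definition adjoint_pair ::
  "('o, 'm, 'x) cat_scheme \<Rightarrow> ('p, 'n, 'y) cat_scheme \<Rightarrow>
   ('o, 'm, 'p, 'n) func \<Rightarrow> ('p, 'n, 'o, 'm) func \<Rightarrow> bool" where
  "adjoint_pair C D F G \<longleftrightarrow> is_functor C D F \<and> is_functor D C G \<and>
     (\<exists>\<phi>. (\<forall>X\<in>obj C. \<forall>Y\<in>obj D.
             bij_betw (\<phi> X Y) (Mor D (fob F X) Y) (Mor C X (fob G Y))) \<and>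
          (\<forall>X\<in>obj C. \<forall>X'\<in>obj C. \<forall>Y\<in>obj D. \<forall>Y'\<in>obj D.
             \<forall>u\<in>Mor C X' X. \<forall>f\<in>Mor D (fob F X) Y. \<forall>v\<in>Mor D Y Y'.
               \<phi> X' Y' (v \<cdot>\<^bsub>D\<^esub> f \<cdot>\<^bsub>D\<^esub> far F u) = far G v \<cdot>\<^bsub>C\<^esub> \<phi> X Y f \<cdot>\<^bsub>C\<^esub> u))"

definition frobenius_pair_of_type ::
  "('o, 'm, 'x) cat_scheme \<Rightarrow> ('p, 'n, 'y) cat_scheme \<Rightarrow>
   ('o, 'm, 'o, 'm) func \<Rightarrow> ('p, 'n, 'p, 'n) func \<Rightarrow>
   ('o, 'm, 'p, 'n) func \<Rightarrow> ('p, 'n, 'o, 'm) func \<Rightarrow> bool" where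
  "frobenius_pair_of_type A B \<alpha> \<beta> F G \<longleftrightarrow>
     adjoint_pair A B F G \<and> adjoint_pair B A G (\<beta> \<circ>\<^sub>F F \<circ>\<^sub>F \<alpha>)"

definition frobenius_pair ::
  "('o, 'm, 'x) cat_scheme \<Rightarrow> ('p, 'n, 'y) cat_scheme \<Rightarrow>
   ('o, 'm, 'p, 'n) func \<Rightarrow> ('p, 'n, 'o, 'm) func \<Rightarrow> bool" where
  "frobenius_pair A B F G \<longleftrightarrow>
     (\<exists>\<alpha> \<beta>. autoequivalence A \<alpha> \<and> autoequivalence B \<beta> \<and> frobenius_pair_of_type A B \<alpha> \<beta> F G)"

definition is_mono :: "('o, 'm, 'x) cat_scheme \<Rightarrow> 'm \<Rightarrow> bool" where
  "is_mono C f \<longleftrightarrow> f \<in> arr C \<and>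
     (\<forall>W\<in>obj C. \<forall>g\<in>Mor C W (src C f). \<forall>h\<in>Mor C W (src C f). f \<cdot>\<^bsub>C\<^esub> g = f \<cdot>\<^bsub>C\<^esub> h \<longrightarrow> g = h)"

definition is_epi :: "('o, 'm, 'x) cat_scheme \<Rightarrow> 'm \<Rightarrow> bool" where
  "is_epi C f \<longleftrightarrow> f \<in> arr C \<and>
     (\<forall>Z\<in>obj C. \<forall>g\<in>Mor C (tgt C f) Z. \<forall>h\<in>Mor C (tgt C f) Z. g \<cdot>\<^bsub>C\<^esub> f = h \<cdot>\<^bsub>C\<^esub> f \<longrightarrow> g = h)"

definition is_zero_object :: "('o, 'm, 'x) cat_scheme \<Rightarrow> 'o \<Rightarrow> bool" where
  "is_zero_object C Z \<longleftrightarrow> Z \<in> obj C \<and>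
     (\<forall>X\<in>obj C. (\<exists>!f. f \<in> Mor C X Z) \<and> (\<exists>!f. f \<in> Mor C Z X))"

definition hom_group :: "('o, 'm, 'x) addcat_scheme \<Rightarrow> 'o \<Rightarrow> 'o \<Rightarrow> 'm monoid" where
  "hom_group C X Y = \<lparr>carrier = Mor C X Y, mult = madd C, one = mzero C X Y\<rparr>"

definition is_kernel :: "('o, 'm, 'x) addcat_scheme \<Rightarrow> 'm \<Rightarrow> 'm \<Rightarrow> bool" where
  "is_kernel C f k \<longleftrightarrow> f \<in> arr C \<and> k \<in> arr C \<and> tgt C k = src C f \<and>
     f \<cdot>\<^bsub>C\<^esub> k = mzero C (src C k) (tgt C f) \<and>
     (\<forall>W\<in>obj C. \<forall>h\<in>Mor C W (src C f). f \<cdot>\<^bsub>C\<^esub> h = mzero C W (tgt C f) \<longrightarrow>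
        (\<exists>!u. u \<in> Mor C W (src C k) \<and> k \<cdot>\<^bsub>C\<^esub> u = h))"

definition is_cokernel :: "('o, 'm, 'x) addcat_scheme \<Rightarrow> 'm \<Rightarrow> 'm \<Rightarrow> bool" where
  "is_cokernel C f c \<longleftrightarrow> f \<in> arr C \<and> c \<in> arr C \<and> src C c = tgt C f \<and>
     c \<cdot>\<^bsub>C\<^esub> f = mzero C (src C f) (tgt C c) \<and>
     (\<forall>Z\<in>obj C. \<forall>h\<in>Mor C (tgt C f) Z. h \<cdot>\<^bsub>C\<^esub> f = mzero C (src C f) Z \<longrightarrow>
        (\<exists>!u. u \<in> Mor C (tgt C c) Z \<and> u \<cdot>\<^bsub>C\<^esub> c = h))"

locale preadditive_category = category C
  for C :: "('o, 'm, 'x) addcat_scheme" (structure) +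
  assumes hom_comm_group: "\<lbrakk>X \<in> obj C; Y \<in> obj C\<rbrakk> \<Longrightarrow> comm_group (hom_group C X Y)"
    and distrib_left: "\<lbrakk>f \<in> Mor C X Y; f' \<in> Mor C X Y; g \<in> Mor C Y Z\<rbrakk> \<Longrightarrow>
      g \<cdot> madd C f f' = madd C (g \<cdot> f) (g \<cdot> f')"
    and distrib_right: "\<lbrakk>f \<in> Mor C X Y; g \<in> Mor C Y Z; g' \<in> Mor C Y Z\<rbrakk> \<Longrightarrow>
      madd C g g' \<cdot> f = madd C (g \<cdot> f) (g' \<cdot> f)"

locale abelian_category = preadditive_category C
  for C :: "('o, 'm, 'x) addcat_scheme" (structure) +
  assumes ex_zero_object: "\<exists>Z. is_zero_object C Z"
    and ex_biproduct: "\<lbrakk>X \<in> obj C; Y \<in> obj C\<rbrakk> \<Longrightarrow>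
      \<exists>S\<in>obj C. \<exists>i\<in>Mor C X S. \<exists>j\<in>Mor C Y S. \<exists>p\<in>Mor C S X. \<exists>q\<in>Mor C S Y.
        p \<cdot> i = idm C X \<and> q \<cdot> j = idm C Y \<and> q \<cdot> i = mzero C X Y \<and> p \<cdot> j = mzero C Y X \<and>
        madd C (i \<cdot> p) (j \<cdot> q) = idm C S"
    and ex_kernel: "f \<in> arr C \<Longrightarrow> \<exists>k. is_kernel C f k"
    and ex_cokernel: "f \<in> arr C \<Longrightarrow> \<exists>c. is_cokernel C f c"
    and mono_is_kernel: "is_mono C f \<Longrightarrow> \<exists>g. is_kernel C g f"
    and epi_is_cokernel: "is_epi C f \<Longrightarrow> \<exists>g. is_cokernel C g f"

definition additive_functor ::
  "('o, 'm, 'x) addcat_scheme \<Rightarrow> ('p, 'n, 'y) addcat_scheme \<Rightarrow> ('o, 'm, 'p, 'n) func \<Rightarrow> bool" where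
  "additive_functor C D F \<longleftrightarrow> is_functor C D F \<and>
     (\<forall>X\<in>obj C. \<forall>Y\<in>obj C. far F \<in> hom (hom_group C X Y) (hom_group D (fob F X) (fob F Y)))"

definition is_image :: "('o, 'm, 'x) addcat_scheme \<Rightarrow> 'm \<Rightarrow> 'm \<Rightarrow> bool" where
  "is_image C f i \<longleftrightarrow> (\<exists>c. is_cokernel C f c \<and> is_kernel C c i)"

definition exact_at :: "('o, 'm, 'x) addcat_scheme \<Rightarrow> 'm \<Rightarrow> 'm \<Rightarrow> bool" where
  "exact_at C f g \<longleftrightarrow> f \<in> arr C \<and> g \<in> arr C \<and> tgt C f = src C g \<and>
     (\<exists>i. is_image C f i \<and> is_kernel C g i)"

definition projectives :: "('o, 'm, 'x) cat_scheme \<Rightarrow> 'o set" where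
  "projectives C = {P \<in> obj C. \<forall>e f. is_epi C e \<and> f \<in> Mor C P (tgt C e) \<longrightarrow>
     (\<exists>g\<in>Mor C P (src C e). e \<cdot>\<^bsub>C\<^esub> g = f)}"

definition enough_projectives :: "('o, 'm, 'x) cat_scheme \<Rightarrow> bool" where
  "enough_projectives C \<longleftrightarrow> (\<forall>X\<in>obj C. \<exists>P\<in>projectives C. \<exists>e\<in>Mor C P X. is_epi C e)"

definition left_projective_approximation :: "('o, 'm, 'x) cat_scheme \<Rightarrow> 'm \<Rightarrow> bool" where
  "left_projective_approximation C f \<longleftrightarrow> f \<in> arr C \<and> tgt C f \<in> projectives C \<and>
     (\<forall>Q\<in>projectives C. \<forall>h\<in>Mor C (src C f) Q. \<exists>g\<in>Mor C (tgt C f) Q. h = g \<cdot>\<^bsub>C\<^esub> f)"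

text \<open>
  Full subcategories are represented by their sets of objects.  Only the values of \<open>P\<close> and \<open>f\<close> at
  the indices \<open>1, \<dots>, n\<close> matter, and \<open>torsionfree\<close> is only meant for \<open>n \<ge> 1\<close>.
\<close>

definition torsionfree :: "('o, 'm, 'x) addcat_scheme \<Rightarrow> nat \<Rightarrow> 'o set" where
  "torsionfree C n = {M \<in> obj C. \<exists>P f Z.
     is_zero_object C Z \<and>
     (\<forall>i\<in>{1..n}. P i \<in> projectives C) \<and>
     f 1 \<in> Mor C M (P 1) \<and>
     (\<forall>i\<in>{1..<n}. f (Suc i) \<in> Mor C (P i) (P (Suc i))) \<and>
     exact_at C (mzero C Z M) (f 1) \<and>
     (\<forall>i\<in>{1..<n}. exact_at C (f i) (f (Suc i))) \<and>
     (\<forall>i\<in>{1..n}. \<exists>j. is_image C (f i) j \<and> left_projective_approximation C j)}"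

definition inf_torsionfree :: "('o, 'm, 'x) addcat_scheme \<Rightarrow> 'o set" where
  "inf_torsionfree C = (\<Inter>n\<in>{1..}. torsionfree C n)"

text \<open>Complexes are cohomologically graded: the differential \<open>d i\<close> goes from \<open>X i\<close> to \<open>X (i + 1)\<close>.\<close>

definition is_complex ::
  "('o, 'm, 'x) addcat_scheme \<Rightarrow> (int \<Rightarrow> 'o) \<Rightarrow> (int \<Rightarrow> 'm) \<Rightarrow> bool" where
  "is_complex C X d \<longleftrightarrow> (\<forall>i. X i \<in> obj C \<and> d i \<in> Mor C (X i) (X (i + 1)) \<and>
     d (i + 1) \<cdot>\<^bsub>C\<^esub> d i = mzero C (X i) (X (i + 2)))"

definition acyclic_complex ::
  "('o, 'm, 'x) addcat_scheme \<Rightarrow> (int \<Rightarrow> 'o) \<Rightarrow> (int \<Rightarrow> 'm) \<Rightarrow> bool" where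
  "acyclic_complex C X d \<longleftrightarrow> is_complex C X d \<and> (\<forall>i. exact_at C (d i) (d (i + 1)))"

text \<open>Acyclicity of the complex of abelian groups obtained by applying \<open>Hom(-, P)\<close>.\<close>

definition hom_acyclic ::
  "('o, 'm, 'x) addcat_scheme \<Rightarrow> (int \<Rightarrow> 'o) \<Rightarrow> (int \<Rightarrow> 'm) \<Rightarrow> 'o \<Rightarrow> bool" where
  "hom_acyclic C X d P \<longleftrightarrow> (\<forall>i.
     kernel (hom_group C (X (i + 1)) P) (hom_group C (X i) P) (\<lambda>g. g \<cdot>\<^bsub>C\<^esub> d i) =
     (\<lambda>g. g \<cdot>\<^bsub>C\<^esub> d (i + 1)) ` carrier (hom_group C (X (i + 2)) P))"

definition totally_acyclic ::
  "('o, 'm, 'x) addcat_scheme \<Rightarrow> (int \<Rightarrow> 'o) \<Rightarrow> (int \<Rightarrow> 'm) \<Rightarrow> bool" where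
  "totally_acyclic C X d \<longleftrightarrow> acyclic_complex C X d \<and> (\<forall>i. X i \<in> projectives C) \<and>
     (\<forall>P\<in>projectives C. hom_acyclic C X d P)"

definition gorenstein_projective :: "('o, 'm, 'x) addcat_scheme \<Rightarrow> 'o \<Rightarrow> bool" where
  "gorenstein_projective C M \<longleftrightarrow> M \<in> obj C \<and>
     (\<exists>X d k. totally_acyclic C X d \<and> is_kernel C (d 0) k \<and> isomorphic C M (src C k))"

end

theory Submission
  imports Defs
begin

text \<open>
  Call a short exact sequence \<open>0 \<rightarrow> M \<rightarrow> P \<rightarrow> N \<rightarrow> 0\<close> whose first map is a left projective approximation a
  step from \<open>M\<close> to \<open>N\<close>.  An object is \<open>n\<close>-torsionfree iff \<open>n\<close> successive steps start at it, and
  Gorenstein projective iff it lies in a class in which every object has a step to and a step from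
  another member.  Since \<open>F\<close> is left adjoint to \<open>G\<close>, which is left adjoint to \<open>\<beta> F \<alpha>\<close>, both functors
  preserve projectives and \<open>F\<close> preserves steps.

  Let \<open>F\<close> be faithful.  Every projective of \<open>A\<close> is then a direct summand of some \<open>G Q\<close> with \<open>Q\<close>
  projective, so that a monic approximation \<open>F X \<rightarrow> Q\<close> has as transpose a monic approximation
  \<open>X \<rightarrow> G Q\<close>.  A step from \<open>F X\<close> to \<open>N\<close> thus yields a step from \<open>X\<close> to some \<open>Y\<close>, and a comparison of
  approximations in the manner of Schanuel's lemma shows that \<open>F Y\<close> and \<open>N\<close> agree up to projective
  summands.  As steps can be transported along such stable retracts, one can iterate.
\<close>

section \<open>Calculus in abelian categories\<close>

text \<open>A faithful \<open>F\<close> does not let the sequence chosen over \<open>F X\<close> be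
  pulled back as it stands: its projectives need not come from \<open>A\<close>, and after one
  lifted step the ends \<open>F Y\<close> and \<open>N\<close> need not be isomorphic. Hence the
  weak relation \<open>stable_retract\<close>: an identity written as a map through the other object
  plus a map through a projective. Only one composite has to be computed, where Schanuel's
  isomorphism would ask for both and for explicit sums; and the relation survives passing to either
  end of a step, which is all that the iteration uses. Projectives are governed by epis: a left
  adjoint preserves projectives as soon as its right adjoint preserves epis. \<open>G\<close>
  preserves epis as a left adjoint, and \<open>\<beta> F \<alpha>\<close> does because
  \<open>F\<close> is a left adjoint and equivalences preserve epis. The \<open>Q\<close> with
  \<open>P\<close> a summand of \<open>G Q\<close> is \<open>\<beta> F \<alpha> P\<close>, with the
  counit as projection. Transposition yields steps out of an object only. For steps into it, the
  kernel of an arbitrary epi from a projective is taken; the comparison shows that its inclusion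
  becomes an approximation under \<open>F\<close>, and this property is reflected.\<close>

context category
begin

lemma MorI [intro]: "\<lbrakk>f \<in> arr C; src C f = X; tgt C f = Y\<rbrakk> \<Longrightarrow> f \<in> Mor C X Y"
  by (simp add: Mor_def)

lemma MorD:
  assumes "f \<in> Mor C X Y"
  shows "f \<in> arr C" "src C f = X" "tgt C f = Y" "X \<in> obj C" "Y \<in> obj C"
  using assms src_in tgt_in by (auto simp: Mor_def)

lemma arr_Mor: "f \<in> arr C \<Longrightarrow> f \<in> Mor C (src C f) (tgt C f)"
  by (simp add: Mor_def)

declare src_in [simp] tgt_in [simp]

lemma id_simps [simp]:
  assumes "X \<in> obj C"
  shows "idm C X \<in> arr C" "src C (idm C X) = X" "tgt C (idm C X) = X"
  using id_in [OF assms] by (auto simp: Mor_def)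

lemma comp_simps [simp]:
  assumes "f \<in> arr C" "g \<in> arr C" "tgt C f = src C g"
  shows "g \<cdot> f \<in> arr C" "src C (g \<cdot> f) = src C f" "tgt C (g \<cdot> f) = tgt C g"
  using comp_in [of f "src C f" "src C g" g "tgt C g"] assms by (auto simp: Mor_def)

lemma id_comp [simp]:
  assumes "f \<in> arr C"
  shows "tgt C f = Y \<Longrightarrow> idm C Y \<cdot> f = f" "src C f = X \<Longrightarrow> f \<cdot> idm C X = f"
  using assms id_left id_right by (auto simp: Mor_def)

lemma comp_assoc [simp]:
  assumes "f \<in> arr C" "g \<in> arr C" "h \<in> arr C" "tgt C f = src C g" "tgt C g = src C h"
  shows "(h \<cdot> g) \<cdot> f = h \<cdot> (g \<cdot> f)"
  using assoc [of f "src C f" "src C g" g "src C h" h "tgt C h"] assms by (auto simp: Mor_def)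

lemma monoD:
  assumes "is_mono C f" "g \<in> arr C" "h \<in> arr C" "tgt C g = src C f" "tgt C h = src C f"
    "src C g = src C h" "f \<cdot> g = f \<cdot> h"
  shows "g = h"
proof -
  have "g \<in> Mor C (src C g) (src C f)" "h \<in> Mor C (src C g) (src C f)"
    using assms by (auto simp: Mor_def)
  then show ?thesis
    using assms(1,7) MorD(4) unfolding is_mono_def by blast
qed

lemma epiD:
  assumes "is_epi C f" "g \<in> arr C" "h \<in> arr C" "src C g = tgt C f" "src C h = tgt C f"
    "tgt C g = tgt C h" "g \<cdot> f = h \<cdot> f"
  shows "g = h"
proof -
  have "g \<in> Mor C (tgt C f) (tgt C g)" "h \<in> Mor C (tgt C f) (tgt C g)"
    using assms by (auto simp: Mor_def)
  then show ?thesis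
    using assms(1,7) MorD(5) unfolding is_epi_def by blast
qed

lemma monoI:
  assumes "f \<in> arr C"
    and "\<And>g h. \<lbrakk>g \<in> arr C; h \<in> arr C; tgt C g = src C f; tgt C h = src C f; src C g = src C h;
           f \<cdot> g = f \<cdot> h\<rbrakk> \<Longrightarrow> g = h"
  shows "is_mono C f"
  using assms unfolding is_mono_def Mor_def by auto

lemma epiI:
  assumes "f \<in> arr C"
    and "\<And>g h. \<lbrakk>g \<in> arr C; h \<in> arr C; src C g = tgt C f; src C h = tgt C f; tgt C g = tgt C h;
           g \<cdot> f = h \<cdot> f\<rbrakk> \<Longrightarrow> g = h"
  shows "is_epi C f"
  using assms unfolding is_epi_def Mor_def by auto

lemma mono_arr: "is_mono C f \<Longrightarrow> f \<in> arr C" and epi_arr: "is_epi C f \<Longrightarrow> f \<in> arr C"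
  by (auto simp: is_mono_def is_epi_def)

lemma mono_comp:
  assumes "is_mono C f" "is_mono C g" "tgt C f = src C g"
  shows "is_mono C (g \<cdot> f)"
proof (rule monoI)
  note [simp] = mono_arr [OF assms(1)] mono_arr [OF assms(2)] assms(3)
  show "g \<cdot> f \<in> arr C" by simp
  fix x y
  assume [simp]: "x \<in> arr C" "y \<in> arr C" "tgt C x = src C (g \<cdot> f)" "tgt C y = src C (g \<cdot> f)"
      "src C x = src C y" and eq: "(g \<cdot> f) \<cdot> x = (g \<cdot> f) \<cdot> y"
  have "g \<cdot> (f \<cdot> x) = g \<cdot> (f \<cdot> y)" using eq by simp
  then have "f \<cdot> x = f \<cdot> y" by - (rule monoD [OF assms(2)], auto)
  then show "x = y" by - (rule monoD [OF assms(1)], auto)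
qed

lemma split_mono:
  assumes "f \<in> Mor C X Y" "g \<in> Mor C Y X" "g \<cdot> f = idm C X"
  shows "is_mono C f"
proof (rule monoI)
  note [simp] = MorD [OF assms(1)] MorD [OF assms(2)]
  show "f \<in> arr C" by simp
  fix x y
  assume [simp]: "x \<in> arr C" "y \<in> arr C" "tgt C x = src C f" "tgt C y = src C f"
     "src C x = src C y" and eq: "f \<cdot> x = f \<cdot> y"
  have "(g \<cdot> f) \<cdot> x = (g \<cdot> f) \<cdot> y" using eq by simp
  then show "x = y" using assms(3) by simp
qed

lemma iso_mono: "is_iso C f \<Longrightarrow> is_mono C f"
  unfolding is_iso_def using split_mono arr_Mor by metis

lemma iso_epi:
  assumes "is_iso C f" shows "is_epi C f"
proof -
  obtain g where [simp]: "f \<in> arr C" and g: "g \<in> Mor C (tgt C f) (src C f)" "f \<cdot> g = idm C (tgt C f)"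
    using assms unfolding is_iso_def by blast
  note [simp] = MorD [OF g(1)]
  show ?thesis
  proof (rule epiI)
    fix x y
    assume [simp]: "x \<in> arr C" "y \<in> arr C" "src C x = tgt C f" "src C y = tgt C f"
       "tgt C x = tgt C y" and eq: "x \<cdot> f = y \<cdot> f"
    have "(x \<cdot> f) \<cdot> g = (y \<cdot> f) \<cdot> g" using eq by simp
    then show "x = y" using g(2) by simp
  qed simp
qed

lemma projectives_obj: "P \<in> projectives C \<Longrightarrow> P \<in> obj C"
  by (simp add: projectives_def)

lemma projective_lift:
  assumes "P \<in> projectives C" "is_epi C e" "f \<in> arr C" "src C f = P" "tgt C f = tgt C e"
  obtains g where "g \<in> Mor C P (src C e)" "e \<cdot> g = f"
  using assms unfolding projectives_def Mor_def by blast

lemma approximation_extend: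
  assumes "left_projective_approximation C f" "h \<in> arr C" "src C h = src C f"
    "tgt C h \<in> projectives C"
  obtains g where "g \<in> Mor C (tgt C f) (tgt C h)" "g \<cdot> f = h"
proof -
  have "h \<in> Mor C (src C f) (tgt C h)" using assms by blast
  then show thesis using assms(1,4) that unfolding left_projective_approximation_def by metis
qed

lemma approximationI:
  assumes "f \<in> arr C" "tgt C f \<in> projectives C"
    and "\<And>h. \<lbrakk>h \<in> arr C; src C h = src C f; tgt C h \<in> projectives C\<rbrakk> \<Longrightarrow>
           \<exists>g\<in>Mor C (tgt C f) (tgt C h). g \<cdot> f = h"
  shows "left_projective_approximation C f"
  unfolding left_projective_approximation_def
proof (intro conjI ballI)
  fix Q h assume "Q \<in> projectives C" "h \<in> Mor C (src C f) Q"
  then show "\<exists>g\<in>Mor C (tgt C f) Q. h = g \<cdot> f" using assms(3) [of h] by (auto simp: Mor_def)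
qed (use assms in auto)

end

section \<open>Sums and zero maps, kernels and cokernels in preadditive categories\<close>

context preadditive_category
begin

lemma zero_simps [simp]:
  assumes "X \<in> obj C" "Y \<in> obj C"
  shows "mzero C X Y \<in> arr C" "src C (mzero C X Y) = X" "tgt C (mzero C X Y) = Y"
proof -
  interpret H: comm_group "hom_group C X Y" using hom_comm_group assms by blast
  have "mzero C X Y \<in> Mor C X Y" using H.one_closed by (simp add: hom_group_def)
  then show "mzero C X Y \<in> arr C" "src C (mzero C X Y) = X" "tgt C (mzero C X Y) = Y"
    by (auto simp: Mor_def)
qed

lemma madd_simps [simp]:
  assumes "f \<in> arr C" "g \<in> arr C" "src C f = src C g" "tgt C f = tgt C g"
  shows "madd C f g \<in> arr C" "src C (madd C f g) = src C g" "tgt C (madd C f g) = tgt C g"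
proof -
  interpret H: comm_group "hom_group C (src C g) (tgt C g)" using hom_comm_group assms by simp
  have "madd C f g \<in> Mor C (src C g) (tgt C g)"
    using H.m_closed [of f g] assms by (simp add: hom_group_def Mor_def)
  then show "madd C f g \<in> arr C" "src C (madd C f g) = src C g" "tgt C (madd C f g) = tgt C g"
    by (auto simp: Mor_def)
qed

lemma madd_zero [simp]:
  assumes "f \<in> arr C" "src C f = X" "tgt C f = Y"
  shows "madd C f (mzero C X Y) = f" "madd C (mzero C X Y) f = f"
proof -
  interpret H: comm_group "hom_group C X Y" using hom_comm_group assms by auto
  show "madd C f (mzero C X Y) = f" "madd C (mzero C X Y) f = f"
    using H.r_one [of f] H.l_one [of f] assms by (simp_all add: hom_group_def Mor_def)
qed

text \<open>The record carries no negation; a difference is built from the inverse in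
  \<open>hom_group\<close> and used only through the equation \<open>madd C g d = f\<close>.\<close>

lemma madd_diff:
  assumes "f \<in> arr C" "g \<in> arr C" "src C f = src C g" "tgt C f = tgt C g"
  obtains d where "d \<in> Mor C (src C g) (tgt C g)" "madd C g d = f"
proof -
  interpret H: comm_group "hom_group C (src C g) (tgt C g)" using hom_comm_group assms by simp
  let ?H = "hom_group C (src C g) (tgt C g)"
  have c: "f \<in> carrier ?H" "g \<in> carrier ?H" using assms by (auto simp: hom_group_def Mor_def)
  have "inv\<^bsub>?H\<^esub> g \<otimes>\<^bsub>?H\<^esub> f \<in> carrier ?H" "g \<otimes>\<^bsub>?H\<^esub> (inv\<^bsub>?H\<^esub> g \<otimes>\<^bsub>?H\<^esub> f) = f"
    using c by (simp_all flip: H.m_assoc)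
  then show thesis by (intro that) (auto simp: hom_group_def)
qed

lemma madd_cancel:
  assumes "f \<in> arr C" "g \<in> arr C" "src C f = src C g" "tgt C f = tgt C g" "madd C g f = g"
  shows "f = mzero C (src C g) (tgt C g)"
proof -
  interpret H: comm_group "hom_group C (src C g) (tgt C g)" using hom_comm_group assms by simp
  show ?thesis
    using H.r_cancel_one [of g f] H.l_cancel_one [of g f] H.r_cancel_one' [of g f]
      H.l_cancel_one' [of g f] assms
    by (auto simp: hom_group_def Mor_def)
qed

lemma comp_madd [simp]:
  assumes "f \<in> arr C" "f' \<in> arr C" "g \<in> arr C" "src C f = src C f'" "tgt C f = src C g"
    "tgt C f' = src C g"
  shows "g \<cdot> madd C f f' = madd C (g \<cdot> f) (g \<cdot> f')"
  using distrib_left [of f "src C f'" "src C g" f' g "tgt C g"] assms by (simp add: Mor_def)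

lemma madd_comp [simp]:
  assumes "f \<in> arr C" "g \<in> arr C" "g' \<in> arr C" "tgt C f = src C g" "src C g = src C g'"
    "tgt C g = tgt C g'"
  shows "madd C g g' \<cdot> f = madd C (g \<cdot> f) (g' \<cdot> f)"
  using distrib_right [of f "src C f" "src C g'" g "tgt C g'" g'] assms by (simp add: Mor_def)

lemma comp_zero [simp]:
  assumes "g \<in> arr C" "src C g = Y" "X \<in> obj C"
  shows "g \<cdot> mzero C X Y = mzero C X (tgt C g)"
proof -
  have Y: "Y \<in> obj C" using assms src_in by blast
  let ?z = "mzero C X Y"
  have z: "madd C ?z ?z = ?z" using assms Y by simp
  have "madd C (g \<cdot> ?z) (g \<cdot> ?z) = g \<cdot> madd C ?z ?z"
    using assms Y by (intro comp_madd [symmetric]) simp_all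
  also have "\<dots> = g \<cdot> ?z" by (simp only: z)
  finally show ?thesis
    using madd_cancel [of "g \<cdot> ?z" "g \<cdot> ?z"] assms Y by simp
qed

lemma zero_comp [simp]:
  assumes "f \<in> arr C" "tgt C f = Y" "Z \<in> obj C"
  shows "mzero C Y Z \<cdot> f = mzero C (src C f) Z"
proof -
  have Y: "Y \<in> obj C" using assms tgt_in by blast
  let ?z = "mzero C Y Z"
  have z: "madd C ?z ?z = ?z" using assms Y by simp
  have "madd C (?z \<cdot> f) (?z \<cdot> f) = madd C ?z ?z \<cdot> f"
    using assms Y by (intro madd_comp [symmetric]) simp_all
  also have "\<dots> = ?z \<cdot> f" by (simp only: z)
  finally show ?thesis
    using madd_cancel [of "?z \<cdot> f" "?z \<cdot> f"] assms Y by simp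
qed

lemma kernelD:
  assumes "is_kernel C f k"
  shows "f \<in> arr C" "k \<in> arr C" "tgt C k = src C f" "f \<cdot> k = mzero C (src C k) (tgt C f)"
  using assms by (auto simp: is_kernel_def)

lemma cokernelD:
  assumes "is_cokernel C f c"
  shows "f \<in> arr C" "c \<in> arr C" "src C c = tgt C f" "c \<cdot> f = mzero C (src C f) (tgt C c)"
  using assms by (auto simp: is_cokernel_def)

lemma kernel_factor:
  assumes "is_kernel C f k" "h \<in> arr C" "tgt C h = src C f" "f \<cdot> h = mzero C (src C h) (tgt C f)"
  obtains u where "u \<in> Mor C (src C h) (src C k)" "k \<cdot> u = h"
proof -
  have "h \<in> Mor C (src C h) (src C f)" "src C h \<in> obj C" using assms by (auto simp: Mor_def)
  then show thesis using assms that unfolding is_kernel_def by blast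
qed

lemma cokernel_factor:
  assumes "is_cokernel C f c" "h \<in> arr C" "src C h = tgt C f" "h \<cdot> f = mzero C (src C f) (tgt C h)"
  obtains u where "u \<in> Mor C (tgt C c) (tgt C h)" "u \<cdot> c = h"
proof -
  have "h \<in> Mor C (tgt C f) (tgt C h)" "tgt C h \<in> obj C" using assms by (auto simp: Mor_def)
  then show thesis using assms that unfolding is_cokernel_def by blast
qed

lemma kernel_mono:
  assumes "is_kernel C f k" shows "is_mono C k"
proof (rule monoI)
  note [simp] = kernelD [OF assms]
  show "k \<in> arr C" by simp
  fix g h
  assume [simp]: "g \<in> arr C" "h \<in> arr C" "tgt C g = src C k" "tgt C h = src C k"
      "src C g = src C h" and eq: "k \<cdot> g = k \<cdot> h"
  have "f \<cdot> (k \<cdot> h) = (f \<cdot> k) \<cdot> h" by (simp del: kernelD(4)[OF assms])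
  then have 0: "f \<cdot> (k \<cdot> h) = mzero C (src C h) (tgt C f)" by simp
  have "k \<cdot> h \<in> Mor C (src C h) (src C f)" "src C h \<in> obj C" by auto
  then have ex1: "\<exists>!u. u \<in> Mor C (src C h) (src C k) \<and> k \<cdot> u = k \<cdot> h"
    using assms 0 unfolding is_kernel_def by blast
  have "g \<in> Mor C (src C h) (src C k)" "h \<in> Mor C (src C h) (src C k)" by auto
  then show "g = h" using ex1 eq by blast
qed

lemma cokernel_epi:
  assumes "is_cokernel C f c" shows "is_epi C c"
proof (rule epiI)
  note [simp] = cokernelD [OF assms]
  show "c \<in> arr C" by simp
  fix g h
  assume [simp]: "g \<in> arr C" "h \<in> arr C" "src C g = tgt C c" "src C h = tgt C c"
      "tgt C g = tgt C h" and eq: "g \<cdot> c = h \<cdot> c"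
  have 0: "(h \<cdot> c) \<cdot> f = mzero C (src C f) (tgt C h)" by simp
  have "h \<cdot> c \<in> Mor C (tgt C f) (tgt C h)" "tgt C h \<in> obj C" by auto
  then have ex1: "\<exists>!u. u \<in> Mor C (tgt C c) (tgt C h) \<and> u \<cdot> c = h \<cdot> c"
    using assms 0 unfolding is_cokernel_def by blast
  have "g \<in> Mor C (tgt C c) (tgt C h)" "h \<in> Mor C (tgt C c) (tgt C h)" by auto
  then show "g = h" using ex1 eq by blast
qed

lemma is_kernelI:
  assumes "is_mono C k" "f \<in> arr C" "tgt C k = src C f" "f \<cdot> k = mzero C (src C k) (tgt C f)"
    and "\<And>h. \<lbrakk>h \<in> arr C; tgt C h = src C f; f \<cdot> h = mzero C (src C h) (tgt C f)\<rbrakk> \<Longrightarrow>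
           \<exists>u\<in>Mor C (src C h) (src C k). k \<cdot> u = h"
  shows "is_kernel C f k"
  unfolding is_kernel_def
proof (intro conjI ballI impI)
  fix W h
  assume h: "h \<in> Mor C W (src C f)" "f \<cdot> h = mzero C W (tgt C f)"
  note [simp] = MorD [OF h(1)] mono_arr [OF assms(1)]
  obtain u where u: "u \<in> Mor C W (src C k)" "k \<cdot> u = h" using assms(5) [of h] h by auto
  show "\<exists>!u. u \<in> Mor C W (src C k) \<and> k \<cdot> u = h"
  proof (rule ex1I [of _ u])
    fix v assume "v \<in> Mor C W (src C k) \<and> k \<cdot> v = h"
    then show "v = u" using u by - (rule monoD [OF assms(1)], auto simp: Mor_def)
  qed (use u in blast)
qed (use assms mono_arr in auto)

lemma is_cokernelI:
  assumes "is_epi C c" "f \<in> arr C" "src C c = tgt C f" "c \<cdot> f = mzero C (src C f) (tgt C c)"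
    and "\<And>h. \<lbrakk>h \<in> arr C; src C h = tgt C f; h \<cdot> f = mzero C (src C f) (tgt C h)\<rbrakk> \<Longrightarrow>
           \<exists>u\<in>Mor C (tgt C c) (tgt C h). u \<cdot> c = h"
  shows "is_cokernel C f c"
  unfolding is_cokernel_def
proof (intro conjI ballI impI)
  fix W h
  assume h: "h \<in> Mor C (tgt C f) W" "h \<cdot> f = mzero C (src C f) W"
  note [simp] = MorD [OF h(1)] epi_arr [OF assms(1)]
  obtain u where u: "u \<in> Mor C (tgt C c) W" "u \<cdot> c = h" using assms(5) [of h] h by auto
  show "\<exists>!u. u \<in> Mor C (tgt C c) W \<and> u \<cdot> c = h"
  proof (rule ex1I [of _ u])
    fix v assume "v \<in> Mor C (tgt C c) W \<and> v \<cdot> c = h"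
    then show "v = u" using u by - (rule epiD [OF assms(1)], auto simp: Mor_def)
  qed (use u in blast)
qed (use assms epi_arr in auto)

text \<open>The difference of \<open>f\<close> and \<open>g\<close> is killed by \<open>e\<close>,
  so it factors through the kernel. This supplies the correction term when syzygies are
  compared.\<close>

lemma eq_madd_kernel:
  assumes "is_kernel C e k" "f \<in> arr C" "g \<in> arr C" "src C f = src C g" "tgt C f = src C e"
    "tgt C g = src C e" "e \<cdot> f = e \<cdot> g"
  obtains u where "u \<in> Mor C (src C g) (src C k)" "madd C g (k \<cdot> u) = f"
proof -
  note [simp] = kernelD [OF assms(1)] assms(2-6)
  obtain d where d: "d \<in> Mor C (src C g) (tgt C g)" "madd C g d = f"
    using madd_diff [of f g] by auto
  note [simp] = MorD [OF d(1)]
  have "madd C (e \<cdot> g) (e \<cdot> d) = e \<cdot> madd C g d" by (rule comp_madd [symmetric]) simp_all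
  also have "\<dots> = e \<cdot> g" using d(2) assms(7) by simp
  finally have "e \<cdot> d = mzero C (src C d) (tgt C e)" using madd_cancel [of "e \<cdot> d" "e \<cdot> g"] by simp
  then obtain u where "u \<in> Mor C (src C d) (src C k)" "k \<cdot> u = d"
    using kernel_factor [OF assms(1), of d] by auto
  then show thesis using d that by auto
qed

text \<open>Dual of \<open>eq_madd_kernel\<close>, for comparing cosyzygies.\<close>

lemma eq_madd_cokernel:
  assumes "is_cokernel C k e" "f \<in> arr C" "g \<in> arr C" "tgt C f = tgt C g" "src C f = tgt C k"
    "src C g = tgt C k" "f \<cdot> k = g \<cdot> k"
  obtains u where "u \<in> Mor C (tgt C e) (tgt C g)" "madd C g (u \<cdot> e) = f"
proof -
  note [simp] = cokernelD [OF assms(1)] assms(2-6)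
  obtain d where d: "d \<in> Mor C (src C g) (tgt C g)" "madd C g d = f"
    using madd_diff [of f g] by auto
  note [simp] = MorD [OF d(1)]
  have "madd C (g \<cdot> k) (d \<cdot> k) = madd C g d \<cdot> k" by (rule madd_comp [symmetric]) simp_all
  also have "\<dots> = g \<cdot> k" using d(2) assms(7) by simp
  finally have "d \<cdot> k = mzero C (src C k) (tgt C d)" using madd_cancel [of "d \<cdot> k" "g \<cdot> k"] by simp
  then obtain u where "u \<in> Mor C (tgt C e) (tgt C d)" "u \<cdot> e = d"
    using cokernel_factor [OF assms(1), of d] by auto
  then show thesis using d that by auto
qed

lemma monoI_zero:
  assumes "f \<in> arr C"
    and "\<And>g. \<lbrakk>g \<in> arr C; tgt C g = src C f; f \<cdot> g = mzero C (src C g) (tgt C f)\<rbrakk> \<Longrightarrow>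
           g = mzero C (src C g) (tgt C g)"
  shows "is_mono C f"
proof (rule monoI)
  fix g h
  assume [simp]: "g \<in> arr C" "h \<in> arr C" "tgt C g = src C f" "tgt C h = src C f"
     "src C g = src C h" and eq: "f \<cdot> g = f \<cdot> h"
  obtain d where d: "d \<in> Mor C (src C h) (tgt C h)" "madd C h d = g"
    using madd_diff [of g h] by auto
  note [simp] = MorD [OF d(1)] assms(1)
  have "madd C (f \<cdot> h) (f \<cdot> d) = f \<cdot> madd C h d" by (rule comp_madd [symmetric]) simp_all
  also have "\<dots> = f \<cdot> h" using d(2) eq by simp
  finally have "f \<cdot> d = mzero C (src C d) (tgt C f)" using madd_cancel [of "f \<cdot> d" "f \<cdot> h"] by simp
  then have "d = mzero C (src C d) (tgt C d)" using assms(2) [of d] by simp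
  then have "d = mzero C (src C h) (tgt C h)" by simp
  then have "madd C h d = h" using madd_zero(1)[of h "src C h" "tgt C h"] by simp
  then show "g = h" using d by simp
qed (use assms in simp)

lemma epiI_zero:
  assumes "f \<in> arr C"
    and "\<And>g. \<lbrakk>g \<in> arr C; src C g = tgt C f; g \<cdot> f = mzero C (src C f) (tgt C g)\<rbrakk> \<Longrightarrow>
           g = mzero C (src C g) (tgt C g)"
  shows "is_epi C f"
proof (rule epiI)
  fix g h
  assume [simp]: "g \<in> arr C" "h \<in> arr C" "src C g = tgt C f" "src C h = tgt C f"
     "tgt C g = tgt C h" and eq: "g \<cdot> f = h \<cdot> f"
  obtain d where d: "d \<in> Mor C (src C h) (tgt C h)" "madd C h d = g"
    using madd_diff [of g h] by auto
  note [simp] = MorD [OF d(1)] assms(1)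
  have "madd C (h \<cdot> f) (d \<cdot> f) = madd C h d \<cdot> f" by (rule madd_comp [symmetric]) simp_all
  also have "\<dots> = h \<cdot> f" using d(2) eq by simp
  finally have "d \<cdot> f = mzero C (src C f) (tgt C d)" using madd_cancel [of "d \<cdot> f" "h \<cdot> f"] by simp
  then have "d = mzero C (src C d) (tgt C d)" using assms(2) [of d] by simp
  then have "d = mzero C (src C h) (tgt C h)" by simp
  then have "madd C h d = h" using madd_zero(1)[of h "src C h" "tgt C h"] by simp
  then show "g = h" using d by simp
qed (use assms in simp)

end

section \<open>Exact sequences and syzygies\<close>

context abelian_category
begin

text \<open>\<open>f\<close> is the kernel of some \<open>g\<close>; since \<open>f\<close> is also
  epic, \<open>g \<cdot> f = 0\<close> forces \<open>g = 0\<close>, so the identity factors through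
  \<open>f\<close>.\<close>

lemma mono_epi_iso:
  assumes "is_mono C f" "is_epi C f"
  obtains g where "g \<in> Mor C (tgt C f) (src C f)" "g \<cdot> f = idm C (src C f)"
proof -
  obtain g where g: "is_kernel C g f" using mono_is_kernel assms(1) by blast
  note [simp] = kernelD(1,2) [OF g] kernelD(3) [OF g, symmetric]
  have "g = mzero C (src C g) (tgt C g)"
    by (rule epiD [OF assms(2)]) (simp_all add: kernelD(4) [OF g])
  then have 0: "g \<cdot> idm C (tgt C f) = mzero C (src C (idm C (tgt C f))) (tgt C g)" by simp
  obtain t where t: "t \<in> Mor C (tgt C f) (src C f)" "f \<cdot> t = idm C (tgt C f)"
    using kernel_factor [OF g _ _ 0] by auto
  note [simp] = MorD [OF t(1)]
  have "f \<cdot> (t \<cdot> f) = (f \<cdot> t) \<cdot> f" by simp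
  also have "\<dots> = f \<cdot> idm C (src C f)" using t by simp
  finally have "t \<cdot> f = idm C (src C f)" by - (rule monoD [OF assms(1)], simp_all)
  then show thesis using t that by blast
qed

text \<open>\<open>e\<close> is the cokernel of some \<open>g\<close>, and \<open>g\<close> factors
  through \<open>k\<close>; a map killing \<open>k\<close> therefore kills \<open>g\<close> and
  descends along \<open>e\<close>.\<close>

lemma epi_cokernel_of_kernel:
  assumes "is_epi C e" "is_kernel C e k"
  shows "is_cokernel C k e"
proof (rule is_cokernelI [OF assms(1)])
  note [simp] = kernelD [OF assms(2)]
  obtain g where g: "is_cokernel C g e" using epi_is_cokernel assms(1) by blast
  note c = cokernelD [OF g]
  note [simp] = c(1) c(3) [symmetric] c(4)
  obtain t where t: "t \<in> Mor C (src C g) (src C k)" "k \<cdot> t = g"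
    using kernel_factor [OF assms(2), of g] by auto
  note [simp] = MorD [OF t(1)]
  fix h assume [simp]: "h \<in> arr C" "src C h = tgt C k"
    and h: "h \<cdot> k = mzero C (src C k) (tgt C h)"
  have "h \<cdot> g = (h \<cdot> k) \<cdot> t" using t by simp
  then have "h \<cdot> g = mzero C (src C g) (tgt C h)" by (simp add: h del: comp_assoc)
  then show "\<exists>u\<in>Mor C (tgt C e) (tgt C h). u \<cdot> e = h"
    using cokernel_factor [OF g, of h] by auto
qed (simp_all add: kernelD [OF assms(2)])

lemma mono_kernel_of_cokernel:
  assumes "is_mono C k" "is_cokernel C k e"
  shows "is_kernel C e k"
proof (rule is_kernelI [OF assms(1)])
  note [simp] = cokernelD [OF assms(2)]
  obtain g where g: "is_kernel C g k" using mono_is_kernel assms(1) by blast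
  note [simp] = kernelD [OF g]
  obtain t where t: "t \<in> Mor C (tgt C e) (tgt C g)" "t \<cdot> e = g"
    using cokernel_factor [OF assms(2), of g] by auto
  note [simp] = MorD [OF t(1)]
  fix h assume [simp]: "h \<in> arr C" "tgt C h = src C e"
    and h: "e \<cdot> h = mzero C (src C h) (tgt C e)"
  have "g \<cdot> h = (t \<cdot> e) \<cdot> h" using t by simp
  then have "g \<cdot> h = t \<cdot> (e \<cdot> h)" by simp
  then have "g \<cdot> h = mzero C (src C h) (tgt C g)" by (simp add: h)
  then show "\<exists>u\<in>Mor C (src C h) (src C k). k \<cdot> u = h"
    using kernel_factor [OF g, of h] by auto
qed (simp_all add: cokernelD [OF assms(2)])

text \<open>Factoring \<open>f\<close> through the kernel \<open>j\<close> of its cokernel is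
  formal; the point is that the factor \<open>e\<close> is epic. If \<open>v\<close> kills
  \<open>e\<close>, then \<open>f\<close> already factors through \<open>j \<cdot> m\<close> with
  \<open>m\<close> the kernel of \<open>v\<close>; minimality of the image makes \<open>m\<close>
  split epic, so \<open>v = 0\<close>.\<close>

lemma is_image_factor:
  assumes "is_image C f j"
  obtains e where "is_epi C e" "e \<in> Mor C (src C f) (src C j)" "j \<cdot> e = f"
proof -
  obtain c where c: "is_cokernel C f c" and j: "is_kernel C c j"
    using assms unfolding is_image_def by blast
  note [simp] = cokernelD [OF c] kernelD [OF j]
  obtain e where e: "e \<in> Mor C (src C f) (src C j)" "j \<cdot> e = f"
    using kernel_factor [OF j, of f] by auto
  note [simp] = MorD [OF e(1)]
  have "is_epi C e"
  proof (rule epiI_zero)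
    fix v assume [simp]: "v \<in> arr C" "src C v = tgt C e" and v: "v \<cdot> e = mzero C (src C e) (tgt C v)"
    obtain m where m: "is_kernel C v m" using ex_kernel [of v] by auto
    note [simp] = kernelD [OF m]
    obtain u where u: "u \<in> Mor C (src C e) (src C m)" "m \<cdot> u = e"
      using kernel_factor [OF m, of e] v by auto
    note [simp] = MorD [OF u(1)]
    \<comment> \<open>As a mono, \<open>j \<cdot> m\<close> is the kernel of some \<open>g\<close>.
      This \<open>g\<close> kills \<open>f\<close>, hence factors through \<open>c\<close>, hence
      kills \<open>j\<close>; so \<open>j\<close> factors through
      \<open>j \<cdot> m\<close>.\<close>
    have "is_mono C (j \<cdot> m)" using mono_comp kernel_mono [OF m] kernel_mono [OF j] by simp
    then obtain g where g: "is_kernel C g (j \<cdot> m)" using mono_is_kernel by blast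
    note [simp] = kernelD(1) [OF g]
    have [simp]: "src C g = tgt C j" using kernelD(3) [OF g] by simp
    have "g \<cdot> f = (g \<cdot> (j \<cdot> m)) \<cdot> u" using e u by simp
    also have "\<dots> = mzero C (src C f) (tgt C g)" using kernelD(4)[OF g] by (simp del: comp_assoc)
    finally obtain w where w: "w \<in> Mor C (tgt C c) (tgt C g)" "w \<cdot> c = g"
      using cokernel_factor [OF c, of g] by auto
    note [simp] = MorD [OF w(1)]
    have "g \<cdot> j = w \<cdot> (c \<cdot> j)" using w(2)[symmetric] by (simp del: kernelD(4)[OF j])
    then have "g \<cdot> j = mzero C (src C j) (tgt C g)" by simp
    then obtain t where t: "t \<in> Mor C (src C j) (src C m)" "(j \<cdot> m) \<cdot> t = j"
      using kernel_factor [OF g, of j] by auto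
    note [simp] = MorD [OF t(1)]
    have "m \<cdot> t = idm C (src C j)"
      by (rule monoD [OF kernel_mono [OF j]]) (use t in simp_all)
    then have "v = v \<cdot> (m \<cdot> t)" by simp
    also have "\<dots> = (v \<cdot> m) \<cdot> t" by (simp del: kernelD(4)[OF m])
    also have "\<dots> = mzero C (src C v) (tgt C v)" by simp
    finally show "v = mzero C (src C v) (tgt C v)" .
  qed simp
  then show thesis using e that by blast
qed

text \<open>\<open>exact_at\<close> provides only one image that is a kernel of \<open>g\<close>.
  Two cokernels of \<open>f\<close> factor through each other, hence so do their kernels, and the
  property passes to the given \<open>j\<close>.\<close>

lemma is_image_kernel:
  assumes "exact_at C f g" "is_image C f j"
  shows "is_kernel C g j"
proof -
  obtain j' where j': "is_image C f j'" "is_kernel C g j'"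
    using assms(1) unfolding exact_at_def by blast
  obtain c where c: "is_cokernel C f c" and j: "is_kernel C c j"
    using assms(2) unfolding is_image_def by blast
  obtain c' where c': "is_cokernel C f c'" and k': "is_kernel C c' j'"
    using j'(1) unfolding is_image_def by blast
  note [simp] = cokernelD(1-3) [OF c] kernelD(1-3) [OF j] cokernelD(2-3) [OF c'] kernelD(1-2) [OF j'(2)]
  have [simp]: "tgt C j' = tgt C f" "src C g = tgt C f" using kernelD(3)[OF k'] kernelD(3)[OF j'(2)] by auto
  obtain u where u: "u \<in> Mor C (tgt C c) (tgt C c')" "u \<cdot> c = c'"
    using cokernel_factor [OF c, of c'] cokernelD(4)[OF c'] by auto
  obtain v where v: "v \<in> Mor C (tgt C c') (tgt C c)" "v \<cdot> c' = c"
    using cokernel_factor [OF c', of c] cokernelD(4)[OF c] by auto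
  note [simp] = MorD [OF u(1)] MorD[OF v(1)]
  have "c' \<cdot> j = u \<cdot> (c \<cdot> j)" using u(2)[symmetric] by simp
  then have "c' \<cdot> j = mzero C (src C j) (tgt C c')" by (simp add: kernelD(4)[OF j])
  then obtain w where w: "w \<in> Mor C (src C j) (src C j')" "j' \<cdot> w = j"
    using kernel_factor [OF k', of j] by auto
  have "c \<cdot> j' = v \<cdot> (c' \<cdot> j')" using v(2)[symmetric] by simp
  then have "c \<cdot> j' = mzero C (src C j') (tgt C c)" by (simp add: kernelD(4)[OF k'])
  then obtain w' where w': "w' \<in> Mor C (src C j') (src C j)" "j \<cdot> w' = j'"
    using kernel_factor [OF j, of j'] by auto
  note [simp] = MorD [OF w(1)] MorD[OF w'(1)]
  show ?thesis
  proof (rule is_kernelI [OF kernel_mono [OF j]])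
    have "g \<cdot> j = (g \<cdot> j') \<cdot> w" using w by simp
    then show "g \<cdot> j = mzero C (src C j) (tgt C g)" by (simp add: kernelD(4)[OF j'(2)] del: comp_assoc)
    fix h assume [simp]: "h \<in> arr C" "tgt C h = src C g" and h: "g \<cdot> h = mzero C (src C h) (tgt C g)"
    obtain t where t: "t \<in> Mor C (src C h) (src C j')" "j' \<cdot> t = h"
      using kernel_factor [OF j'(2), of h] h by auto
    note [simp] = MorD [OF t(1)]
    have "j \<cdot> (w' \<cdot> t) = (j \<cdot> w') \<cdot> t" by simp
    also have "\<dots> = h" using w' t by simp
    finally show "\<exists>u\<in>Mor C (src C h) (src C j). j \<cdot> u = h" by (rule bexI [OF _ MorI]) simp_all
  qed simp_all
qed

lemma kernel_unique:
  assumes "is_kernel C g k" "is_kernel C g k'"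
  obtains t t' where "t \<in> Mor C (src C k) (src C k')" "t' \<in> Mor C (src C k') (src C k)"
    "k' \<cdot> t = k" "k \<cdot> t' = k'" "t \<cdot> t' = idm C (src C k')" "t' \<cdot> t = idm C (src C k)"
proof -
  note [simp] = kernelD(1-4) [OF assms(1)] kernelD(2-4) [OF assms(2)]
  obtain t where t: "t \<in> Mor C (src C k) (src C k')" "k' \<cdot> t = k"
    using kernel_factor [OF assms(2), of k] by auto
  obtain t' where t': "t' \<in> Mor C (src C k') (src C k)" "k \<cdot> t' = k'"
    using kernel_factor [OF assms(1), of k'] by auto
  note [simp] = MorD [OF t(1)] MorD [OF t'(1)]
  have "k \<cdot> (t' \<cdot> t) = (k \<cdot> t') \<cdot> t" "k' \<cdot> (t \<cdot> t') = (k' \<cdot> t) \<cdot> t'" by simp_all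
  then have "k \<cdot> (t' \<cdot> t) = k \<cdot> idm C (src C k)" "k' \<cdot> (t \<cdot> t') = k' \<cdot> idm C (src C k')"
    using t(2) t'(2) by simp_all
  then have "t \<cdot> t' = idm C (src C k')" "t' \<cdot> t = idm C (src C k)"
    using monoD [OF kernel_mono [OF assms(1)], of "t' \<cdot> t" "idm C (src C k)"]
      monoD [OF kernel_mono [OF assms(2)], of "t \<cdot> t'" "idm C (src C k')"] by simp_all
  then show thesis using t t' that by blast
qed

text \<open>The epi from \<open>is_image_factor\<close> lands in the image hidden in
  \<open>exact_at\<close>; the comparison of two kernels of \<open>g\<close> moves it to the given
  one.\<close>

lemma exact_at_factor:
  assumes "exact_at C f g" "is_kernel C g k"
  obtains e where "is_epi C e" "e \<in> Mor C (src C f) (src C k)" "k \<cdot> e = f"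
proof -
  obtain j where j: "is_image C f j" "is_kernel C g j"
    using assms(1) unfolding exact_at_def by blast
  obtain e where e: "is_epi C e" "e \<in> Mor C (src C f) (src C j)" "j \<cdot> e = f"
    using is_image_factor [OF j(1)] .
  obtain t t' where t: "t \<in> Mor C (src C k) (src C j)" "t' \<in> Mor C (src C j) (src C k)"
    "j \<cdot> t = k" "k \<cdot> t' = j" "t \<cdot> t' = idm C (src C j)" "t' \<cdot> t = idm C (src C k)"
    using kernel_unique [OF assms(2) j(2)] .
  note [simp] = MorD [OF t(1)] MorD [OF t(2)] MorD [OF e(2)] kernelD(2) [OF assms(2)]
  have "is_epi C (t' \<cdot> e)"
  proof (rule epiI)
    fix x y assume [simp]: "x \<in> arr C" "y \<in> arr C" "src C x = tgt C (t' \<cdot> e)" "src C y = tgt C (t' \<cdot> e)"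
      "tgt C x = tgt C y" and eq: "x \<cdot> (t' \<cdot> e) = y \<cdot> (t' \<cdot> e)"
    have "(x \<cdot> t') \<cdot> e = (y \<cdot> t') \<cdot> e" using eq by simp
    then have "x \<cdot> t' = y \<cdot> t'" by - (rule epiD [OF e(1)], simp_all)
    then have "(x \<cdot> t') \<cdot> t = (y \<cdot> t') \<cdot> t" by simp
    then show "x = y" using t(6) by simp
  qed simp
  moreover have "k \<cdot> (t' \<cdot> e) = (k \<cdot> t') \<cdot> e" by simp
  then have "k \<cdot> (t' \<cdot> e) = f" using t(4) e(3) by simp
  ultimately show thesis using that [of "t' \<cdot> e"] by (simp add: Mor_def)
qed

text \<open>The identity of \<open>M\<close> composes to zero with the map
  \<open>Z \<rightarrow> M\<close>, so it factors through the cokernel \<open>c\<close>. Thus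
  \<open>c\<close> is split monic and its kernel \<open>j\<close> is zero; by exactness this
  \<open>j\<close> is a kernel of \<open>f\<close>.\<close>

lemma exact_at_zero_mono:
  assumes "exact_at C (mzero C Z M) f" "Z \<in> obj C" "M \<in> obj C"
  shows "is_mono C f"
proof -
  obtain j where j: "is_image C (mzero C Z M) j" "is_kernel C f j"
    using assms(1) unfolding exact_at_def by blast
  obtain c where c: "is_cokernel C (mzero C Z M) c" and k: "is_kernel C c j"
    using j(1) unfolding is_image_def by blast
  note [simp] = cokernelD(2-3) [OF c] kernelD(2-3) [OF k] kernelD(1) [OF j(2)] assms(2,3)
  have [simp]: "tgt C j = M" "src C f = M" using cokernelD(3)[OF c] kernelD(3)[OF k] kernelD(3)[OF j(2)] by auto
  obtain t where t: "t \<in> Mor C (tgt C c) M" "t \<cdot> c = idm C M"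
    using cokernel_factor [OF c, of "idm C M"] by auto
  note [simp] = MorD [OF t(1)]
  have "j = (t \<cdot> c) \<cdot> j" using t by simp
  also have "\<dots> = t \<cdot> (c \<cdot> j)" by simp
  finally have j0: "j = mzero C (src C j) M" using kernelD(4)[OF k] by simp
  show ?thesis
  proof (rule monoI_zero)
    fix g assume [simp]: "g \<in> arr C" "tgt C g = src C f" and g: "f \<cdot> g = mzero C (src C g) (tgt C f)"
    obtain u where u: "u \<in> Mor C (src C g) (src C j)" "j \<cdot> u = g"
      using kernel_factor [OF j(2), of g] g by auto
    note [simp] = MorD [OF u(1)]
    have "mzero C (src C j) M \<cdot> u = g" using u(2) j0 by simp
    then show "g = mzero C (src C g) (tgt C g)" by simp
  qed simp
qed

end

section \<open>Stable retracts and approximation steps\<close>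

text \<open>Exactness in the middle is implicit: in an abelian category a mono is the kernel of its
  cokernel, see \<open>short_exactD\<close>.\<close>

definition short_exact :: "('o, 'm, 'x) addcat_scheme \<Rightarrow> 'm \<Rightarrow> 'm \<Rightarrow> bool" where
  "short_exact C k e \<longleftrightarrow> is_mono C k \<and> is_cokernel C k e"

definition approximation_step :: "('o, 'm, 'x) addcat_scheme \<Rightarrow> 'o \<Rightarrow> 'o \<Rightarrow> bool" where
  "approximation_step C M N \<longleftrightarrow> (\<exists>k e. left_projective_approximation C k \<and> short_exact C k e \<and>
     src C k = M \<and> tgt C e = N)"

text \<open>\<open>M\<close> is a direct summand of \<open>N\<close> up to a projective summand.\<close>

definition stable_retract :: "('o, 'm, 'x) addcat_scheme \<Rightarrow> 'o \<Rightarrow> 'o \<Rightarrow> bool" where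
  "stable_retract C M N \<longleftrightarrow> M \<in> obj C \<and> (\<exists>R\<in>projectives C. \<exists>\<phi>\<in>Mor C M N. \<exists>\<psi>\<in>Mor C N M.
     \<exists>a\<in>Mor C M R. \<exists>b\<in>Mor C R M. madd C (\<psi> \<cdot>\<^bsub>C\<^esub> \<phi>) (b \<cdot>\<^bsub>C\<^esub> a) = idm C M)"

lemma stable_retractE:
  assumes "stable_retract C M N"
  obtains R \<phi> \<psi> a b where "R \<in> projectives C" "\<phi> \<in> Mor C M N" "\<psi> \<in> Mor C N M" "a \<in> Mor C M R"
    "b \<in> Mor C R M" "madd C (\<psi> \<cdot>\<^bsub>C\<^esub> \<phi>) (b \<cdot>\<^bsub>C\<^esub> a) = idm C M"
  using assms unfolding stable_retract_def by blast

text \<open>The simplifier brackets compositions to the right, so a rule for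
  \<open>g \<cdot> f\<close> no longer matches inside \<open>g \<cdot> (f \<cdot> x)\<close>. This
  form restores such rewriting and is applied to each new equation below.\<close>

lemma (in category) comp_eq_comp:
  assumes "g \<cdot> f = h" "f \<in> arr C" "g \<in> arr C" "tgt C f = src C g" "x \<in> arr C" "tgt C x = src C f"
  shows "g \<cdot> (f \<cdot> x) = h \<cdot> x"
  using assms comp_assoc [of x f g] by simp

lemma (in category) approximationD:
  assumes "left_projective_approximation C f"
  shows "f \<in> arr C" "tgt C f \<in> projectives C"
  using assms by (auto simp: left_projective_approximation_def)

context abelian_category
begin

lemma zero_object_projective:
  assumes "is_zero_object C Z"
  shows "Z \<in> projectives C"
  unfolding projectives_def
proof (intro CollectI conjI allI impI)
  show [simp]: "Z \<in> obj C" using assms by (simp add: is_zero_object_def)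
  fix e f assume ef: "is_epi C e \<and> f \<in> Mor C Z (tgt C e)"
  note [simp] = MorD [OF conjunct2 [OF ef]] epi_arr [OF conjunct1 [OF ef]]
  have "\<exists>!f. f \<in> Mor C Z (tgt C e)" using assms by (simp add: is_zero_object_def)
  moreover have "e \<cdot> mzero C Z (src C e) \<in> Mor C Z (tgt C e)" by (rule MorI) simp_all
  ultimately have "e \<cdot> mzero C Z (src C e) = f" using ef by blast
  moreover have "mzero C Z (src C e) \<in> Mor C Z (src C e)" by (rule MorI) simp_all
  ultimately show "\<exists>g\<in>Mor C Z (src C e). e \<cdot> g = f" by blast
qed

lemma retract_stable_retract:
  assumes "\<phi> \<in> Mor C M N" "\<psi> \<in> Mor C N M" "\<psi> \<cdot> \<phi> = idm C M"
  shows "stable_retract C M N"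
proof -
  obtain Z where Z: "is_zero_object C Z" using ex_zero_object by blast
  note [simp] = MorD [OF assms(1)] projectives_obj [OF zero_object_projective [OF Z]]
  have "mzero C M Z \<in> Mor C M Z" "mzero C Z M \<in> Mor C Z M" by (rule MorI; simp)+
  moreover have "madd C (\<psi> \<cdot> \<phi>) (mzero C Z M \<cdot> mzero C M Z) = idm C M" using assms(3) by simp
  ultimately show ?thesis
    using assms zero_object_projective [OF Z] unfolding stable_retract_def by (metis MorD(4))
qed

lemma short_exactD:
  assumes "short_exact C k e"
  shows "is_mono C k" "is_cokernel C k e" "is_kernel C e k" "is_epi C e" "k \<in> arr C" "e \<in> arr C"
    "src C e = tgt C k" "e \<cdot> k = mzero C (src C k) (tgt C e)"
  using assms mono_kernel_of_cokernel [of k e] cokernel_epi [of k e] cokernelD [of k e]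
  by (auto simp: short_exact_def)

lemma short_exactI_epi:
  assumes "is_epi C e" "is_kernel C e k"
  shows "short_exact C k e"
  using assms epi_cokernel_of_kernel kernel_mono unfolding short_exact_def by blast

lemma approximation_stepI:
  assumes "left_projective_approximation C k" "is_mono C k"
  obtains e where "approximation_step C (src C k) (tgt C e)" "short_exact C k e"
proof -
  obtain e where "is_cokernel C k e" using ex_cokernel approximationD(1) [OF assms(1)] by blast
  then show thesis using assms that unfolding approximation_step_def short_exact_def by blast
qed

text \<open>\<open>\<phi>\<close>, \<open>\<psi>\<close> and \<open>a\<close> all extend along the
  approximations because their new targets are projective. The extensions induce maps on cokernels
  whose composite differs from the identity by a map through the projective
  \<open>tgt C k\<close>.\<close>

lemma stable_retract_cosyzygy:
  assumes "stable_retract C (src C k) (src C k\<^sub>0)"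
    and "left_projective_approximation C k" "is_cokernel C k e"
    and "left_projective_approximation C k\<^sub>0" "is_cokernel C k\<^sub>0 e\<^sub>0"
  shows "stable_retract C (tgt C e) (tgt C e\<^sub>0)"
proof -
  obtain R \<phi> \<psi> a b where R: "R \<in> projectives C" and \<phi>: "\<phi> \<in> Mor C (src C k) (src C k\<^sub>0)"
    and \<psi>: "\<psi> \<in> Mor C (src C k\<^sub>0) (src C k)" and a: "a \<in> Mor C (src C k) R"
    and b: "b \<in> Mor C R (src C k)" and id: "madd C (\<psi> \<cdot> \<phi>) (b \<cdot> a) = idm C (src C k)"
    using stable_retractE [OF assms(1)] .
  note [simp] = MorD [OF \<phi>] MorD [OF \<psi>] MorD [OF a] MorD [OF b] R
    approximationD [OF assms(2)] approximationD [OF assms(4)]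
    cokernelD(2-4) [OF assms(3)] cokernelD(2-4) [OF assms(5)]
  obtain \<phi>\<^sub>1 where \<phi>1: "\<phi>\<^sub>1 \<in> Mor C (tgt C k) (tgt C k\<^sub>0)" "\<phi>\<^sub>1 \<cdot> k = k\<^sub>0 \<cdot> \<phi>"
    using approximation_extend [OF assms(2), of "k\<^sub>0 \<cdot> \<phi>"] by auto
  obtain \<psi>\<^sub>1 where \<psi>1: "\<psi>\<^sub>1 \<in> Mor C (tgt C k\<^sub>0) (tgt C k)" "\<psi>\<^sub>1 \<cdot> k\<^sub>0 = k \<cdot> \<psi>"
    using approximation_extend [OF assms(4), of "k \<cdot> \<psi>"] by auto
  obtain a' where a': "a' \<in> Mor C (tgt C k) R" "a' \<cdot> k = a"
    using approximation_extend [OF assms(2), of a] by auto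
  note [simp] = MorD [OF \<phi>1(1)] MorD [OF \<psi>1(1)] MorD [OF a'(1)] \<phi>1(2) \<psi>1(2) a'(2)
    comp_eq_comp [OF \<phi>1(2)] comp_eq_comp [OF \<psi>1(2)] comp_eq_comp [OF a'(2)]
    comp_eq_comp [OF cokernelD(4) [OF assms(3)]] comp_eq_comp [OF cokernelD(4) [OF assms(5)]]
  obtain \<phi>\<^sub>2 where \<phi>2: "\<phi>\<^sub>2 \<in> Mor C (tgt C e) (tgt C e\<^sub>0)" "\<phi>\<^sub>2 \<cdot> e = e\<^sub>0 \<cdot> \<phi>\<^sub>1"
    using cokernel_factor [OF assms(3), of "e\<^sub>0 \<cdot> \<phi>\<^sub>1"] by auto
  obtain \<psi>\<^sub>2 where \<psi>2: "\<psi>\<^sub>2 \<in> Mor C (tgt C e\<^sub>0) (tgt C e)" "\<psi>\<^sub>2 \<cdot> e\<^sub>0 = e \<cdot> \<psi>\<^sub>1"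
    using cokernel_factor [OF assms(5), of "e \<cdot> \<psi>\<^sub>1"] by auto
  note [simp] = MorD [OF \<phi>2(1)] MorD [OF \<psi>2(1)] \<phi>2(2) comp_eq_comp [OF \<psi>2(2)]
  \<comment> \<open>The summand \<open>k \<cdot> (b \<cdot> a')\<close> contributes the part
    \<open>b \<cdot> a\<close> of the identity, so that \<open>?g\<close> agrees with the identity
    after restriction along \<open>k\<close>; hence the two differ by a map
    \<open>w \<cdot> e\<close>.\<close>
  let ?g = "madd C (\<psi>\<^sub>1 \<cdot> \<phi>\<^sub>1) (k \<cdot> (b \<cdot> a'))"
  have "?g \<cdot> k = k \<cdot> madd C (\<psi> \<cdot> \<phi>) (b \<cdot> a)" by simp
  then have "idm C (tgt C k) \<cdot> k = ?g \<cdot> k" using id by simp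
  then obtain w where w: "w \<in> Mor C (tgt C e) (tgt C k)" "madd C ?g (w \<cdot> e) = idm C (tgt C k)"
    using eq_madd_cokernel [OF assms(3), of "idm C (tgt C k)" ?g] by auto
  note [simp] = MorD [OF w(1)]
  \<comment> \<open>Postcomposition with \<open>e\<close> kills the summand of \<open>?g\<close>
    that starts with \<open>k\<close>; only \<open>\<psi>\<^sub>2 \<cdot> \<phi>\<^sub>2\<close> and
    the correction \<open>e \<cdot> w\<close> remain.\<close>
  have "madd C (\<psi>\<^sub>2 \<cdot> \<phi>\<^sub>2) (e \<cdot> w) \<cdot> e = e \<cdot> madd C ?g (w \<cdot> e)" by simp
  then have "madd C (\<psi>\<^sub>2 \<cdot> \<phi>\<^sub>2) (e \<cdot> w) \<cdot> e = idm C (tgt C e) \<cdot> e" using w(2) by simp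
  then have "madd C (\<psi>\<^sub>2 \<cdot> \<phi>\<^sub>2) (e \<cdot> w) = idm C (tgt C e)"
    by - (rule epiD [OF cokernel_epi [OF assms(3)]], simp_all)
  moreover have "e \<in> Mor C (tgt C k) (tgt C e)" by (rule MorI) simp_all
  moreover have "tgt C e \<in> obj C" "tgt C k \<in> projectives C" by simp_all
  ultimately show ?thesis using \<phi>2(1) \<psi>2(1) w(1) unfolding stable_retract_def by blast
qed

text \<open>Dual comparison: \<open>\<phi>\<close>, \<open>\<psi>\<close> and \<open>b\<close> lift
  because both middle terms and \<open>R\<close> are projective, and the lifts restrict to kernels.
  Here only \<open>e\<^sub>0\<close> comes from a step; that \<open>k\<close> is an approximation is
  inherited from \<open>k\<^sub>0\<close> through the resulting decomposition of the
  identity.\<close>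

lemma stable_retract_syzygy:
  assumes "stable_retract C (tgt C e) (tgt C e\<^sub>0)"
    and "is_epi C e" "src C e \<in> projectives C" "is_kernel C e k"
    and "left_projective_approximation C k\<^sub>0" "short_exact C k\<^sub>0 e\<^sub>0"
  shows "left_projective_approximation C k \<and> stable_retract C (src C k) (src C k\<^sub>0)"
proof -
  obtain R \<phi> \<psi> a b where R: "R \<in> projectives C" and \<phi>: "\<phi> \<in> Mor C (tgt C e) (tgt C e\<^sub>0)"
    and \<psi>: "\<psi> \<in> Mor C (tgt C e\<^sub>0) (tgt C e)" and a: "a \<in> Mor C (tgt C e) R"
    and b: "b \<in> Mor C R (tgt C e)" and id: "madd C (\<psi> \<cdot> \<phi>) (b \<cdot> a) = idm C (tgt C e)"
    using stable_retractE [OF assms(1)] .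
  note [simp] = MorD [OF \<phi>] MorD [OF \<psi>] MorD [OF a] MorD [OF b] R
    approximationD [OF assms(5)] epi_arr [OF assms(2)] kernelD(2-4) [OF assms(4)]
    short_exactD(5-8) [OF assms(6)] comp_eq_comp [OF kernelD(4) [OF assms(4)]]
    comp_eq_comp [OF short_exactD(8) [OF assms(6)]]
  obtain \<phi>\<^sub>1 where \<phi>1: "\<phi>\<^sub>1 \<in> Mor C (src C e) (src C e\<^sub>0)" "e\<^sub>0 \<cdot> \<phi>\<^sub>1 = \<phi> \<cdot> e"
    using projective_lift [OF assms(3) short_exactD(4) [OF assms(6)], of "\<phi> \<cdot> e"] by auto
  obtain \<psi>\<^sub>1 where \<psi>1: "\<psi>\<^sub>1 \<in> Mor C (src C e\<^sub>0) (src C e)" "e \<cdot> \<psi>\<^sub>1 = \<psi> \<cdot> e\<^sub>0"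
    using projective_lift [OF _ assms(2), of "src C e\<^sub>0" "\<psi> \<cdot> e\<^sub>0"] by auto
  obtain b' where b': "b' \<in> Mor C R (src C e)" "e \<cdot> b' = b"
    using projective_lift [OF R assms(2), of b] by auto
  note [simp] = MorD [OF \<phi>1(1)] MorD [OF \<psi>1(1)] MorD [OF b'(1)] \<phi>1(2) \<psi>1(2) b'(2)
    comp_eq_comp [OF \<phi>1(2)] comp_eq_comp [OF \<psi>1(2)] comp_eq_comp [OF b'(2)]
  obtain \<phi>\<^sub>2 where \<phi>2: "\<phi>\<^sub>2 \<in> Mor C (src C k) (src C k\<^sub>0)" "k\<^sub>0 \<cdot> \<phi>\<^sub>2 = \<phi>\<^sub>1 \<cdot> k"
    using kernel_factor [OF short_exactD(3) [OF assms(6)], of "\<phi>\<^sub>1 \<cdot> k"] by auto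
  obtain \<psi>\<^sub>2 where \<psi>2: "\<psi>\<^sub>2 \<in> Mor C (src C k\<^sub>0) (src C k)" "k \<cdot> \<psi>\<^sub>2 = \<psi>\<^sub>1 \<cdot> k\<^sub>0"
    using kernel_factor [OF assms(4), of "\<psi>\<^sub>1 \<cdot> k\<^sub>0"] by auto
  note [simp] = MorD [OF \<phi>2(1)] MorD [OF \<psi>2(1)] \<phi>2(2) comp_eq_comp [OF \<psi>2(2)]
  let ?g = "madd C (\<psi>\<^sub>1 \<cdot> \<phi>\<^sub>1) (b' \<cdot> (a \<cdot> e))"
  have "e \<cdot> ?g = madd C (\<psi> \<cdot> \<phi>) (b \<cdot> a) \<cdot> e" by simp
  then have "e \<cdot> idm C (src C e) = e \<cdot> ?g" using id by simp
  then obtain w where w: "w \<in> Mor C (src C e) (src C k)" "madd C ?g (k \<cdot> w) = idm C (src C e)"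
    using eq_madd_kernel [OF assms(4), of "idm C (src C e)" ?g] by auto
  note [simp] = MorD [OF w(1)]
  \<comment> \<open>Restriction along \<open>k\<close> kills the summand of \<open>?g\<close> that
    ends in \<open>e\<close>, which leaves a map through \<open>src C e\<close> as the error
    term.\<close>
  have "k \<cdot> madd C (\<psi>\<^sub>2 \<cdot> \<phi>\<^sub>2) (w \<cdot> k) = madd C ?g (k \<cdot> w) \<cdot> k" by simp
  then have "k \<cdot> madd C (\<psi>\<^sub>2 \<cdot> \<phi>\<^sub>2) (w \<cdot> k) = k \<cdot> idm C (src C k)" using w(2) by simp
  then have id_k: "madd C (\<psi>\<^sub>2 \<cdot> \<phi>\<^sub>2) (w \<cdot> k) = idm C (src C k)"
    by - (rule monoD [OF kernel_mono [OF assms(4)]], simp_all)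
  moreover have "k \<in> Mor C (src C k) (src C e)" by (rule MorI) simp_all
  moreover have "src C k \<in> obj C" by simp
  ultimately have "stable_retract C (src C k) (src C k\<^sub>0)"
    using \<phi>2(1) \<psi>2(1) w(1) assms(3) unfolding stable_retract_def by blast
  moreover have "left_projective_approximation C k"
  proof (rule approximationI)
    fix h assume [simp]: "h \<in> arr C" "src C h = src C k" "tgt C h \<in> projectives C"
    \<comment> \<open>Writing \<open>h\<close> as \<open>h \<cdot> \<psi>\<^sub>2 \<cdot>
      \<phi>\<^sub>2 + h \<cdot> w \<cdot> k\<close>, the first summand extends via
      \<open>k\<^sub>0\<close> as \<open>h' \<cdot> \<phi>\<^sub>1\<close>, the second visibly as
      \<open>h \<cdot> w\<close>.\<close>
    obtain h' where h': "h' \<in> Mor C (tgt C k\<^sub>0) (tgt C h)" "h' \<cdot> k\<^sub>0 = h \<cdot> \<psi>\<^sub>2"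
      using approximation_extend [OF assms(5), of "h \<cdot> \<psi>\<^sub>2"] by auto
    note [simp] = MorD [OF h'(1)] comp_eq_comp [OF h'(2)]
    have "h' \<cdot> (\<phi>\<^sub>1 \<cdot> k) = h \<cdot> (\<psi>\<^sub>2 \<cdot> \<phi>\<^sub>2)"
      using comp_eq_comp [OF h'(2), of \<phi>\<^sub>2] by simp
    then have "madd C (h' \<cdot> \<phi>\<^sub>1) (h \<cdot> w) \<cdot> k = h \<cdot> madd C (\<psi>\<^sub>2 \<cdot> \<phi>\<^sub>2) (w \<cdot> k)" by simp
    also have "\<dots> = h" using id_k by simp
    finally show "\<exists>g\<in>Mor C (tgt C k) (tgt C h). g \<cdot> k = h" by (rule bexI [OF _ MorI]) simp_all
  qed (use assms(3) in simp_all)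
  ultimately show ?thesis by simp
qed

lemma ex_projective_biproduct:
  assumes "P \<in> projectives C" "R \<in> projectives C"
  obtains S i j p q where "S \<in> projectives C" "i \<in> Mor C P S" "j \<in> Mor C R S" "p \<in> Mor C S P"
    "q \<in> Mor C S R" "p \<cdot> i = idm C P" "q \<cdot> j = idm C R" "q \<cdot> i = mzero C P R" "p \<cdot> j = mzero C R P"
proof -
  note [simp] = projectives_obj [OF assms(1)] projectives_obj [OF assms(2)]
  obtain S i j p q where S: "S \<in> obj C" "i \<in> Mor C P S" "j \<in> Mor C R S" "p \<in> Mor C S P"
    "q \<in> Mor C S R" "p \<cdot> i = idm C P" "q \<cdot> j = idm C R" "q \<cdot> i = mzero C P R" "p \<cdot> j = mzero C R P"
    and id: "madd C (i \<cdot> p) (j \<cdot> q) = idm C S"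
    using ex_biproduct [of P R] by auto
  note [simp] = MorD [OF S(2)] MorD [OF S(3)] MorD [OF S(4)] MorD [OF S(5)]
  have "\<exists>g\<in>Mor C S (src C e). e \<cdot> g = f" if ef: "is_epi C e" "f \<in> Mor C S (tgt C e)" for e f
  proof -
    note [simp] = MorD [OF ef(2)] epi_arr [OF ef(1)]
    obtain g where g: "g \<in> Mor C P (src C e)" "e \<cdot> g = f \<cdot> i"
      using projective_lift [OF assms(1) ef(1), of "f \<cdot> i"] by auto
    obtain g' where g': "g' \<in> Mor C R (src C e)" "e \<cdot> g' = f \<cdot> j"
      using projective_lift [OF assms(2) ef(1), of "f \<cdot> j"] by auto
    note [simp] = MorD [OF g(1)] MorD [OF g'(1)] comp_eq_comp [OF g(2)] comp_eq_comp [OF g'(2)]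
    have "e \<cdot> madd C (g \<cdot> p) (g' \<cdot> q) = f \<cdot> madd C (i \<cdot> p) (j \<cdot> q)" by simp
    then have "e \<cdot> madd C (g \<cdot> p) (g' \<cdot> q) = f" using id by simp
    then show ?thesis by (rule bexI [OF _ MorI]) simp_all
  qed
  then have "S \<in> projectives C" using S(1) by (auto simp: projectives_def)
  then show thesis using S that by blast
qed

text \<open>\<open>N\<close> embeds into the sum of \<open>tgt C k\<^sub>0\<close> and
  \<open>R\<close> by the pair of \<open>k\<^sub>0 \<cdot> \<phi>\<close> and \<open>a\<close>.
  Since \<open>\<psi> \<cdot> \<phi> + b \<cdot> a\<close> is the identity, nothing is killed by
  both components, and a map \<open>h\<close> extends by treating \<open>h \<cdot> \<psi>\<close>
  and \<open>h \<cdot> b\<close> separately.\<close>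

lemma stable_retract_mono_approximation:
  assumes "stable_retract C N (src C k\<^sub>0)" "left_projective_approximation C k\<^sub>0" "is_mono C k\<^sub>0"
  obtains k where "left_projective_approximation C k" "is_mono C k" "src C k = N"
proof -
  obtain R \<phi> \<psi> a b where R: "R \<in> projectives C" and \<phi>: "\<phi> \<in> Mor C N (src C k\<^sub>0)"
    and \<psi>: "\<psi> \<in> Mor C (src C k\<^sub>0) N" and a: "a \<in> Mor C N R"
    and b: "b \<in> Mor C R N" and id: "madd C (\<psi> \<cdot> \<phi>) (b \<cdot> a) = idm C N"
    using stable_retractE [OF assms(1)] .
  note [simp] = MorD [OF \<phi>] MorD [OF \<psi>] MorD [OF a] MorD [OF b] R approximationD [OF assms(2)]
  obtain S i j p q where S: "S \<in> projectives C" and ij: "i \<in> Mor C (tgt C k\<^sub>0) S" "j \<in> Mor C R S"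
    and pq: "p \<in> Mor C S (tgt C k\<^sub>0)" "q \<in> Mor C S R"
    and eqs: "p \<cdot> i = idm C (tgt C k\<^sub>0)" "q \<cdot> j = idm C R" "q \<cdot> i = mzero C (tgt C k\<^sub>0) R"
      "p \<cdot> j = mzero C R (tgt C k\<^sub>0)"
    using ex_projective_biproduct [OF approximationD(2) [OF assms(2)] R] .
  note [simp] = S MorD [OF ij(1)] MorD [OF ij(2)] MorD [OF pq(1)] MorD [OF pq(2)]
    eqs [THEN comp_eq_comp]
  define k where "k = madd C (i \<cdot> (k\<^sub>0 \<cdot> \<phi>)) (j \<cdot> a)"
  have [simp]: "k \<in> arr C" "src C k = N" "tgt C k = S" by (simp_all add: k_def)
  have pk: "p \<cdot> k = k\<^sub>0 \<cdot> \<phi>" and qk: "q \<cdot> k = a" by (simp_all add: k_def)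
  have "is_mono C k"
  proof (rule monoI_zero)
    fix x assume [simp]: "x \<in> arr C" "tgt C x = src C k"
      and x: "k \<cdot> x = mzero C (src C x) (tgt C k)"
    have "k\<^sub>0 \<cdot> (\<phi> \<cdot> x) = p \<cdot> (k \<cdot> x)" using comp_eq_comp [OF pk, of x] by simp
    then have "k\<^sub>0 \<cdot> (\<phi> \<cdot> x) = k\<^sub>0 \<cdot> mzero C (src C x) (src C k\<^sub>0)" using x by simp
    then have \<phi>x: "\<phi> \<cdot> x = mzero C (src C x) (src C k\<^sub>0)"
      by - (rule monoD [OF assms(3)], simp_all)
    have "a \<cdot> x = q \<cdot> (k \<cdot> x)" using comp_eq_comp [OF qk, of x] by simp
    then have ax: "a \<cdot> x = mzero C (src C x) R" using x by simp
    have "x = madd C (\<psi> \<cdot> \<phi>) (b \<cdot> a) \<cdot> x" using id by simp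
    also have "\<dots> = madd C (\<psi> \<cdot> (\<phi> \<cdot> x)) (b \<cdot> (a \<cdot> x))" by simp
    also have "\<dots> = mzero C (src C x) (tgt C x)" using \<phi>x ax by simp
    finally show "x = mzero C (src C x) (tgt C x)" .
  qed simp
  moreover have "left_projective_approximation C k"
  proof (rule approximationI)
    fix h assume [simp]: "h \<in> arr C" "src C h = src C k" "tgt C h \<in> projectives C"
    obtain h' where h': "h' \<in> Mor C (tgt C k\<^sub>0) (tgt C h)" "h' \<cdot> k\<^sub>0 = h \<cdot> \<psi>"
      using approximation_extend [OF assms(2), of "h \<cdot> \<psi>"] by auto
    note [simp] = MorD [OF h'(1)] comp_eq_comp [OF h'(2)]
    have "madd C (h' \<cdot> p) (h \<cdot> (b \<cdot> q)) \<cdot> k = h \<cdot> madd C (\<psi> \<cdot> \<phi>) (b \<cdot> a)" using pk qk by simp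
    then have "madd C (h' \<cdot> p) (h \<cdot> (b \<cdot> q)) \<cdot> k = h" using id by simp
    then show "\<exists>g\<in>Mor C (tgt C k) (tgt C h). g \<cdot> k = h" by (rule bexI [OF _ MorI]) simp_all
  qed simp_all
  ultimately show thesis using that by simp
qed

lemma stable_retract_step:
  assumes "stable_retract C N N\<^sub>0" "approximation_step C N\<^sub>0 M\<^sub>0"
  obtains M where "approximation_step C N M" "stable_retract C M M\<^sub>0"
proof -
  obtain k\<^sub>0 e\<^sub>0 where k0: "left_projective_approximation C k\<^sub>0" "short_exact C k\<^sub>0 e\<^sub>0"
    and [simp]: "src C k\<^sub>0 = N\<^sub>0" "tgt C e\<^sub>0 = M\<^sub>0"
    using assms(2) unfolding approximation_step_def by blast
  obtain k where k: "left_projective_approximation C k" "is_mono C k" and [simp]: "src C k = N"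
    using stable_retract_mono_approximation [of N k\<^sub>0] assms(1) k0(1) short_exactD(1) [OF k0(2)] by auto
  obtain e where e: "approximation_step C N (tgt C e)" "short_exact C k e"
    using approximation_stepI [OF k] by auto
  have "stable_retract C (tgt C e) M\<^sub>0"
    using stable_retract_cosyzygy [of k k\<^sub>0 e e\<^sub>0] k k0 e short_exactD(2) assms(1) by simp
  then show thesis using e that by blast
qed

text \<open>The end of a step does not depend on the chosen approximation up to stable retracts;
  with \<open>N = N\<^sub>0\<close> this compares two steps from the same object.\<close>

lemma stable_retract_of_steps:
  assumes "stable_retract C N N\<^sub>0" "approximation_step C N M" "approximation_step C N\<^sub>0 M\<^sub>0"
  shows "stable_retract C M M\<^sub>0"
  using assms(2,3) stable_retract_cosyzygy short_exactD(2) assms(1)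
  unfolding approximation_step_def by blast

lemma stable_retract_refl: "M \<in> obj C \<Longrightarrow> stable_retract C M M"
  using retract_stable_retract [of "idm C M" M M "idm C M"] id_in by simp

end

section \<open>Torsionfree and Gorenstein projective objects\<close>

primrec approximation_chain :: "('o, 'm, 'x) addcat_scheme \<Rightarrow> nat \<Rightarrow> 'o \<Rightarrow> bool" where
  "approximation_chain C 0 M \<longleftrightarrow> M \<in> obj C"
| "approximation_chain C (Suc n) M \<longleftrightarrow> (\<exists>N. approximation_step C M N \<and> approximation_chain C n N)"

context abelian_category
begin

lemma approximation_step_obj:
  assumes "approximation_step C M N" shows "M \<in> obj C" "N \<in> obj C"
  using assms short_exactD(5,6) src_in tgt_in unfolding approximation_step_def by metis+

text \<open>The first step is transported to \<open>N\<close>, and its end is again a stable retract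
  of the old end, so the induction continues.\<close>

lemma stable_retract_chain:
  assumes "stable_retract C N N\<^sub>0" "approximation_chain C n N\<^sub>0"
  shows "approximation_chain C n N"
  using assms
proof (induction n arbitrary: N N\<^sub>0)
  case 0
  then show ?case by (simp add: stable_retract_def)
next
  case (Suc n)
  then obtain M\<^sub>0 where "approximation_step C N\<^sub>0 M\<^sub>0" "approximation_chain C n M\<^sub>0" by auto
  then show ?case using Suc stable_retract_step by (metis approximation_chain.simps(2))
qed

lemma approximation_chain_sequence:
  assumes "approximation_chain C n M"
  obtains N where "N 0 = M" "\<forall>i<n. approximation_step C (N i) (N (Suc i))"
proof -
  have "\<exists>N. N 0 = M \<and> (\<forall>i<n. approximation_step C (N i) (N (Suc i)))"
    using assms
  proof (induction n arbitrary: M)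
    case (Suc n)
    then obtain M' where M': "approximation_step C M M'" "approximation_chain C n M'" by auto
    obtain N where N: "N 0 = M'" "\<forall>i<n. approximation_step C (N i) (N (Suc i))"
      using Suc.IH [OF M'(2)] by blast
    have "approximation_step C (case_nat M N i) (case_nat M N (Suc i))" if "i < Suc n" for i
      using that M'(1) N by (cases i) auto
    then show ?case by (intro exI [of _ "case_nat M N"]) auto
  qed auto
  then show thesis using that by blast
qed

text \<open>Used on spliced maps \<open>m \<cdot> e\<close>, where \<open>m\<close> is the inclusion
  of an image: it passes between the kernel of the spliced map and that of its epic part.\<close>

lemma kernel_mono_comp:
  assumes "is_mono C m" "e \<in> arr C" "tgt C e = src C m"
  shows "is_kernel C (m \<cdot> e) k \<longleftrightarrow> is_kernel C e k"
proof -
  note [simp] = mono_arr [OF assms(1)] assms(2,3)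
  have zero_iff: "(m \<cdot> e) \<cdot> h = mzero C (src C h) (tgt C (m \<cdot> e)) \<longleftrightarrow> e \<cdot> h = mzero C (src C h) (tgt C e)"
    if [simp]: "h \<in> arr C" "tgt C h = src C e" for h
  proof
    assume "(m \<cdot> e) \<cdot> h = mzero C (src C h) (tgt C (m \<cdot> e))"
    then have "m \<cdot> (e \<cdot> h) = m \<cdot> mzero C (src C h) (src C m)" by simp
    then show "e \<cdot> h = mzero C (src C h) (tgt C e)"
      by - (rule monoD [OF assms(1)], simp_all)
  qed simp
  show ?thesis
  proof
    assume k: "is_kernel C (m \<cdot> e) k"
    note [simp] = kernelD(2) [OF k]
    have [simp]: "tgt C k = src C e" using kernelD(3) [OF k] by simp
    show "is_kernel C e k"
    proof (rule is_kernelI [OF kernel_mono [OF k]])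
      show "e \<cdot> k = mzero C (src C k) (tgt C e)" using zero_iff [of k] kernelD(4) [OF k] by (simp del: comp_assoc)
      fix h assume h: "h \<in> arr C" "tgt C h = src C e" "e \<cdot> h = mzero C (src C h) (tgt C e)"
      then show "\<exists>u\<in>Mor C (src C h) (src C k). k \<cdot> u = h"
        using kernel_factor [OF k, of h] zero_iff [OF h(1,2)] by auto
    qed simp_all
  next
    assume k: "is_kernel C e k"
    note [simp] = kernelD(2,3) [OF k]
    show "is_kernel C (m \<cdot> e) k"
    proof (rule is_kernelI [OF kernel_mono [OF k]])
      show "(m \<cdot> e) \<cdot> k = mzero C (src C k) (tgt C (m \<cdot> e))"
        using zero_iff [of k] kernelD(4) [OF k] by (simp del: comp_assoc)
      fix h assume h: "h \<in> arr C" "tgt C h = src C (m \<cdot> e)"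
        "(m \<cdot> e) \<cdot> h = mzero C (src C h) (tgt C (m \<cdot> e))"
      then show "\<exists>u\<in>Mor C (src C h) (src C k). k \<cdot> u = h"
        using kernel_factor [OF k, of h] zero_iff [of h] by auto
    qed simp_all
  qed
qed

text \<open>Identifies the image of a spliced map \<open>k \<cdot> q\<close> as \<open>k\<close>:
  both have the same cokernel, of which \<open>k\<close> is the kernel when it is monic.\<close>

lemma cokernel_comp_epi:
  assumes "is_epi C q" "tgt C q = src C k" "is_cokernel C k c"
  shows "is_cokernel C (k \<cdot> q) c"
proof (rule is_cokernelI [OF cokernel_epi [OF assms(3)]])
  note [simp] = epi_arr [OF assms(1)] assms(2) cokernelD [OF assms(3)]
    comp_eq_comp [OF cokernelD(4) [OF assms(3)]]
  fix h assume [simp]: "h \<in> arr C" "src C h = tgt C (k \<cdot> q)"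
    and h: "h \<cdot> (k \<cdot> q) = mzero C (src C (k \<cdot> q)) (tgt C h)"
  have "(h \<cdot> k) \<cdot> q = mzero C (src C k) (tgt C h) \<cdot> q" using h by simp
  then have "h \<cdot> k = mzero C (src C k) (tgt C h)" by - (rule epiD [OF assms(1)], simp_all)
  then show "\<exists>u\<in>Mor C (tgt C c) (tgt C h). u \<cdot> c = h"
    using cokernel_factor [OF assms(3), of h] by auto
qed (use assms(2) epi_arr [OF assms(1)] cokernelD [OF assms(3)]
    comp_eq_comp [OF cokernelD(4) [OF assms(3)]] in simp_all)

lemma kernel_comp_iso:
  assumes "is_iso C f" "tgt C f = src C k" "is_kernel C g k"
  shows "is_kernel C g (k \<cdot> f)"
proof (rule is_kernelI)
  obtain f' where f': "f' \<in> Mor C (tgt C f) (src C f)" "f \<cdot> f' = idm C (tgt C f)"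
    using assms(1) unfolding is_iso_def by blast
  note [simp] = mono_arr [OF iso_mono [OF assms(1)]] assms(2) kernelD [OF assms(3)] MorD [OF f'(1)]
    comp_eq_comp [OF kernelD(4) [OF assms(3)]]
  show "is_mono C (k \<cdot> f)" using mono_comp [OF iso_mono kernel_mono] assms by blast
  show "g \<in> arr C" "tgt C (k \<cdot> f) = src C g" "g \<cdot> (k \<cdot> f) = mzero C (src C (k \<cdot> f)) (tgt C g)"
    by simp_all
  fix h assume [simp]: "h \<in> arr C" "tgt C h = src C g" and h: "g \<cdot> h = mzero C (src C h) (tgt C g)"
  obtain u where u: "u \<in> Mor C (src C h) (src C k)" "k \<cdot> u = h"
    using kernel_factor [OF assms(3), of h] h by auto
  note [simp] = MorD [OF u(1)]
  have "(k \<cdot> f) \<cdot> (f' \<cdot> u) = k \<cdot> ((f \<cdot> f') \<cdot> u)" by simp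
  then have "(k \<cdot> f) \<cdot> (f' \<cdot> u) = h" using f'(2) u(2) by simp
  then show "\<exists>u\<in>Mor C (src C h) (src C (k \<cdot> f)). (k \<cdot> f) \<cdot> u = h"
    by (rule bexI [OF _ MorI]) simp_all
qed

lemma zero_kernel:
  assumes "is_mono C f" "is_zero_object C Z"
  shows "is_kernel C f (mzero C Z (src C f))"
proof (rule is_kernelI)
  note [simp] = mono_arr [OF assms(1)]
  have [simp]: "Z \<in> obj C" using assms(2) by (simp add: is_zero_object_def)
  have uniq: "\<exists>!g. g \<in> Mor C W Z" if "W \<in> obj C" for W
    using that assms(2) unfolding is_zero_object_def by blast
  show "is_mono C (mzero C Z (src C f))"
  proof (rule monoI)
    fix g h assume *: "g \<in> arr C" "h \<in> arr C" "tgt C g = src C (mzero C Z (src C f))"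
      "tgt C h = src C (mzero C Z (src C f))" "src C g = src C h"
    then have "g \<in> Mor C (src C h) Z" "h \<in> Mor C (src C h) Z" by auto
    then show "g = h" using uniq [of "src C h"] *(2) by auto
  qed simp
  show "f \<in> arr C" "tgt C (mzero C Z (src C f)) = src C f"
    "f \<cdot> mzero C Z (src C f) = mzero C (src C (mzero C Z (src C f))) (tgt C f)" by simp_all
  fix h assume [simp]: "h \<in> arr C" "tgt C h = src C f" and h: "f \<cdot> h = mzero C (src C h) (tgt C f)"
  have "f \<cdot> h = f \<cdot> mzero C (src C h) (src C f)" using h by simp
  then have "h = mzero C (src C h) (src C f)" by - (rule monoD [OF assms(1)], simp_all)
  then have "mzero C Z (src C f) \<cdot> mzero C (src C h) Z = h" by simp
  then show "\<exists>u\<in>Mor C (src C h) (src C (mzero C Z (src C f))). mzero C Z (src C f) \<cdot> u = h"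
    by (rule bexI [OF _ MorI]) simp_all
qed

text \<open>Writing \<open>f (Suc i)\<close> as an epi followed by the inclusion
  \<open>j (Suc i)\<close>, exactness makes \<open>j i\<close> the kernel of that epi, which is a
  step from one image to the next. \<open>M\<close> is only isomorphic to the first image, and this
  is absorbed by \<open>stable_retract_chain\<close>.\<close>

lemma approximation_chain_if_torsionfree:
  assumes "M \<in> torsionfree C n" "n \<ge> 1"
  shows "approximation_chain C n M"
proof -
  obtain P f Z where M: "M \<in> obj C" and Z: "is_zero_object C Z"
    and f1: "f 1 \<in> Mor C M (P 1)" and ex0: "exact_at C (mzero C Z M) (f 1)"
    and ex: "\<forall>i\<in>{1..<n}. exact_at C (f i) (f (Suc i))"
    and "\<forall>i\<in>{1..n}. \<exists>j. is_image C (f i) j \<and> left_projective_approximation C j"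
    using assms(1) unfolding torsionfree_def by (elim CollectE conjE exE) (rule that)
  then obtain j where j: "\<And>i. i \<in> {1..n} \<Longrightarrow> is_image C (f i) (j i) \<and> left_projective_approximation C (j i)"
    by metis
  have mono: "is_mono C (j i)" if "i \<in> {1..n}" for i
    using j [OF that] kernel_mono unfolding is_image_def by blast
  have step: "approximation_step C (src C (j i)) (src C (j (Suc i)))" if i: "i \<in> {1..<n}" for i
  proof -
    have i': "i \<in> {1..n}" "Suc i \<in> {1..n}" using i by auto
    obtain e where e: "is_epi C e" "e \<in> Mor C (src C (f (Suc i))) (src C (j (Suc i)))"
      "j (Suc i) \<cdot> e = f (Suc i)"
      using is_image_factor j [OF i'(2)] by metis
    note [simp] = MorD [OF e(2)]
    have "is_kernel C (j (Suc i) \<cdot> e) (j i)"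
      using is_image_kernel ex i j [OF i'(1)] e(3) by metis
    then have "is_kernel C e (j i)" using kernel_mono_comp [OF mono [OF i'(2)], of e] by simp
    then have "short_exact C (j i) e" using short_exactI_epi e(1) by blast
    then show ?thesis using j [OF i'(1)] unfolding approximation_step_def by (metis MorD(3) e(2))
  qed
  \<comment> \<open>The chain grows backwards from the last image: \<open>j n\<close> contributes
    one step, to its own cokernel, and every earlier image one more.\<close>
  have chain: "approximation_chain C (Suc m) (src C (j (n - m)))" if "m < n" for m
    using that
  proof (induction m)
    case 0
    then have "n \<in> {1..n}" by auto
    then show ?case
      using j mono approximation_stepI [of "j n"] approximation_step_obj(2)
      by (metis approximation_chain.simps diff_zero)
  next
    case (Suc m)
    then have "n - Suc m \<in> {1..<n}" "Suc (n - Suc m) = n - m" by auto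
    then have "approximation_step C (src C (j (n - Suc m))) (src C (j (n - m)))"
      using step [of "n - Suc m"] by simp
    then show ?case using Suc approximation_chain.simps(2) by (metis Suc_lessD)
  qed
  \<comment> \<open>The epi from \<open>M\<close> onto the first image is also monic because
    \<open>f 1\<close> is.\<close>
  obtain e where e: "is_epi C e" "e \<in> Mor C M (src C (j 1))" "j 1 \<cdot> e = f 1"
    using is_image_factor [of "f 1" "j 1"] j [of 1] MorD [OF f1] assms(2) by auto
  note [simp] = MorD [OF e(2)]
  have "is_mono C (f 1)" using exact_at_zero_mono [OF ex0] M Z by (simp add: is_zero_object_def)
  have jarr: "j 1 \<in> arr C" using mono_arr [OF mono] assms(2) by simp
  have "is_mono C e"
  proof (rule monoI)
    fix g h assume [simp]: "g \<in> arr C" "h \<in> arr C" "tgt C g = src C e" "tgt C h = src C e"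
      "src C g = src C h" and eq: "e \<cdot> g = e \<cdot> h"
    have "f 1 \<cdot> g = j 1 \<cdot> (e \<cdot> g)" "f 1 \<cdot> h = j 1 \<cdot> (e \<cdot> h)"
      using comp_eq_comp [OF e(3), of g] comp_eq_comp [OF e(3), of h] jarr by auto
    then show "g = h" using eq monoD [OF \<open>is_mono C (f 1)\<close>, of g h] MorD [OF f1] by simp
  qed simp
  then obtain t where "t \<in> Mor C (tgt C e) (src C e)" "t \<cdot> e = idm C (src C e)"
    using mono_epi_iso e(1) by blast
  then have "stable_retract C M (src C (j 1))" using retract_stable_retract [OF e(2), of t] by simp
  then show ?thesis using stable_retract_chain chain [of "n - 1"] assms(2) by simp
qed

text \<open>The steps are spliced: each new map is the epi of one step followed by the mono of the
  next, so it has the latter as image and the former's mono as kernel.\<close>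

lemma torsionfree_if_approximation_chain:
  assumes "approximation_chain C n M" "n \<ge> 1"
  shows "M \<in> torsionfree C n"
proof -
  obtain N where N0: "N 0 = M" and "\<forall>i<n. approximation_step C (N i) (N (Suc i))"
    using approximation_chain_sequence [OF assms(1)] .
  then have "\<forall>i. \<exists>k e. i < n \<longrightarrow> left_projective_approximation C k \<and> short_exact C k e \<and>
     src C k = N i \<and> tgt C e = N (Suc i)"
    unfolding approximation_step_def by blast
  then obtain k e where ke: "\<And>i. i < n \<Longrightarrow> left_projective_approximation C (k i)"
      "\<And>i. i < n \<Longrightarrow> short_exact C (k i) (e i)"
      "\<And>i. i < n \<Longrightarrow> src C (k i) = N i" "\<And>i. i < n \<Longrightarrow> tgt C (e i) = N (Suc i)"
    by metis
  note ks [simp] = approximationD [OF ke(1)] ke(3) ke(4) short_exactD(6,7) [OF ke(2)]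
  have [simp]: "0 < n" using assms(2) by simp
  have [simp]: "M \<in> obj C" using ks(1) [of 0] ke(3) [of 0] N0 src_in [of "k 0"] by simp
  \<comment> \<open>The steps are numbered from 0, the maps of the sequence from 1. Putting the
    identity of \<open>M\<close> before the epis makes \<open>f 1 = k 0\<close> an instance of the
    general formula; \<open>f 0\<close> and \<open>P 0\<close> are irrelevant values.\<close>
  define q where "q = case_nat (idm C M) e"
  define f where "f i = k (i - 1) \<cdot> q (i - 1)" for i
  define P where "P i = tgt C (k (i - 1))" for i
  have idepi: "is_epi C (idm C M)" by (rule epiI) simp_all
  have q: "is_epi C (q i)" "tgt C (q i) = N i" if "i < n" for i
    using that idepi N0 short_exactD(4) [OF ke(2) [of "i - 1"]] by (cases i; simp add: q_def)+
  have qsrc: "src C (q i) = (case i of 0 \<Rightarrow> M | Suc m \<Rightarrow> tgt C (k m))" if "i < n" for i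
    using that by (cases i) (simp_all add: q_def)
  have f_arr: "f (Suc i) \<in> Mor C (src C (q i)) (tgt C (k i))" if "i < n" for i
    using that q [OF that] epi_arr by (auto simp: f_def intro!: MorI)
  have img: "is_image C (f (Suc i)) (k i)" if "i < n" for i
    using cokernel_comp_epi [OF q(1) [OF that], of "k i" "e i"] q(2) [OF that] that
      short_exactD(2,3) [OF ke(2) [OF that]]
    unfolding is_image_def f_def by auto
  have ker: "is_kernel C (f (Suc (Suc i))) (k i)" if "Suc i < n" for i
    using kernel_mono_comp [of "k (Suc i)" "e i" "k i"] that
      short_exactD(1) [OF ke(2) [of "Suc i"]] short_exactD(3) [OF ke(2) [of i]]
    by (simp add: f_def q_def)
  have ex: "exact_at C (f (Suc i)) (f (Suc (Suc i)))" if "Suc i < n" for i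
    unfolding exact_at_def using that img [of i] ker [of i] MorD [OF f_arr [of i]] MorD [OF f_arr [of "Suc i"]]
      qsrc [of "Suc i"] by auto
  obtain Z where Z: "is_zero_object C Z" using ex_zero_object by blast
  have [simp]: "Z \<in> obj C" using Z by (simp add: is_zero_object_def)
  have f1: "f 1 = k 0" using N0 by (simp add: f_def q_def)
  have idmono: "is_mono C (idm C M)" by (rule monoI) simp_all
  \<comment> \<open>Exactness at \<open>M\<close>: the zero map has the identity as cokernel, hence
    is its own image, and it is the kernel of the mono \<open>k 0\<close>.\<close>
  have "is_cokernel C (mzero C Z M) (idm C M)"
    by (rule is_cokernelI [OF idepi]) (auto intro!: MorI bexI)
  then have "is_image C (mzero C Z M) (mzero C Z M)"
    using zero_kernel [OF idmono Z] unfolding is_image_def by auto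
  moreover have "is_kernel C (k 0) (mzero C Z M)"
    using zero_kernel [OF short_exactD(1) [OF ke(2) [of 0]] Z] N0 by simp
  ultimately have ex0: "exact_at C (mzero C Z M) (f 1)"
    unfolding exact_at_def f1 using N0 by auto
  show ?thesis
    unfolding torsionfree_def
  proof (intro CollectI conjI exI)
    show "\<forall>i\<in>{1..n}. P i \<in> projectives C" by (auto simp: P_def)
    show "f 1 \<in> Mor C M (P 1)" using f_arr [of 0] qsrc [of 0] by (simp add: P_def)
    show "\<forall>i\<in>{1..<n}. f (Suc i) \<in> Mor C (P i) (P (Suc i))"
    proof
      fix i assume "i \<in> {1..<n}"
      then obtain m where "i = Suc m" "i < n" by (cases i) auto
      then show "f (Suc i) \<in> Mor C (P i) (P (Suc i))" using f_arr [of i] qsrc [of i] by (simp add: P_def)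
    qed
    show "\<forall>i\<in>{1..<n}. exact_at C (f i) (f (Suc i))"
    proof
      fix i assume "i \<in> {1..<n}"
      then obtain m where "i = Suc m" "i < n" by (cases i) auto
      then show "exact_at C (f i) (f (Suc i))" using ex by simp
    qed
    show "\<forall>i\<in>{1..n}. \<exists>j. is_image C (f i) j \<and> left_projective_approximation C j"
    proof
      fix i assume "i \<in> {1..n}"
      then obtain m where "i = Suc m" "m < n" by (cases i) auto
      then show "\<exists>j. is_image C (f i) j \<and> left_projective_approximation C j" using img ke(1) by blast
    qed
  qed (use Z ex0 in simp_all)
qed

lemma torsionfree_iff_approximation_chain:
  "n \<ge> 1 \<Longrightarrow> M \<in> torsionfree C n \<longleftrightarrow> approximation_chain C n M"
  using approximation_chain_if_torsionfree torsionfree_if_approximation_chain by blast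

text \<open>The differential \<open>d i\<close> factors as an epi onto the next cocycles, with
  kernel \<open>k\<close>. For the approximation property, \<open>h\<close> is pulled back along the
  epi \<open>e'\<close> from the previous term to a cocycle of the Hom complex; acyclicity extends
  it over \<open>d (i - 1) = k \<cdot> e'\<close>, and \<open>e'\<close> cancels.\<close>

lemma totally_acyclic_step:
  assumes "totally_acyclic C X d" "is_kernel C (d i) k" "is_kernel C (d (i + 1)) k'"
  shows "approximation_step C (src C k) (src C k')"
proof -
  have ac: "\<And>i. exact_at C (d i) (d (i + 1))" and X: "\<And>i. X i \<in> projectives C"
    and "is_complex C X d" and hom: "\<And>P. P \<in> projectives C \<Longrightarrow> hom_acyclic C X d P"
    using assms(1) by (auto simp: totally_acyclic_def acyclic_complex_def)
  then have d: "\<And>i. X i \<in> obj C" "\<And>i. d i \<in> Mor C (X i) (X (i + 1))"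
    "\<And>i. d (i + 1) \<cdot> d i = mzero C (X i) (X (i + 2))"
    by (auto simp: is_complex_def)
  note [simp] = kernelD(2,3) [OF assms(2)] kernelD(2,3) [OF assms(3)] X d(1)
  have [simp]: "d i \<in> arr C" "src C (d i) = X i" "tgt C (d i) = X (i + 1)" for i
    using MorD [OF d(2)] by auto
  obtain e where e: "is_epi C e" "e \<in> Mor C (X i) (src C k')" "k' \<cdot> e = d i"
    using exact_at_factor [OF ac assms(3)] by auto
  obtain e' where e': "is_epi C e'" "e' \<in> Mor C (X (i - 1)) (src C k)" "k \<cdot> e' = d (i - 1)"
    using exact_at_factor [of "d (i - 1)" "d i" k] ac [of "i - 1"] assms(2) by auto
  note [simp] = MorD [OF e(2)] MorD [OF e'(2)]
  have "is_kernel C e k"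
    using kernel_mono_comp [OF kernel_mono [OF assms(3)], of e] assms(2) e(3) by simp
  then have "short_exact C k e" using short_exactI_epi e(1) by blast
  moreover have "left_projective_approximation C k"
  proof (rule approximationI)
    fix h assume h: "h \<in> arr C" "src C h = src C k" "tgt C h \<in> projectives C"
    let ?Q = "tgt C h"
    note [simp] = h(1,2) projectives_obj [OF h(3)]
    have "k \<cdot> (e' \<cdot> d (i - 2)) = d (i - 1) \<cdot> d (i - 2)"
      using comp_eq_comp [OF e'(3), of "d (i - 2)"] by simp
    also have "\<dots> = k \<cdot> mzero C (X (i - 2)) (src C k)" using d(3) [of "i - 2"] by simp
    finally have ed: "e' \<cdot> d (i - 2) = mzero C (X (i - 2)) (src C k)"
      by - (rule monoD [OF kernel_mono [OF assms(2)]], simp_all)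
    have "h \<cdot> e' \<in> kernel (hom_group C (X (i - 1)) ?Q) (hom_group C (X (i - 2)) ?Q) (\<lambda>g. g \<cdot> d (i - 2))"
      using ed by (simp add: kernel_def hom_group_def Mor_def)
    also have "\<dots> = (\<lambda>g. g \<cdot> d (i - 1)) ` carrier (hom_group C (X i) ?Q)"
      \<comment> \<open>Hom-acyclicity at \<open>X (i - 1)\<close> is its instance at index
        \<open>i - 2\<close>.\<close>
      using spec [OF hom [OF h(3), unfolded hom_acyclic_def], of "i - 2"] by simp
    finally obtain v where v: "v \<in> Mor C (X i) ?Q" "h \<cdot> e' = v \<cdot> d (i - 1)"
      by (auto simp: hom_group_def)
    note [simp] = MorD [OF v(1)]
    have "(v \<cdot> k) \<cdot> e' = v \<cdot> (k \<cdot> e')" by simp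
    then have "(v \<cdot> k) \<cdot> e' = h \<cdot> e'" using v(2) e'(3) by simp
    then have "v \<cdot> k = h" by - (rule epiD [OF e'(1)], simp_all)
    then show "\<exists>g\<in>Mor C (tgt C k) ?Q. g \<cdot> k = h" using v(1) by auto
  qed simp_all
  ultimately show ?thesis unfolding approximation_step_def using MorD(3) [OF e(2)] by blast
qed

lemma gorenstein_projective_imp_steps:
  assumes "gorenstein_projective C M"
  obtains S where "M \<in> S" "\<forall>N\<in>S. \<exists>N'\<in>S. approximation_step C N N'"
    "\<forall>N\<in>S. \<exists>N'\<in>S. approximation_step C N' N"
proof -
  obtain X d k where X: "totally_acyclic C X d" and k: "is_kernel C (d 0) k"
    and "isomorphic C M (src C k)"
    using assms unfolding gorenstein_projective_def by blast
  then obtain f where f: "f \<in> Mor C M (src C k)" "is_iso C f" unfolding isomorphic_def by blast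
  have darr: "d i \<in> arr C" for i
    using X MorD(1) unfolding totally_acyclic_def acyclic_complex_def is_complex_def by blast
  define S where "S = {src C k | k i. is_kernel C (d i) k}"
  show thesis
  proof (rule that; (intro ballI)?)
    have "is_kernel C (d 0) (k \<cdot> f)" using kernel_comp_iso f k MorD(3) [OF f(1)] by blast
    moreover have "src C (k \<cdot> f) = M" using MorD [OF f(1)] kernelD(2) [OF k] by simp
    ultimately show "M \<in> S" unfolding S_def by blast
    fix N assume "N \<in> S"
    then obtain k i where N: "N = src C k" and k: "is_kernel C (d i) k" unfolding S_def by blast
    obtain k1 k2 where k1: "is_kernel C (d (i + 1)) k1" and k2: "is_kernel C (d (i - 1)) k2"
      using ex_kernel darr by meson
    show "\<exists>N'\<in>S. approximation_step C N N'"
      using totally_acyclic_step [OF X k k1] k1 N unfolding S_def by blast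
    show "\<exists>N'\<in>S. approximation_step C N' N"
      using totally_acyclic_step [OF X k2, of k] k k2 N unfolding S_def by auto
  qed
qed

text \<open>Dependent choice produces steps from \<open>M\<close> in both directions; spliced
  together they form the complex, with \<open>N i\<close> as its cocycles in degree
  \<open>i\<close>.\<close>

lemma steps_imp_gorenstein_projective:
  assumes "M \<in> S" and right: "\<And>N. N \<in> S \<Longrightarrow> \<exists>N'\<in>S. approximation_step C N N'"
    and left: "\<And>N. N \<in> S \<Longrightarrow> \<exists>N'\<in>S. approximation_step C N' N"
  shows "gorenstein_projective C M"
proof -
  \<comment> \<open>The clause for \<open>n = 0\<close> in the invariant pins the choice sequence to
    start at \<open>M\<close>.\<close>
  have "\<exists>r. r 0 = M \<and> (\<forall>n. r n \<in> S \<and> approximation_step C (r n) (r (Suc n)))"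
    using dependent_nat_choice [of "\<lambda>n N. N \<in> S \<and> (n = 0 \<longrightarrow> N = M)" "\<lambda>_. approximation_step C"]
      assms(1) right by (metis nat.distinct(1))
  then obtain r where r: "r 0 = M" "\<And>n. approximation_step C (r n) (r (Suc n))" by blast
  have "\<exists>l. l 0 = M \<and> (\<forall>n. l n \<in> S \<and> approximation_step C (l (Suc n)) (l n))"
    using dependent_nat_choice [of "\<lambda>n N. N \<in> S \<and> (n = 0 \<longrightarrow> N = M)" "\<lambda>_ N N'. approximation_step C N' N"]
      assms(1) left by (metis nat.distinct(1))
  then obtain l where l: "l 0 = M" "\<And>n. approximation_step C (l (Suc n)) (l n)" by blast
  \<comment> \<open>The two sequences share the value \<open>M\<close> at 0, which is what makes the
    step from -1 to 0 fit.\<close>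
  define N :: "int \<Rightarrow> _" where "N i = (if i \<ge> 0 then r (nat i) else l (nat (- i)))" for i
  have step: "approximation_step C (N i) (N (i + 1))" for i
  proof (cases "i \<ge> 0")
    case True
    then show ?thesis using r(2) [of "nat i"] by (simp add: N_def nat_add_distrib)
  next
    case False
    then have "nat (- i) = Suc (nat (- (i + 1)))" by simp
    then show ?thesis using False l(2) [of "nat (- (i + 1))"] l(1) r(1)
      by (cases "i = -1") (simp_all add: N_def)
  qed
  then have [simp]: "N i \<in> obj C" for i using approximation_step_obj(1) by blast
  obtain k e where ke: "\<And>i. left_projective_approximation C (k i)"
    "\<And>i. short_exact C (k i) (e i)" "\<And>i. src C (k i) = N i" "\<And>i. tgt C (e i) = N (i + 1)"
    using step unfolding approximation_step_def by metis
  note [simp] = approximationD [OF ke(1)] projectives_obj [OF approximationD(2) [OF ke(1)]] ke(3,4)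
    short_exactD(6,7) [OF ke(2)]
  define X where "X i = tgt C (k i)" for i
  define d where "d i = k (i + 1) \<cdot> e i" for i
  have dMor: "d i \<in> Mor C (X i) (X (i + 1))" for i by (auto simp: d_def X_def intro!: MorI)
  have dk: "is_kernel C (d i) (k i)" for i
    using kernel_mono_comp [OF short_exactD(1) [OF ke(2) [of "i + 1"]], of "e i" "k i"]
      short_exactD(3) [OF ke(2)] by (simp add: d_def)
  have img: "is_image C (d i) (k (i + 1))" for i
    using cokernel_comp_epi [OF short_exactD(4) [OF ke(2)] _ short_exactD(2) [OF ke(2)], of i "i + 1"]
      short_exactD(3) [OF ke(2)] unfolding is_image_def d_def by auto
  have dd: "d (i + 1) \<cdot> d i = mzero C (X i) (X (i + 2))" for i
    using short_exactD(8) [OF ke(2), of "i + 1"] comp_eq_comp [OF short_exactD(8) [OF ke(2), of "i + 1"]]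
    by (simp add: d_def X_def add.commute [of _ 2])
  have "is_complex C X d" unfolding is_complex_def using dMor dd by (simp add: X_def)
  moreover have "exact_at C (d i) (d (i + 1))" for i
    unfolding exact_at_def using img dk MorD [OF dMor [of i]] MorD [OF dMor [of "i + 1"]] by auto
  moreover have "hom_acyclic C X d P" if P: "P \<in> projectives C" for P
    unfolding hom_acyclic_def
  proof
    fix i
    note [simp] = projectives_obj [OF P]
    \<comment> \<open>Cancelling the epi \<open>e i\<close> shows that \<open>g\<close> kills
      \<open>k (i + 1)\<close>, so it descends to the cocycles \<open>N (i + 2)\<close>; from there
      the approximation \<open>k (i + 2)\<close> extends it.\<close>
    have 1: "\<exists>v\<in>Mor C (X (i + 2)) P. g = v \<cdot> d (i + 1)"
      if g: "g \<in> Mor C (X (i + 1)) P" "g \<cdot> d i = mzero C (X i) P" for g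
    proof -
      note [simp] = MorD [OF g(1)]
      have "(g \<cdot> k (i + 1)) \<cdot> e i = mzero C (N (i + 1)) P \<cdot> e i"
        using g(2) by (simp add: d_def X_def)
      then have "g \<cdot> k (i + 1) = mzero C (N (i + 1)) P"
        by - (rule epiD [OF short_exactD(4) [OF ke(2) [of i]]], simp_all add: X_def)
      then obtain u where u: "u \<in> Mor C (N (i + 2)) P" "u \<cdot> e (i + 1) = g"
        using cokernel_factor [OF short_exactD(2) [OF ke(2), of "i + 1"], of g]
        by (auto simp: X_def add.commute [of _ 2])
      obtain v where v: "v \<in> Mor C (X (i + 2)) P" "v \<cdot> k (i + 2) = u"
        using approximation_extend [OF ke(1), of u "i + 2"] MorD [OF u(1)] P by (auto simp: X_def)
      have "v \<cdot> d (i + 1) = (v \<cdot> k (i + 2)) \<cdot> e (i + 1)"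
        using MorD [OF v(1)] by (simp add: d_def X_def add.commute [of _ 2])
      then show ?thesis using u(2) v by auto
    qed
    have 2: "v \<cdot> d (i + 1) \<in> Mor C (X (i + 1)) P \<and> (v \<cdot> d (i + 1)) \<cdot> d i = mzero C (X i) P"
      if v: "v \<in> Mor C (X (i + 2)) P" for v
      using MorD [OF v] MorD [OF dMor [of i]] MorD [OF dMor [of "i + 1"]] dd [of i]
      by (auto simp: add.commute [of _ 2])
    show "kernel (hom_group C (X (i + 1)) P) (hom_group C (X i) P) (\<lambda>g. g \<cdot> d i) =
        (\<lambda>g. g \<cdot> d (i + 1)) ` carrier (hom_group C (X (i + 2)) P)"
      using 1 2 by (auto simp: kernel_def hom_group_def simp del: comp_assoc)
  qed
  ultimately have "totally_acyclic C X d"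
    by (simp add: totally_acyclic_def acyclic_complex_def X_def)
  moreover have M: "M \<in> obj C" "src C (k 0) = M"
    using approximation_step_obj(1) r by (blast, simp add: N_def r(1))
  moreover have "isomorphic C M (src C (k 0))"
    unfolding isomorphic_def is_iso_def M(2)
    using M(1) id_in [OF M(1)] by (intro bexI [of _ "idm C M"]) (auto intro!: bexI [of _ "idm C M"])
  ultimately show ?thesis unfolding gorenstein_projective_def using dk by blast
qed

end

section \<open>Adjunctions and equivalences\<close>

context category
begin

lemma mono_cancel:
  assumes "is_mono C (g \<cdot> f)" "f \<in> arr C" "g \<in> arr C" "tgt C f = src C g"
  shows "is_mono C f"
proof (rule monoI)
  fix x y
  assume [simp]: "x \<in> arr C" "y \<in> arr C" "tgt C x = src C f" "tgt C y = src C f"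
     "src C x = src C y" and eq: "f \<cdot> x = f \<cdot> y"
  then have "(g \<cdot> f) \<cdot> x = (g \<cdot> f) \<cdot> y" using assms(2-4) by simp
  then show "x = y" by - (rule monoD [OF assms(1)], use assms(2-4) in simp_all)
qed (rule assms)

lemma epi_comp:
  assumes "is_epi C f" "is_epi C g" "tgt C f = src C g"
  shows "is_epi C (g \<cdot> f)"
proof (rule epiI)
  note [simp] = epi_arr [OF assms(1)] epi_arr [OF assms(2)] assms(3)
  show "g \<cdot> f \<in> arr C" by simp
  fix x y
  assume [simp]: "x \<in> arr C" "y \<in> arr C" "src C x = tgt C (g \<cdot> f)" "src C y = tgt C (g \<cdot> f)"
      "tgt C x = tgt C y" and eq: "x \<cdot> (g \<cdot> f) = y \<cdot> (g \<cdot> f)"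
  have "(x \<cdot> g) \<cdot> f = (y \<cdot> g) \<cdot> f" using eq by simp
  then have "x \<cdot> g = y \<cdot> g" by - (rule epiD [OF assms(1)], auto)
  then show "x = y" by - (rule epiD [OF assms(2)], auto)
qed

lemma isoE:
  assumes "is_iso C f"
  obtains g where "g \<in> Mor C (tgt C f) (src C f)" "g \<cdot> f = idm C (src C f)" "f \<cdot> g = idm C (tgt C f)"
    "is_iso C g"
proof -
  obtain g where g: "f \<in> arr C" "g \<in> Mor C (tgt C f) (src C f)" "g \<cdot> f = idm C (src C f)"
    "f \<cdot> g = idm C (tgt C f)"
    using assms unfolding is_iso_def by blast
  then have "is_iso C g" unfolding is_iso_def using arr_Mor [OF g(1)] MorD [OF g(2)] by auto
  then show thesis using g that by blast
qed

lemma mono_cancel_iso: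
  assumes "is_mono C (f \<cdot> a)" "is_iso C a" "f \<in> arr C" "tgt C a = src C f"
  shows "is_mono C f"
proof -
  obtain a' where a': "a' \<in> Mor C (tgt C a) (src C a)" "a \<cdot> a' = idm C (tgt C a)" "is_iso C a'"
    using isoE [OF assms(2)] by metis
  note [simp] = MorD [OF a'(1)] mono_arr [OF iso_mono [OF assms(2)]] assms(3,4)
  have "is_mono C ((f \<cdot> a) \<cdot> a')" using mono_comp [OF iso_mono [OF a'(3)] assms(1)] by simp
  then show ?thesis using a'(2) by simp
qed

lemma epi_cancel_iso:
  assumes "is_epi C (b \<cdot> f)" "is_iso C b" "f \<in> arr C" "tgt C f = src C b"
  shows "is_epi C f"
proof -
  obtain b' where b': "b' \<in> Mor C (tgt C b) (src C b)" "b' \<cdot> b = idm C (src C b)" "is_iso C b'"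
    using isoE [OF assms(2)] by metis
  note [simp] = MorD [OF b'(1)] mono_arr [OF iso_mono [OF assms(2)]] assms(3,4)
  have "is_epi C (b' \<cdot> (b \<cdot> f))" using epi_comp [OF assms(1) iso_epi [OF b'(3)]] by simp
  then show ?thesis using b'(2) comp_eq_comp [OF b'(2), of f] by simp
qed

end

lemma functorD:
  assumes "is_functor C D F" "category C"
  shows "X \<in> obj C \<Longrightarrow> fob F X \<in> obj D" "X \<in> obj C \<Longrightarrow> far F (idm C X) = idm D (fob F X)"
    "f \<in> Mor C X Y \<Longrightarrow> far F f \<in> Mor D (fob F X) (fob F Y)"
    "\<lbrakk>f \<in> arr C; g \<in> arr C; tgt C f = src C g\<rbrakk> \<Longrightarrow> far F (g \<cdot>\<^bsub>C\<^esub> f) = far F g \<cdot>\<^bsub>D\<^esub> far F f"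
proof -
  interpret C: category C by fact
  note F = assms(1) [unfolded is_functor_def]
  show "X \<in> obj C \<Longrightarrow> fob F X \<in> obj D" "X \<in> obj C \<Longrightarrow> far F (idm C X) = idm D (fob F X)"
    using F by auto
  show "f \<in> Mor C X Y \<Longrightarrow> far F f \<in> Mor D (fob F X) (fob F Y)"
    using F C.MorD(4,5) by metis
  assume "f \<in> arr C" "g \<in> arr C" "tgt C f = src C g"
  then have "f \<in> Mor C (src C f) (src C g)" "g \<in> Mor C (src C g) (tgt C g)" by auto
  then show "far F (g \<cdot>\<^bsub>C\<^esub> f) = far F g \<cdot>\<^bsub>D\<^esub> far F f"
    using F C.MorD(4,5) by metis
qed

lemma functor_arr:
  assumes "is_functor C D F" "category C" "f \<in> arr C"
  shows "far F f \<in> arr D" "src D (far F f) = fob F (src C f)" "tgt D (far F f) = fob F (tgt C f)"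
  using functorD(3) [OF assms(1,2) category.arr_Mor [OF assms(2,3)]] by (auto simp: Mor_def)

lemma functor_iso:
  assumes "is_functor C D F" "category C" "is_iso C f"
  shows "is_iso D (far F f)"
proof -
  interpret C: category C by fact
  obtain g where g: "g \<in> Mor C (tgt C f) (src C f)" "g \<cdot>\<^bsub>C\<^esub> f = idm C (src C f)"
    "f \<cdot>\<^bsub>C\<^esub> g = idm C (tgt C f)"
    using C.isoE [OF assms(3)] by metis
  note F = functor_arr [OF assms(1,2)] functorD [OF assms(1,2)]
  have f: "f \<in> arr C" using assms(3) by (simp add: is_iso_def)
  have "far F g \<in> Mor D (fob F (tgt C f)) (fob F (src C f))" using F(6) g(1) by blast
  moreover have "far F g \<cdot>\<^bsub>D\<^esub> far F f = idm D (fob F (src C f))"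
    "far F f \<cdot>\<^bsub>D\<^esub> far F g = idm D (fob F (tgt C f))"
    using F(7) [of f g] F(7) [of g f] f C.MorD [OF g(1)] g(2,3) F(5) by auto
  ultimately show ?thesis unfolding is_iso_def using F(1-3) [OF f] by auto
qed

locale adjunction = C: category C + D: category D
  for C :: "('o, 'm, 'x) cat_scheme" and D :: "('p, 'n, 'y) cat_scheme" +
  fixes F :: "('o, 'm, 'p, 'n) func" and G :: "('p, 'n, 'o, 'm) func" and \<phi> :: "'o \<Rightarrow> 'p \<Rightarrow> 'n \<Rightarrow> 'm"
  assumes functor_F: "is_functor C D F" and functor_G: "is_functor D C G"
    and bij: "\<lbrakk>X \<in> obj C; Y \<in> obj D\<rbrakk> \<Longrightarrow> bij_betw (\<phi> X Y) (Mor D (fob F X) Y) (Mor C X (fob G Y))"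
    and nat: "\<lbrakk>u \<in> Mor C X' X; X \<in> obj C; f \<in> Mor D (fob F X) Y; v \<in> Mor D Y Y'\<rbrakk> \<Longrightarrow>
      \<phi> X' Y' (v \<cdot>\<^bsub>D\<^esub> f \<cdot>\<^bsub>D\<^esub> far F u) = far G v \<cdot>\<^bsub>C\<^esub> \<phi> X Y f \<cdot>\<^bsub>C\<^esub> u"

lemma adjoint_pairE:
  assumes "adjoint_pair C D F G" "category C" "category D"
  obtains \<phi> where "adjunction C D F G \<phi>"
proof -
  interpret C: category C by fact
  interpret D: category D by fact
  obtain \<phi> where "is_functor C D F" "is_functor D C G"
    "\<forall>X\<in>obj C. \<forall>Y\<in>obj D. bij_betw (\<phi> X Y) (Mor D (fob F X) Y) (Mor C X (fob G Y))"
    "\<forall>X\<in>obj C. \<forall>X'\<in>obj C. \<forall>Y\<in>obj D. \<forall>Y'\<in>obj D.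
       \<forall>u\<in>Mor C X' X. \<forall>f\<in>Mor D (fob F X) Y. \<forall>v\<in>Mor D Y Y'.
         \<phi> X' Y' (v \<cdot>\<^bsub>D\<^esub> f \<cdot>\<^bsub>D\<^esub> far F u) = far G v \<cdot>\<^bsub>C\<^esub> \<phi> X Y f \<cdot>\<^bsub>C\<^esub> u"
    using assms(1) unfolding adjoint_pair_def by blast
  then have "adjunction C D F G \<phi>"
    by unfold_locales (blast, blast, blast, use C.MorD(4) D.MorD(4,5) in blast)
  then show thesis by (rule that)
qed

context adjunction
begin

lemmas F_arr [simp] = functor_arr [OF functor_F C.category_axioms]
lemmas G_arr [simp] = functor_arr [OF functor_G D.category_axioms]
lemmas F_simps [simp] = functorD(1,2,4) [OF functor_F C.category_axioms]
lemmas G_simps [simp] = functorD(1,2,4) [OF functor_G D.category_axioms]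

lemma transpose_Mor:
  assumes "f \<in> Mor D (fob F X) Y" "X \<in> obj C"
  shows "\<phi> X Y f \<in> Mor C X (fob G Y)"
  using bij_betwE [OF bij] assms D.MorD(5) by blast

lemma transpose_inj:
  assumes "\<phi> X Y f = \<phi> X Y g" "f \<in> Mor D (fob F X) Y" "g \<in> Mor D (fob F X) Y" "X \<in> obj C"
  shows "f = g"
  using inj_onD [OF bij_betw_imp_inj_on [OF bij], of X Y f g] assms D.MorD(5) by blast

lemma transpose_surj:
  assumes "g \<in> Mor C X (fob G Y)" "Y \<in> obj D"
  obtains f where "f \<in> Mor D (fob F X) Y" "\<phi> X Y f = g"
proof -
  have "g \<in> \<phi> X Y ` Mor D (fob F X) Y"
    using bij_betw_imp_surj_on [OF bij [OF C.MorD(4) [OF assms(1)] assms(2)]] assms(1) by simp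
  then show thesis using that by blast
qed

lemma transpose_comp_left:
  assumes "u \<in> Mor C X' X" "f \<in> Mor D (fob F X) Y"
  shows "\<phi> X' Y (f \<cdot>\<^bsub>D\<^esub> far F u) = \<phi> X Y f \<cdot>\<^bsub>C\<^esub> u"
proof -
  note [simp] = C.MorD [OF assms(1)] D.MorD [OF assms(2)]
    C.MorD [OF transpose_Mor [OF assms(2) C.MorD(5) [OF assms(1)]]]
  show ?thesis using nat [OF assms(1) _ assms(2) D.id_in] by simp
qed

lemma transpose_comp_right:
  assumes "v \<in> Mor D Y Y'" "f \<in> Mor D (fob F X) Y" "X \<in> obj C"
  shows "\<phi> X Y' (v \<cdot>\<^bsub>D\<^esub> f) = far G v \<cdot>\<^bsub>C\<^esub> \<phi> X Y f"
proof -
  note [simp] = D.MorD [OF assms(1)] D.MorD [OF assms(2)]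
    C.MorD [OF transpose_Mor [OF assms(2,3)]] assms(3)
  show ?thesis using nat [OF C.id_in assms(3,2,1)] by simp
qed

text \<open>Transposition turns precomposition with \<open>far F e\<close> into precomposition with
  \<open>e\<close>.\<close>

lemma left_adjoint_epi:
  assumes "is_epi C e" shows "is_epi D (far F e)"
proof (rule D.epiI)
  note e [simp] = C.epi_arr [OF assms]
  show "far F e \<in> arr D" by simp
  fix g h
  assume gh [simp]: "g \<in> arr D" "h \<in> arr D" "src D g = tgt D (far F e)" "src D h = tgt D (far F e)"
    "tgt D g = tgt D h" and eq: "g \<cdot>\<^bsub>D\<^esub> far F e = h \<cdot>\<^bsub>D\<^esub> far F e"
  let ?X = "tgt C e" and ?Y = "tgt D h"
  have M: "g \<in> Mor D (fob F ?X) ?Y" "h \<in> Mor D (fob F ?X) ?Y" by (auto intro!: D.MorI)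
  note [simp] = C.MorD [OF transpose_Mor [OF M(1)]] C.MorD [OF transpose_Mor [OF M(2)]]
  have "\<phi> ?X ?Y g \<cdot>\<^bsub>C\<^esub> e = \<phi> ?X ?Y h \<cdot>\<^bsub>C\<^esub> e"
    using transpose_comp_left [OF C.arr_Mor [OF e]] M eq by metis
  then have "\<phi> ?X ?Y g = \<phi> ?X ?Y h" by - (rule C.epiD [OF assms], simp_all)
  then show "g = h" using transpose_inj M by simp
qed

lemma right_adjoint_mono:
  assumes "is_mono D m" shows "is_mono C (far G m)"
proof (rule C.monoI)
  note m [simp] = D.mono_arr [OF assms]
  show "far G m \<in> arr C" by simp
  fix g h
  assume [simp]: "g \<in> arr C" "h \<in> arr C" "tgt C g = src C (far G m)" "tgt C h = src C (far G m)"
    "src C g = src C h" and eq: "far G m \<cdot>\<^bsub>C\<^esub> g = far G m \<cdot>\<^bsub>C\<^esub> h"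
  let ?X = "src C h" and ?Y = "src D m"
  have M: "g \<in> Mor C ?X (fob G ?Y)" "h \<in> Mor C ?X (fob G ?Y)" by (auto intro!: C.MorI)
  obtain g' where g': "g' \<in> Mor D (fob F ?X) ?Y" "\<phi> ?X ?Y g' = g"
    using transpose_surj [OF M(1)] by auto
  obtain h' where h': "h' \<in> Mor D (fob F ?X) ?Y" "\<phi> ?X ?Y h' = h"
    using transpose_surj [OF M(2)] by auto
  note [simp] = D.MorD [OF g'(1)] D.MorD [OF h'(1)]
  have "\<phi> ?X (tgt D m) (m \<cdot>\<^bsub>D\<^esub> g') = \<phi> ?X (tgt D m) (m \<cdot>\<^bsub>D\<^esub> h')"
    using transpose_comp_right [OF D.arr_Mor [OF m]] g' h' eq by simp
  then have "m \<cdot>\<^bsub>D\<^esub> g' = m \<cdot>\<^bsub>D\<^esub> h'" by (rule transpose_inj) (auto intro!: D.MorI)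
  then have "g' = h'" by - (rule D.monoD [OF assms], simp_all)
  then show "g = h" using g'(2) h'(2) by metis
qed

text \<open>A lifting problem for \<open>fob F P\<close> against \<open>e\<close> transposes to one
  for \<open>P\<close> against \<open>far G e\<close>.\<close>

lemma left_adjoint_projective:
  assumes "\<And>e. is_epi D e \<Longrightarrow> is_epi C (far G e)" "P \<in> projectives C"
  shows "fob F P \<in> projectives D"
  unfolding projectives_def
proof (intro CollectI conjI allI impI)
  note P [simp] = C.projectives_obj [OF assms(2)]
  show "fob F P \<in> obj D" by simp
  fix e f assume "is_epi D e \<and> f \<in> Mor D (fob F P) (tgt D e)"
  then have e: "is_epi D e" and f: "f \<in> Mor D (fob F P) (tgt D e)" by auto
  note e' [simp] = D.epi_arr [OF e]
  note t = transpose_Mor [OF f P]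
  obtain g where g: "g \<in> Mor C P (fob G (src D e))" "far G e \<cdot>\<^bsub>C\<^esub> g = \<phi> P (tgt D e) f"
    using C.projective_lift [OF assms(2) assms(1) [OF e], of "\<phi> P (tgt D e) f"] C.MorD [OF t] by auto
  obtain h where h: "h \<in> Mor D (fob F P) (src D e)" "\<phi> P (src D e) h = g"
    using transpose_surj [OF g(1)] by auto
  have "\<phi> P (tgt D e) (e \<cdot>\<^bsub>D\<^esub> h) = \<phi> P (tgt D e) f"
    using transpose_comp_right [OF D.arr_Mor [OF e'] h(1) P] g(2) h(2) by simp
  moreover have "e \<cdot>\<^bsub>D\<^esub> h \<in> Mor D (fob F P) (tgt D e)" using D.MorD [OF h(1)] by auto
  ultimately have "e \<cdot>\<^bsub>D\<^esub> h = f" using transpose_inj f P by blast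
  then show "\<exists>g\<in>Mor D (fob F P) (src D e). e \<cdot>\<^bsub>D\<^esub> g = f" using h(1) by blast
qed

text \<open>A map from \<open>fob F (src C k)\<close> to a projective \<open>Q\<close> transposes to
  a map into the projective \<open>fob G Q\<close>, which extends along \<open>k\<close>; the
  extension is transposed back.\<close>

lemma left_adjoint_approximation:
  assumes "left_projective_approximation C k" "fob F (tgt C k) \<in> projectives D"
    and "\<And>Q. Q \<in> projectives D \<Longrightarrow> fob G Q \<in> projectives C"
  shows "left_projective_approximation D (far F k)"
proof (rule D.approximationI)
  note k [simp] = C.approximationD(1) [OF assms(1)]
  show "far F k \<in> arr D" "tgt D (far F k) \<in> projectives D" using assms(2) by simp_all
  fix h assume [simp]: "h \<in> arr D" "src D h = src D (far F k)" and Q: "tgt D h \<in> projectives D"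
  let ?X = "src C k" and ?Y = "tgt D h"
  have h: "h \<in> Mor D (fob F ?X) ?Y" by (auto intro!: D.MorI)
  note t = transpose_Mor [OF h]
  obtain g where g: "g \<in> Mor C (tgt C k) (fob G ?Y)" "g \<cdot>\<^bsub>C\<^esub> k = \<phi> ?X ?Y h"
    using C.approximation_extend [OF assms(1), of "\<phi> ?X ?Y h"] C.MorD [OF t] assms(3) [OF Q] by auto
  obtain g' where g': "g' \<in> Mor D (fob F (tgt C k)) ?Y" "\<phi> (tgt C k) ?Y g' = g"
    using transpose_surj [OF g(1)] by auto
  have "\<phi> ?X ?Y (g' \<cdot>\<^bsub>D\<^esub> far F k) = \<phi> ?X ?Y h"
    using transpose_comp_left [OF C.arr_Mor [OF k] g'(1)] g(2) g'(2) by simp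
  moreover have "g' \<cdot>\<^bsub>D\<^esub> far F k \<in> Mor D (fob F ?X) ?Y" using D.MorD [OF g'(1)] by (auto intro!: D.MorI)
  ultimately have "g' \<cdot>\<^bsub>D\<^esub> far F k = h" using transpose_inj h by simp
  then show "\<exists>g\<in>Mor D (tgt D (far F k)) ?Y. g \<cdot>\<^bsub>D\<^esub> far F k = h" using g'(1) by auto
qed

end

section \<open>Equivalences preserve monos, epis and projectives\<close>

definition retraction_iso ::
  "('o, 'm, 'x) cat_scheme \<Rightarrow> ('o, 'm, 'p, 'n) func \<Rightarrow> ('p, 'n, 'o, 'm) func \<Rightarrow> ('o \<Rightarrow> 'm) \<Rightarrow> bool" where
  "retraction_iso C E S \<eta> \<longleftrightarrow>
     (\<forall>X\<in>obj C. \<eta> X \<in> Mor C (fob S (fob E X)) X \<and> is_iso C (\<eta> X)) \<and>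
     (\<forall>X\<in>obj C. \<forall>Y\<in>obj C. \<forall>f\<in>Mor C X Y. f \<cdot>\<^bsub>C\<^esub> \<eta> X = \<eta> Y \<cdot>\<^bsub>C\<^esub> far S (far E f))"

lemma retraction_isoD:
  assumes "retraction_iso C E S \<eta>" "category C"
  shows "X \<in> obj C \<Longrightarrow> \<eta> X \<in> Mor C (fob S (fob E X)) X" "X \<in> obj C \<Longrightarrow> is_iso C (\<eta> X)"
    "f \<in> Mor C X Y \<Longrightarrow> f \<cdot>\<^bsub>C\<^esub> \<eta> X = \<eta> Y \<cdot>\<^bsub>C\<^esub> far S (far E f)"
  using assms(1) category.MorD(4,5) [OF assms(2), of f X Y] unfolding retraction_iso_def by auto

text \<open>Both natural isomorphisms become instances of \<open>retraction_iso\<close>, with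
  composite and identity functors unfolded; by symmetry the quasi-inverse is an equivalence
  too.\<close>

lemma equivalenceE:
  assumes "equivalence C D E"
  obtains S \<eta> \<epsilon> where "is_functor C D E" "is_functor D C S" "equivalence D C S"
    "retraction_iso C E S \<eta>" "retraction_iso D S E \<epsilon>"
proof -
  obtain S where S: "is_functor C D E" "is_functor D C S"
    "nat_isomorphic C C (S \<circ>\<^sub>F E) id_func" "nat_isomorphic D D (E \<circ>\<^sub>F S) id_func"
    using assms unfolding equivalence_def by blast
  have "equivalence D C S" using S unfolding equivalence_def by blast
  moreover have "\<exists>\<eta>. retraction_iso C E S \<eta>" "\<exists>\<epsilon>. retraction_iso D S E \<epsilon>"
    using S(3,4) unfolding nat_isomorphic_def retraction_iso_def
    by (simp_all add: comp_func_def id_func_def)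
  ultimately show thesis using that S(1,2) by blast
qed

text \<open>By naturality \<open>far E f\<close> determines \<open>f \<cdot> \<eta> X\<close>, and
  the isomorphism \<open>\<eta> X\<close> cancels.\<close>

lemma equivalence_faithful:
  assumes "equivalence C D E" "category C" "f \<in> Mor C X Y" "g \<in> Mor C X Y" "far E f = far E g"
  shows "f = g"
proof -
  interpret C: category C by fact
  obtain S \<eta> where "retraction_iso C E S \<eta>" using equivalenceE [OF assms(1)] by blast
  note \<eta> = retraction_isoD [OF this assms(2)]
  note f = C.MorD [OF assms(3)] and g = C.MorD [OF assms(4)]
  have "f \<cdot>\<^bsub>C\<^esub> \<eta> X = g \<cdot>\<^bsub>C\<^esub> \<eta> X"
    using \<eta>(3) [OF assms(3)] \<eta>(3) [OF assms(4)] assms(5) by simp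
  then show "f = g"
    by - (rule C.epiD [OF C.iso_epi [OF \<eta>(2) [OF f(4)]]], use f g C.MorD [OF \<eta>(1) [OF f(4)]] in simp_all)
qed

text \<open>By naturality \<open>far S (far E m)\<close> is \<open>m\<close> up to isomorphism,
  hence monic; the faithful functor \<open>S\<close> reflects this to
  \<open>far E m\<close>.\<close>

lemma equivalence_mono:
  assumes "equivalence C D E" "category C" "category D" "is_mono C m"
  shows "is_mono D (far E m)"
proof -
  interpret C: category C by fact
  interpret D: category D by fact
  obtain S \<eta> where E: "is_functor C D E" and S: "is_functor D C S" "equivalence D C S"
    and "retraction_iso C E S \<eta>"
    using equivalenceE [OF assms(1)] by blast
  note \<eta> = retraction_isoD [OF this(4) assms(2)]
  note m = C.mono_arr [OF assms(4)]
  note [simp] = m functor_arr [OF E assms(2)] functor_arr [OF S(1) assms(3)]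
    functorD(1,4) [OF E assms(2)] functorD(1,4) [OF S(1) assms(3)]
  have \<eta>m: "is_iso C (\<eta> (src C m))" "is_iso C (\<eta> (tgt C m))"
    and M: "\<eta> (src C m) \<in> Mor C (fob S (fob E (src C m))) (src C m)"
      "\<eta> (tgt C m) \<in> Mor C (fob S (fob E (tgt C m))) (tgt C m)"
    using \<eta>(1,2) m by auto
  note [simp] = C.MorD [OF M(1)] C.MorD [OF M(2)]
  have "is_mono C (m \<cdot>\<^bsub>C\<^esub> \<eta> (src C m))"
    by (rule C.mono_comp [OF C.iso_mono [OF \<eta>m(1)] assms(4)]) simp
  then have "is_mono C (\<eta> (tgt C m) \<cdot>\<^bsub>C\<^esub> far S (far E m))"
    using \<eta>(3) [OF C.arr_Mor [OF m]] by simp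
  then have SE: "is_mono C (far S (far E m))" by (rule C.mono_cancel) simp_all
  show ?thesis
  proof (rule D.monoI)
    fix g h assume [simp]: "g \<in> arr D" "h \<in> arr D" "tgt D g = src D (far E m)"
      "tgt D h = src D (far E m)" "src D g = src D h"
      and eq: "far E m \<cdot>\<^bsub>D\<^esub> g = far E m \<cdot>\<^bsub>D\<^esub> h"
    have "far S (far E m \<cdot>\<^bsub>D\<^esub> g) = far S (far E m \<cdot>\<^bsub>D\<^esub> h)" using eq by simp
    then have "far S (far E m) \<cdot>\<^bsub>C\<^esub> far S g = far S (far E m) \<cdot>\<^bsub>C\<^esub> far S h" by simp
    then have "far S g = far S h" by - (rule C.monoD [OF SE], simp_all)
    then show "g = h"
      by - (rule equivalence_faithful [OF S(2) assms(3), of _ "src D h" "tgt D h"], auto intro!: D.MorI)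
  qed simp
qed

lemma equivalence_epi:
  assumes "equivalence C D E" "category C" "category D" "is_epi C m"
  shows "is_epi D (far E m)"
proof -
  interpret C: category C by fact
  interpret D: category D by fact
  obtain S \<eta> where E: "is_functor C D E" and S: "is_functor D C S" "equivalence D C S"
    and "retraction_iso C E S \<eta>"
    using equivalenceE [OF assms(1)] by blast
  note \<eta> = retraction_isoD [OF this(4) assms(2)]
  note m = C.epi_arr [OF assms(4)]
  note [simp] = m functor_arr [OF E assms(2)] functor_arr [OF S(1) assms(3)]
    functorD(1,4) [OF E assms(2)] functorD(1,4) [OF S(1) assms(3)]
  have \<eta>m: "is_iso C (\<eta> (src C m))" "is_iso C (\<eta> (tgt C m))"
    and M: "\<eta> (src C m) \<in> Mor C (fob S (fob E (src C m))) (src C m)"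
      "\<eta> (tgt C m) \<in> Mor C (fob S (fob E (tgt C m))) (tgt C m)"
    using \<eta>(1,2) m by auto
  note [simp] = C.MorD [OF M(1)] C.MorD [OF M(2)]
  have "is_epi C (m \<cdot>\<^bsub>C\<^esub> \<eta> (src C m))"
    by (rule C.epi_comp [OF C.iso_epi [OF \<eta>m(1)] assms(4)]) simp
  then have "is_epi C (\<eta> (tgt C m) \<cdot>\<^bsub>C\<^esub> far S (far E m))"
    using \<eta>(3) [OF C.arr_Mor [OF m]] by simp
  then have SE: "is_epi C (far S (far E m))" by (rule C.epi_cancel_iso) (simp_all add: \<eta>m)
  show ?thesis
  proof (rule D.epiI)
    fix g h assume [simp]: "g \<in> arr D" "h \<in> arr D" "src D g = tgt D (far E m)"
      "src D h = tgt D (far E m)" "tgt D g = tgt D h"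
      and eq: "g \<cdot>\<^bsub>D\<^esub> far E m = h \<cdot>\<^bsub>D\<^esub> far E m"
    have "far S (g \<cdot>\<^bsub>D\<^esub> far E m) = far S (h \<cdot>\<^bsub>D\<^esub> far E m)" using eq by simp
    then have "far S g \<cdot>\<^bsub>C\<^esub> far S (far E m) = far S h \<cdot>\<^bsub>C\<^esub> far S (far E m)" by simp
    then have "far S g = far S h" by - (rule C.epiD [OF SE], simp_all)
    then show "g = h"
      by - (rule equivalence_faithful [OF S(2) assms(3), of _ "src D h" "tgt D h"], auto intro!: D.MorI)
  qed simp
qed

text \<open>An equivalence comes here without triangle identities, so the lift is transported by
  hand: \<open>S\<close> moves the problem to \<open>C\<close>, where \<open>P\<close> lifts against
  the epi \<open>far S e\<close>, and \<open>E\<close> with \<open>\<epsilon>\<close> moves the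
  solution back.\<close>

lemma equivalence_projective:
  assumes "equivalence C D E" "category C" "category D" "P \<in> projectives C"
  shows "fob E P \<in> projectives D"
proof -
  interpret C: category C by fact
  interpret D: category D by fact
  obtain S \<eta> \<epsilon> where E: "is_functor C D E" and S: "is_functor D C S" "equivalence D C S"
    and R: "retraction_iso C E S \<eta>" "retraction_iso D S E \<epsilon>"
    using equivalenceE [OF assms(1)] by blast
  note \<eta> = retraction_isoD [OF R(1) assms(2)] and \<epsilon> = retraction_isoD [OF R(2) assms(3)]
  note P [simp] = C.projectives_obj [OF assms(4)]
  note [simp] = functor_arr [OF E assms(2)] functor_arr [OF S(1) assms(3)]
    functorD(1,4) [OF E assms(2)] functorD(1,4) [OF S(1) assms(3)]
  show ?thesis
    unfolding projectives_def
  proof (intro CollectI conjI allI impI)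
    show "fob E P \<in> obj D" by simp
    fix e f assume "is_epi D e \<and> f \<in> Mor D (fob E P) (tgt D e)"
    then have e: "is_epi D e" and f: "f \<in> Mor D (fob E P) (tgt D e)" by auto
    note e' [simp] = D.epi_arr [OF e] and f' [simp] = D.MorD [OF f]
    obtain \<theta> where \<theta>: "\<eta> P \<in> Mor C (fob S (fob E P)) P" "\<theta> \<in> Mor C P (fob S (fob E P))"
      "\<theta> \<cdot>\<^bsub>C\<^esub> \<eta> P = idm C (fob S (fob E P))"
      using \<eta>(1,2) [OF P] C.isoE [of "\<eta> P"] C.MorD [of "\<eta> P"] by metis
    note [simp] = C.MorD [OF \<theta>(1)] C.MorD [OF \<theta>(2)]
    obtain g where g: "g \<in> Mor C P (fob S (src D e))" "far S e \<cdot>\<^bsub>C\<^esub> g = far S f \<cdot>\<^bsub>C\<^esub> \<theta>"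
      using C.projective_lift [OF assms(4) equivalence_epi [OF S(2) assms(3,2) e], of "far S f \<cdot>\<^bsub>C\<^esub> \<theta>"]
      by auto
    note [simp] = C.MorD [OF g(1)] C.comp_eq_comp [OF g(2)]
    have ge: "far S e \<cdot>\<^bsub>C\<^esub> (g \<cdot>\<^bsub>C\<^esub> \<eta> P) = far S f"
      using \<theta>(3) by simp
    let ?X = "fob E P"
    have \<epsilon>M: "\<epsilon> ?X \<in> Mor D (fob E (fob S ?X)) ?X" "\<epsilon> (src D e) \<in> Mor D (fob E (fob S (src D e))) (src D e)"
      "\<epsilon> (tgt D e) \<in> Mor D (fob E (fob S (tgt D e))) (tgt D e)" "is_iso D (\<epsilon> ?X)"
      using \<epsilon>(1,2) by auto
    note [simp] = D.MorD [OF \<epsilon>M(1)] D.MorD [OF \<epsilon>M(2)] D.MorD [OF \<epsilon>M(3)]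
    obtain \<delta> where \<delta>: "\<delta> \<in> Mor D ?X (fob E (fob S ?X))" "\<epsilon> ?X \<cdot>\<^bsub>D\<^esub> \<delta> = idm D ?X"
      using D.isoE [OF \<epsilon>M(4)] by auto
    note [simp] = D.MorD [OF \<delta>(1)]
    \<comment> \<open>\<open>g \<cdot> \<eta> P\<close> solves the problem for
      \<open>far S e\<close> and \<open>far S f\<close>; \<open>\<delta>\<close> and
      \<open>\<epsilon>\<close> identify both ends of its image under \<open>E\<close> with the
      original objects.\<close>
    let ?h = "\<epsilon> (src D e) \<cdot>\<^bsub>D\<^esub> (far E (g \<cdot>\<^bsub>C\<^esub> \<eta> P) \<cdot>\<^bsub>D\<^esub> \<delta>)"
    have n: "e \<cdot>\<^bsub>D\<^esub> \<epsilon> (src D e) = \<epsilon> (tgt D e) \<cdot>\<^bsub>D\<^esub> far E (far S e)"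
      "f \<cdot>\<^bsub>D\<^esub> \<epsilon> ?X = \<epsilon> (tgt D e) \<cdot>\<^bsub>D\<^esub> far E (far S f)"
      using \<epsilon>(3) [OF D.arr_Mor [OF e']] \<epsilon>(3) [OF f] by simp_all
    have "e \<cdot>\<^bsub>D\<^esub> ?h = (e \<cdot>\<^bsub>D\<^esub> \<epsilon> (src D e)) \<cdot>\<^bsub>D\<^esub> (far E (g \<cdot>\<^bsub>C\<^esub> \<eta> P) \<cdot>\<^bsub>D\<^esub> \<delta>)" by simp
    also have "\<dots> = \<epsilon> (tgt D e) \<cdot>\<^bsub>D\<^esub> (far E (far S e) \<cdot>\<^bsub>D\<^esub> far E (g \<cdot>\<^bsub>C\<^esub> \<eta> P)) \<cdot>\<^bsub>D\<^esub> \<delta>"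
      unfolding n(1) by (simp del: functorD(4) [OF E assms(2)])
    also have "far E (far S e) \<cdot>\<^bsub>D\<^esub> far E (g \<cdot>\<^bsub>C\<^esub> \<eta> P) = far E (far S f)"
      using functorD(4) [OF E assms(2), of "g \<cdot>\<^bsub>C\<^esub> \<eta> P" "far S e"] ge by simp
    also have "\<epsilon> (tgt D e) \<cdot>\<^bsub>D\<^esub> far E (far S f) = f \<cdot>\<^bsub>D\<^esub> \<epsilon> ?X" using n(2) by simp
    also have "f \<cdot>\<^bsub>D\<^esub> \<epsilon> ?X \<cdot>\<^bsub>D\<^esub> \<delta> = f" using \<delta>(2) by simp
    finally show "\<exists>g\<in>Mor D ?X (src D e). e \<cdot>\<^bsub>D\<^esub> g = f" by (rule bexI [OF _ D.MorI]) simp_all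
  qed
qed

section \<open>Frobenius functors\<close>

locale frobenius_functor = A: abelian_category A + B: abelian_category B +
  left: adjunction A B F G \<phi> + right: adjunction B A G "\<beta> \<circ>\<^sub>F F \<circ>\<^sub>F \<alpha>" \<psi>
  for A :: "('o, 'm, 'x) addcat_scheme" and B :: "('p, 'n, 'y) addcat_scheme"
    and F :: "('o, 'm, 'p, 'n) func" and G :: "('p, 'n, 'o, 'm) func" and \<phi> \<psi> \<alpha> \<beta> +
  assumes additive: "additive_functor A B F"
    and equivalence_\<alpha>: "equivalence A A \<alpha>" and equivalence_\<beta>: "equivalence B B \<beta>"
begin

lemma comp_simps [simp]:
  "fob (\<beta> \<circ>\<^sub>F F \<circ>\<^sub>F \<alpha>) X = fob \<beta> (fob F (fob \<alpha> X))" "far (\<beta> \<circ>\<^sub>F F \<circ>\<^sub>F \<alpha>) f = far \<beta> (far F (far \<alpha> f))"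
  by (simp_all add: comp_func_def)

lemma F_zero:
  assumes "X \<in> obj A" "Y \<in> obj A"
  shows "far F (mzero A X Y) = mzero B (fob F X) (fob F Y)"
proof -
  have "far F \<in> hom (hom_group A X Y) (hom_group B (fob F X) (fob F Y))"
    using additive assms by (simp add: additive_functor_def)
  then have "far F \<one>\<^bsub>hom_group A X Y\<^esub> = \<one>\<^bsub>hom_group B (fob F X) (fob F Y)\<^esub>"
    by (rule hom_one) (auto intro!: comm_group.axioms(2) A.hom_comm_group B.hom_comm_group simp: assms)
  then show ?thesis by (simp add: hom_group_def)
qed

lemma F_epi: "is_epi A e \<Longrightarrow> is_epi B (far F e)"
  by (rule left.left_adjoint_epi)

lemma G_epi: "is_epi B e \<Longrightarrow> is_epi A (far G e)"
  by (rule right.left_adjoint_epi)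

text \<open>Its right adjoint \<open>G\<close> preserves epis, being a left adjoint itself.\<close>

lemma F_projective: "P \<in> projectives A \<Longrightarrow> fob F P \<in> projectives B"
  by (rule left.left_adjoint_projective [OF G_epi])

lemma right_adjoint_epi: "is_epi A e \<Longrightarrow> is_epi B (far \<beta> (far F (far \<alpha> e)))"
  using equivalence_epi [OF equivalence_\<alpha>] equivalence_epi [OF equivalence_\<beta>]
    A.category_axioms B.category_axioms F_epi by blast

lemma right_adjoint_projective:
  "P \<in> projectives A \<Longrightarrow> fob \<beta> (fob F (fob \<alpha> P)) \<in> projectives B"
  using equivalence_projective [OF equivalence_\<alpha>] equivalence_projective [OF equivalence_\<beta>]
    A.category_axioms B.category_axioms F_projective by blast

lemma G_projective: "P \<in> projectives B \<Longrightarrow> fob G P \<in> projectives A"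
  by (rule right.left_adjoint_projective) (simp_all add: right_adjoint_epi)

text \<open>The right adjoint \<open>\<beta> F \<alpha>\<close> of \<open>G\<close> preserves monomorphisms, and \<open>F\<close> inherits this because
  every morphism is isomorphic to one in the image of \<open>\<alpha>\<close> and \<open>\<beta>\<close> is faithful.\<close>

lemma F_mono:
  assumes "is_mono A m" shows "is_mono B (far F m)"
proof -
  obtain S \<eta> \<epsilon> where \<alpha>: "is_functor A A \<alpha>" and S: "is_functor A A S" "equivalence A A S"
    and R: "retraction_iso A S \<alpha> \<epsilon>"
    using equivalenceE [OF equivalence_\<alpha>] by metis
  have \<beta>: "is_functor B B \<beta>" using equivalence_\<beta> by (simp add: equivalence_def)
  note \<epsilon> = retraction_isoD [OF R A.category_axioms]
  note m = A.mono_arr [OF assms]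
  note [simp] = functor_arr [OF \<alpha> A.category_axioms] functor_arr [OF S(1) A.category_axioms]
    functor_arr [OF \<beta> B.category_axioms] m functorD(1) [OF \<alpha> A.category_axioms]
    functorD(1) [OF S(1) A.category_axioms] functorD(1) [OF \<beta> B.category_axioms]
  let ?X = "src A m" and ?Y = "tgt A m" and ?f = "far F (far \<alpha> (far S m))"
  \<comment> \<open>\<open>\<beta> F \<alpha>\<close> is applied to \<open>far S m\<close>, with
    \<open>S\<close> quasi-inverse to \<open>\<alpha>\<close>, because
    \<open>far \<alpha> (far S m)\<close> is \<open>m\<close> up to isomorphism.\<close>
  have "is_mono A (far S m)"
    using equivalence_mono [OF S(2)] assms A.category_axioms by blast
  then have H: "is_mono B (far \<beta> ?f)" using right.right_adjoint_mono by fastforce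
  have f: "is_mono B ?f"
  proof (rule B.monoI)
    fix g h assume [simp]: "g \<in> arr B" "h \<in> arr B" "tgt B g = src B ?f" "tgt B h = src B ?f"
      "src B g = src B h" and eq: "?f \<cdot>\<^bsub>B\<^esub> g = ?f \<cdot>\<^bsub>B\<^esub> h"
    have "far \<beta> ?f \<cdot>\<^bsub>B\<^esub> far \<beta> g = far \<beta> ?f \<cdot>\<^bsub>B\<^esub> far \<beta> h"
      using functorD(4) [OF \<beta> B.category_axioms, of g ?f] functorD(4) [OF \<beta> B.category_axioms, of h ?f] eq
      by simp
    then have "far \<beta> g = far \<beta> h" by - (rule B.monoD [OF H], simp_all)
    then show "g = h"
      by - (rule equivalence_faithful [OF equivalence_\<beta> B.category_axioms, of _ "src B h" "tgt B h"],
        auto intro!: B.MorI)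
  qed simp
  have \<epsilon>X: "\<epsilon> ?X \<in> Mor A (fob \<alpha> (fob S ?X)) ?X" "is_iso A (\<epsilon> ?X)"
    and \<epsilon>Y: "\<epsilon> ?Y \<in> Mor A (fob \<alpha> (fob S ?Y)) ?Y" "is_iso A (\<epsilon> ?Y)"
    using \<epsilon>(1,2) by auto
  note [simp] = A.MorD [OF \<epsilon>X(1)] A.MorD [OF \<epsilon>Y(1)]
  have "far F (m \<cdot>\<^bsub>A\<^esub> \<epsilon> ?X) = far F (\<epsilon> ?Y \<cdot>\<^bsub>A\<^esub> far \<alpha> (far S m))"
    using \<epsilon>(3) [OF A.arr_Mor [OF m]] by simp
  then have eq: "far F m \<cdot>\<^bsub>B\<^esub> far F (\<epsilon> ?X) = far F (\<epsilon> ?Y) \<cdot>\<^bsub>B\<^esub> ?f" by simp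
  have iso: "is_iso B (far F (\<epsilon> ?X))" "is_iso B (far F (\<epsilon> ?Y))"
    using functor_iso [OF left.functor_F A.category_axioms] \<epsilon>X \<epsilon>Y by auto
  have "is_mono B (far F m \<cdot>\<^bsub>B\<^esub> far F (\<epsilon> ?X))"
    unfolding eq by (rule B.mono_comp [OF f B.iso_mono [OF iso(2)]]) simp
  then show ?thesis by (rule B.mono_cancel_iso [OF _ iso(1)]) simp_all
qed

text \<open>A left adjoint preserves cokernels: a map killing \<open>far F k\<close> transposes to
  one killing \<open>k\<close>, which factors through \<open>c\<close>.\<close>

lemma F_cokernel:
  assumes "is_cokernel A k c" shows "is_cokernel B (far F k) (far F c)"
proof (rule B.is_cokernelI)
  note [simp] = A.cokernelD [OF assms]
  show "is_epi B (far F c)" using F_epi A.cokernel_epi [OF assms] by blast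
  show "far F k \<in> arr B" "src B (far F c) = tgt B (far F k)" by simp_all
  have "far F c \<cdot>\<^bsub>B\<^esub> far F k = far F (c \<cdot>\<^bsub>A\<^esub> k)" by (simp del: A.cokernelD(4) [OF assms])
  then show "far F c \<cdot>\<^bsub>B\<^esub> far F k = mzero B (src B (far F k)) (tgt B (far F c))"
    using F_zero by simp
  fix h assume [simp]: "h \<in> arr B" "src B h = tgt B (far F k)"
    and h: "h \<cdot>\<^bsub>B\<^esub> far F k = mzero B (src B (far F k)) (tgt B h)"
  let ?X = "src A k" and ?Y = "tgt A k" and ?Z = "tgt A c" and ?W = "tgt B h"
  have hM: "h \<in> Mor B (fob F ?Y) ?W" by (auto intro!: B.MorI)
  note t [simp] = A.MorD [OF left.transpose_Mor [OF hM A.tgt_in]]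
  have kM: "k \<in> Mor A ?X ?Y" and cM: "c \<in> Mor A ?Y ?Z" by (auto intro!: A.MorI)
  have 0: "mzero A ?X ?X \<in> Mor A ?X ?X" "mzero B (fob F ?X) ?W \<in> Mor B (fob F ?X) ?W"
    by (auto intro!: A.MorI B.MorI)
  note t0 [simp] = A.MorD [OF left.transpose_Mor [OF 0(2) A.src_in]]
  \<comment> \<open>\<open>\<phi>\<close> is not assumed additive. That it sends zero to zero
    follows from naturality, since the zero map equals itself composed with \<open>far F\<close> of
    a zero map.\<close>
  have "mzero B (fob F ?X) ?W \<cdot>\<^bsub>B\<^esub> far F (mzero A ?X ?X) = mzero B (fob F ?X) ?W"
    using F_zero by simp
  then have "\<phi> ?X ?W (mzero B (fob F ?X) ?W) = \<phi> ?X ?W (mzero B (fob F ?X) ?W) \<cdot>\<^bsub>A\<^esub> mzero A ?X ?X"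
    using left.transpose_comp_left [OF 0] by simp
  then have \<phi>0: "\<phi> ?X ?W (mzero B (fob F ?X) ?W) = mzero A ?X (fob G ?W)" by simp
  have "\<phi> ?Y ?W h \<cdot>\<^bsub>A\<^esub> k = \<phi> ?X ?W (h \<cdot>\<^bsub>B\<^esub> far F k)"
    using left.transpose_comp_left [OF kM hM] by simp
  also have "\<dots> = mzero A ?X (fob G ?W)" using \<phi>0 h by simp
  finally obtain u where u: "u \<in> Mor A ?Z (fob G ?W)" "u \<cdot>\<^bsub>A\<^esub> c = \<phi> ?Y ?W h"
    using A.cokernel_factor [OF assms, of "\<phi> ?Y ?W h"] by auto
  obtain v where v: "v \<in> Mor B (fob F ?Z) ?W" "\<phi> ?Z ?W v = u"
    using left.transpose_surj [OF u(1)] by auto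
  note [simp] = B.MorD [OF v(1)]
  have "\<phi> ?Y ?W (v \<cdot>\<^bsub>B\<^esub> far F c) = \<phi> ?Y ?W h"
    using left.transpose_comp_left [OF cM v(1)] u(2) v(2) by simp
  then have "v \<cdot>\<^bsub>B\<^esub> far F c = h"
    by (rule left.transpose_inj [OF _ _ hM]) (auto intro!: B.MorI)
  then show "\<exists>u\<in>Mor B (tgt B (far F c)) ?W. u \<cdot>\<^bsub>B\<^esub> far F c = h" using v(1) by auto
qed

lemma F_short_exact: "short_exact A k e \<Longrightarrow> short_exact B (far F k) (far F e)"
  using F_mono F_cokernel unfolding short_exact_def by blast

lemma F_approximation_step:
  assumes "approximation_step A M N" shows "approximation_step B (fob F M) (fob F N)"
proof -
  obtain k e where k: "left_projective_approximation A k" and ke: "short_exact A k e"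
    and "src A k = M" "tgt A e = N"
    using assms unfolding approximation_step_def by blast
  moreover have "left_projective_approximation B (far F k)"
    using left.left_adjoint_approximation [OF k] F_projective G_projective A.approximationD(2) [OF k]
    by blast
  ultimately show ?thesis
    unfolding approximation_step_def
    using F_short_exact [OF ke] left.F_arr A.short_exactD(5,6) [OF ke] by blast
qed

lemma F_approximation_chain:
  "approximation_chain A n X \<Longrightarrow> approximation_chain B n (fob F X)"
  by (induction n arbitrary: X) (auto dest: F_approximation_step)

lemma F_torsionfree: "\<lbrakk>X \<in> torsionfree A n; n \<ge> 1\<rbrakk> \<Longrightarrow> fob F X \<in> torsionfree B n"
  using F_approximation_chain A.torsionfree_iff_approximation_chain
    B.torsionfree_iff_approximation_chain by blast

lemma F_gorenstein_projective:
  assumes "gorenstein_projective A X" shows "gorenstein_projective B (fob F X)"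
proof -
  obtain S where S: "X \<in> S" "\<forall>N\<in>S. \<exists>N'\<in>S. approximation_step A N N'"
    "\<forall>N\<in>S. \<exists>N'\<in>S. approximation_step A N' N"
    using A.gorenstein_projective_imp_steps [OF assms] .
  show ?thesis
    by (rule B.steps_imp_gorenstein_projective [of _ "fob F ` S"])
      (use S F_approximation_step in blast)+
qed

section \<open>Reflection along a faithful Frobenius functor\<close>

context
  assumes faithful: "faithful A B F"
begin

lemma F_faithful:
  assumes "far F f = far F g" "f \<in> Mor A X Y" "g \<in> Mor A X Y" shows "f = g"
proof -
  have "inj_on (far F) (Mor A X Y)"
    using faithful A.MorD(4,5) [OF assms(2)] unfolding faithful_def by blast
  then show ?thesis using assms by (meson inj_onD)
qed

lemma right_adjoint_faithful:
  assumes "far \<beta> (far F (far \<alpha> f)) = far \<beta> (far F (far \<alpha> g))" "f \<in> Mor A X Y" "g \<in> Mor A X Y"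
  shows "f = g"
proof -
  have \<alpha>: "is_functor A A \<alpha>" using equivalence_\<alpha> by (simp add: equivalence_def)
  note M = functorD(3) [OF \<alpha> A.category_axioms]
  note N = functorD(3) [OF left.functor_F A.category_axioms]
  have "far F (far \<alpha> f) = far F (far \<alpha> g)"
    using equivalence_faithful [OF equivalence_\<beta> B.category_axioms N [OF M [OF assms(2)]] N [OF M [OF assms(3)]]]
      assms(1) by blast
  then have "far \<alpha> f = far \<alpha> g" using F_faithful M assms(2,3) by blast
  then show ?thesis using equivalence_faithful [OF equivalence_\<alpha> A.category_axioms assms(2,3)] by blast
qed

text \<open>Composing the transpose of \<open>u\<close> with \<open>g\<close> is transposing
  \<open>u \<cdot> far F g\<close>; so \<open>u\<close> cancels because it is monic, and
  \<open>far F\<close> because it is faithful.\<close>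

lemma transpose_mono:
  assumes "is_mono B u" "src B u = fob F X" "X \<in> obj A"
  shows "is_mono A (\<phi> X (tgt B u) u)"
proof -
  have u: "u \<in> Mor B (fob F X) (tgt B u)" using B.mono_arr assms by auto
  note [simp] = A.MorD [OF left.transpose_Mor [OF u assms(3)]] B.MorD(1,2) [OF u]
  show ?thesis
  proof (rule A.monoI)
    fix g h assume [simp]: "g \<in> arr A" "h \<in> arr A" "tgt A g = src A (\<phi> X (tgt B u) u)"
      "tgt A h = src A (\<phi> X (tgt B u) u)" "src A g = src A h"
      and eq: "\<phi> X (tgt B u) u \<cdot>\<^bsub>A\<^esub> g = \<phi> X (tgt B u) u \<cdot>\<^bsub>A\<^esub> h"
    have M: "g \<in> Mor A (src A h) X" "h \<in> Mor A (src A h) X" by (auto intro!: A.MorI)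
    have "\<phi> (src A h) (tgt B u) (u \<cdot>\<^bsub>B\<^esub> far F g) = \<phi> (src A h) (tgt B u) (u \<cdot>\<^bsub>B\<^esub> far F h)"
      by (simp only: left.transpose_comp_left [OF M(1) u] left.transpose_comp_left [OF M(2) u] eq)
    then have "u \<cdot>\<^bsub>B\<^esub> far F g = u \<cdot>\<^bsub>B\<^esub> far F h"
      by (rule left.transpose_inj) (auto intro!: B.MorI)
    then have "far F g = far F h" by - (rule B.monoD [OF assms(1)], simp_all)
    then show "g = h" using F_faithful M by blast
  qed simp
qed

text \<open>The counit of the adjunction between \<open>G\<close> and the faithful functor \<open>\<beta> F \<alpha>\<close> is epic, hence
  splits over projective objects.\<close>

lemma projective_retract:
  assumes "P \<in> projectives A"
  obtains Q r s where "Q \<in> projectives B" "r \<in> Mor A (fob G Q) P" "s \<in> Mor A P (fob G Q)"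
    "r \<cdot>\<^bsub>A\<^esub> s = idm A P"
proof -
  note P [simp] = A.projectives_obj [OF assms]
  let ?Q = "fob \<beta> (fob F (fob \<alpha> P))"
  note Q = right_adjoint_projective [OF assms]
  note Qo [simp] = B.projectives_obj [OF Q]
  \<comment> \<open>The counit at \<open>P\<close>, as the map whose transpose under
    \<open>\<psi>\<close> is the identity.\<close>
  obtain r where r: "r \<in> Mor A (fob G ?Q) P" "\<psi> ?Q P r = idm B ?Q"
    using right.transpose_surj [of "idm B ?Q" ?Q P] B.id_in [OF Qo] by auto
  note r' [simp] = A.MorD [OF r(1)]
  have "is_epi A r"
  proof (rule A.epiI)
    fix g h assume [simp]: "g \<in> arr A" "h \<in> arr A" "src A g = tgt A r" "src A h = tgt A r"
      "tgt A g = tgt A h" and eq: "g \<cdot>\<^bsub>A\<^esub> r = h \<cdot>\<^bsub>A\<^esub> r"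
    have M: "g \<in> Mor A P (tgt A h)" "h \<in> Mor A P (tgt A h)" by (auto intro!: A.MorI)
    have "far \<beta> (far F (far \<alpha> g)) \<cdot>\<^bsub>B\<^esub> idm B ?Q = far \<beta> (far F (far \<alpha> h)) \<cdot>\<^bsub>B\<^esub> idm B ?Q"
      using right.transpose_comp_right [OF M(1) r(1) Qo] right.transpose_comp_right [OF M(2) r(1) Qo]
        eq r(2) by simp
    then have "far \<beta> (far F (far \<alpha> g)) = far \<beta> (far F (far \<alpha> h))"
      using right.G_arr [of g] right.G_arr [of h] by simp
    then show "g = h" using right_adjoint_faithful M by blast
  qed simp
  then obtain s where "s \<in> Mor A P (fob G ?Q)" "r \<cdot>\<^bsub>A\<^esub> s = idm A P"
    using A.projective_lift [OF assms, of r "idm A P"] by auto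
  then show thesis using that Q r(1) by blast
qed

text \<open>A map \<open>h\<close> into a projective is first embedded by \<open>s\<close> into some
  \<open>fob G Q\<close>, where it is a transpose and extends over that of \<open>u\<close>; the
  retraction \<open>r\<close> then returns to the original target.\<close>

lemma transpose_approximation:
  assumes "left_projective_approximation B u" "src B u = fob F X" "X \<in> obj A"
  shows "left_projective_approximation A (\<phi> X (tgt B u) u)"
proof -
  have u: "u \<in> Mor B (fob F X) (tgt B u)" using B.approximationD(1) assms by auto
  note [simp] = A.MorD [OF left.transpose_Mor [OF u assms(3)]] B.MorD(1,2) [OF u]
  show ?thesis
  proof (rule A.approximationI)
    show "tgt A (\<phi> X (tgt B u) u) \<in> projectives A"
      using G_projective B.approximationD(2) [OF assms(1)] by simp
    fix h assume [simp]: "h \<in> arr A" "src A h = src A (\<phi> X (tgt B u) u)" and P: "tgt A h \<in> projectives A"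
    obtain Q r s where Q: "Q \<in> projectives B" and rs: "r \<in> Mor A (fob G Q) (tgt A h)"
      "s \<in> Mor A (tgt A h) (fob G Q)" and rs_id: "r \<cdot>\<^bsub>A\<^esub> s = idm A (tgt A h)"
      using projective_retract [OF P] .
    note [simp] = A.MorD [OF rs(1)] A.MorD [OF rs(2)]
    have sh: "s \<cdot>\<^bsub>A\<^esub> h \<in> Mor A X (fob G Q)" by (auto intro!: A.MorI)
    obtain f where f: "f \<in> Mor B (fob F X) Q" "\<phi> X Q f = s \<cdot>\<^bsub>A\<^esub> h"
      using left.transpose_surj [OF sh] B.projectives_obj [OF Q] by auto
    obtain g where g: "g \<in> Mor B (tgt B u) Q" "g \<cdot>\<^bsub>B\<^esub> u = f"
      using B.approximation_extend [OF assms(1), of f] B.MorD [OF f(1)] Q by auto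
    note [simp] = B.MorD [OF g(1)]
    have "far G g \<cdot>\<^bsub>A\<^esub> \<phi> X (tgt B u) u = s \<cdot>\<^bsub>A\<^esub> h"
      using left.transpose_comp_right [OF g(1) u assms(3)] g(2) f(2) by simp
    then have "(r \<cdot>\<^bsub>A\<^esub> far G g) \<cdot>\<^bsub>A\<^esub> \<phi> X (tgt B u) u = (r \<cdot>\<^bsub>A\<^esub> s) \<cdot>\<^bsub>A\<^esub> h" by simp
    then have "(r \<cdot>\<^bsub>A\<^esub> far G g) \<cdot>\<^bsub>A\<^esub> \<phi> X (tgt B u) u = h" using rs_id by simp
    then show "\<exists>g\<in>Mor A (tgt A (\<phi> X (tgt B u) u)) (tgt A h). g \<cdot>\<^bsub>A\<^esub> \<phi> X (tgt B u) u = h"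
      by (rule bexI [OF _ A.MorI]) simp_all
  qed simp
qed

text \<open>After embedding its target into some \<open>fob G Q\<close>, a map from
  \<open>src A k\<close> is the transpose of a map that extends along \<open>far F k\<close>;
  transposing the extension gives one along \<open>k\<close>.\<close>

lemma F_reflects_approximation:
  assumes "left_projective_approximation B (far F k)" "k \<in> arr A" "tgt A k \<in> projectives A"
  shows "left_projective_approximation A k"
proof (rule A.approximationI)
  note [simp] = assms(2)
  fix h assume [simp]: "h \<in> arr A" "src A h = src A k" and P: "tgt A h \<in> projectives A"
  obtain Q r s where Q: "Q \<in> projectives B" and rs: "r \<in> Mor A (fob G Q) (tgt A h)"
    "s \<in> Mor A (tgt A h) (fob G Q)" and rs_id: "r \<cdot>\<^bsub>A\<^esub> s = idm A (tgt A h)"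
    using projective_retract [OF P] .
  note [simp] = A.MorD [OF rs(1)] A.MorD [OF rs(2)]
  have sh: "s \<cdot>\<^bsub>A\<^esub> h \<in> Mor A (src A k) (fob G Q)" by (auto intro!: A.MorI)
  obtain f where f: "f \<in> Mor B (fob F (src A k)) Q" "\<phi> (src A k) Q f = s \<cdot>\<^bsub>A\<^esub> h"
    using left.transpose_surj [OF sh] B.projectives_obj [OF Q] by auto
  obtain g where g: "g \<in> Mor B (fob F (tgt A k)) Q" "g \<cdot>\<^bsub>B\<^esub> far F k = f"
    using B.approximation_extend [OF assms(1), of f] B.MorD [OF f(1)] Q by auto
  let ?g = "\<phi> (tgt A k) Q g"
  note [simp] = A.MorD [OF left.transpose_Mor [OF g(1) A.tgt_in [OF assms(2)]]]
  have "?g \<cdot>\<^bsub>A\<^esub> k = s \<cdot>\<^bsub>A\<^esub> h"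
    using left.transpose_comp_left [OF A.arr_Mor [OF assms(2)] g(1)] g(2) f(2) by simp
  then have "(r \<cdot>\<^bsub>A\<^esub> ?g) \<cdot>\<^bsub>A\<^esub> k = (r \<cdot>\<^bsub>A\<^esub> s) \<cdot>\<^bsub>A\<^esub> h" by simp
  then have "(r \<cdot>\<^bsub>A\<^esub> ?g) \<cdot>\<^bsub>A\<^esub> k = h" using rs_id by simp
  then show "\<exists>g\<in>Mor A (tgt A k) (tgt A h). g \<cdot>\<^bsub>A\<^esub> k = h"
    by (rule bexI [OF _ A.MorI]) simp_all
qed (use assms in simp_all)

text \<open>The transposed approximation starts a step from \<open>X\<close> to some
  \<open>Y\<close>. Under \<open>F\<close> it becomes a second step from \<open>fob F X\<close>,
  whose end is compared with \<open>N\<close>.\<close>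

lemma approximation_step_lift:
  assumes "approximation_step B (fob F X) N" "X \<in> obj A"
  obtains Y where "approximation_step A X Y" "stable_retract B (fob F Y) N"
proof -
  obtain u where u: "left_projective_approximation B u" "is_mono B u" "src B u = fob F X"
    using assms(1) B.short_exactD(1) unfolding approximation_step_def by blast
  have "u \<in> Mor B (fob F X) (tgt B u)" using B.approximationD(1) u by auto
  then have "src A (\<phi> X (tgt B u) u) = X" using A.MorD(2) left.transpose_Mor assms(2) by blast
  then obtain Y where Y: "approximation_step A X Y"
    using A.approximation_stepI [OF transpose_approximation [OF u(1,3) assms(2)]
      transpose_mono [OF u(2,3) assms(2)]] by metis
  have "stable_retract B (fob F Y) N"
    using B.stable_retract_of_steps [OF B.stable_retract_refl F_approximation_step [OF Y] assms(1)]
      assms(2) by simp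
  then show thesis using that Y by blast
qed

lemma F_reflects_approximation_chain:
  assumes "approximation_chain B n (fob F X)" "X \<in> obj A"
  shows "approximation_chain A n X"
  using assms
proof (induction n arbitrary: X)
  case (Suc n)
  then obtain N where N: "approximation_step B (fob F X) N" "approximation_chain B n N" by auto
  obtain Y where Y: "approximation_step A X Y" "stable_retract B (fob F Y) N"
    using approximation_step_lift [OF N(1) Suc.prems(2)] .
  then have "approximation_chain A n Y"
    using Suc.IH B.stable_retract_chain [OF Y(2) N(2)] A.approximation_step_obj(2) by blast
  then show ?case using Y(1) by auto
qed simp

lemma F_reflects_torsionfree:
  "\<lbrakk>fob F X \<in> torsionfree B n; X \<in> obj A; n \<ge> 1\<rbrakk> \<Longrightarrow> X \<in> torsionfree A n"
  using F_reflects_approximation_chain A.torsionfree_iff_approximation_chain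
    B.torsionfree_iff_approximation_chain by blast

lemma F_reflects_gorenstein_projective:
  assumes "gorenstein_projective B (fob F X)" "X \<in> obj A" "enough_projectives A"
  shows "gorenstein_projective A X"
proof -
  obtain S where S: "fob F X \<in> S" "\<forall>N\<in>S. \<exists>N'\<in>S. approximation_step B N N'"
    "\<forall>N\<in>S. \<exists>N'\<in>S. approximation_step B N' N"
    using B.gorenstein_projective_imp_steps [OF assms(1)] .
  \<comment> \<open>Members of \<open>S\<close> need not lie in the image of \<open>F\<close>; being
    a stable retract of a member is what each lifted step preserves.\<close>
  let ?T = "{Y \<in> obj A. \<exists>N\<in>S. stable_retract B (fob F Y) N}"
  show ?thesis
  proof (rule A.steps_imp_gorenstein_projective [of _ ?T])
    show "X \<in> ?T" using S(1) assms(2) B.stable_retract_refl left.F_simps(1) by blast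
  next
    fix Y assume "Y \<in> ?T"
    then obtain N where Y: "Y \<in> obj A" and N: "N \<in> S" "stable_retract B (fob F Y) N" by blast
    obtain N' where N': "N' \<in> S" "approximation_step B N N'" using S(2) N(1) by blast
    \<comment> \<open>This step out of \<open>fob F Y\<close> is what can be lifted to a step from
      \<open>Y\<close> to some \<open>Z\<close>; afterwards \<open>fob F Z\<close> is compared
      directly with \<open>N'\<close>.\<close>
    obtain M where M: "approximation_step B (fob F Y) M" "stable_retract B M N'"
      using B.stable_retract_step [OF N(2) N'(2)] .
    obtain Z where Z: "approximation_step A Y Z"
      using approximation_step_lift [OF M(1) Y] .
    have "stable_retract B (fob F Z) N'"
      using B.stable_retract_of_steps [OF N(2) F_approximation_step [OF Z] N'(2)] .
    then show "\<exists>Z\<in>?T. approximation_step A Y Z"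
      using Z N'(1) A.approximation_step_obj(2) by blast
  next
    fix Y assume "Y \<in> ?T"
    then obtain N where Y: "Y \<in> obj A" and N: "N \<in> S" "stable_retract B (fob F Y) N" by blast
    obtain N' where N': "N' \<in> S" "approximation_step B N' N" using S(3) N(1) by blast
    obtain k\<^sub>0 e\<^sub>0 where k0: "left_projective_approximation B k\<^sub>0" "short_exact B k\<^sub>0 e\<^sub>0"
      "src B k\<^sub>0 = N'" "tgt B e\<^sub>0 = N"
      using N'(2) unfolding approximation_step_def by blast
    \<comment> \<open>Any epi from a projective onto \<open>Y\<close> will do: its kernel inclusion
      turns out to be an approximation whatever the choice.\<close>
    obtain Q e where Q: "Q \<in> projectives A" and e: "e \<in> Mor A Q Y" "is_epi A e"
      using assms(3) Y unfolding enough_projectives_def by blast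
    note [simp] = A.MorD [OF e(1)]
    obtain k where k: "is_kernel A e k" using A.ex_kernel [of e] by auto
    have ke: "short_exact A k e" using A.short_exactI_epi [OF e(2) k] .
    note [simp] = A.kernelD(2,3) [OF k]
    \<comment> \<open>The image under \<open>F\<close> of this sequence is compared with the step
      from \<open>N'\<close> to \<open>N\<close>, of which \<open>fob F Y\<close> is a stable
      retract at the right end.\<close>
    have "left_projective_approximation B (far F k) \<and>
        stable_retract B (src B (far F k)) (src B k\<^sub>0)"
      by (rule B.stable_retract_syzygy [OF _ _ _ _ k0(1,2), of "far F e"])
        (use N(2) k0(4) B.short_exactD(3,4) [OF F_short_exact [OF ke]] F_projective [OF Q] in simp_all)
    then have K: "left_projective_approximation B (far F k)" "stable_retract B (fob F (src A k)) N'"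
      using k0(3) by simp_all
    have "left_projective_approximation A k"
      using F_reflects_approximation [OF K(1)] Q by simp
    then have "approximation_step A (src A k) Y"
      using ke unfolding approximation_step_def by (metis A.MorD(3) e(1))
    then show "\<exists>Z\<in>?T. approximation_step A Z Y"
      using K(2) N'(1) A.approximation_step_obj(1) by blast
  qed
qed

end

end

theorem corollary3p5:
  fixes A :: "('o, 'm) addcat" and B :: "('p, 'n) addcat"
    and F :: "('o, 'm, 'p, 'n) func" and G :: "('p, 'n, 'o, 'm) func" and X :: 'o
  assumes "abelian_category A" and "enough_projectives A"
    and "abelian_category B" and "enough_projectives B"
    and "additive_functor A B F" and "additive_functor B A G"
    and "frobenius_pair A B F G"
    and "X \<in> obj A"
  shows "(\<forall>n\<ge>1. X \<in> torsionfree A n \<longrightarrow> fob F X \<in> torsionfree B n) \<and>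
         (X \<in> inf_torsionfree A \<longrightarrow> fob F X \<in> inf_torsionfree B) \<and>
         (gorenstein_projective A X \<longrightarrow> gorenstein_projective B (fob F X)) \<and>
         (faithful A B F \<longrightarrow>
            (\<forall>n\<ge>1. X \<in> torsionfree A n \<longleftrightarrow> fob F X \<in> torsionfree B n) \<and>
            (X \<in> inf_torsionfree A \<longleftrightarrow> fob F X \<in> inf_torsionfree B) \<and>
            (gorenstein_projective A X \<longleftrightarrow> gorenstein_projective B (fob F X)))"
proof -
  interpret A: abelian_category A by fact
  interpret B: abelian_category B by fact
  obtain \<alpha> \<beta> where eq: "equivalence A A \<alpha>" "equivalence B B \<beta>"
    and adj: "adjoint_pair A B F G" "adjoint_pair B A G (\<beta> \<circ>\<^sub>F F \<circ>\<^sub>F \<alpha>)"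
    using assms(7) unfolding frobenius_pair_def frobenius_pair_of_type_def by blast
  obtain \<phi> where "adjunction A B F G \<phi>"
    using adjoint_pairE [OF adj(1) A.category_axioms B.category_axioms] .
  then interpret left: adjunction A B F G \<phi> .
  obtain \<psi> where "adjunction B A G (\<beta> \<circ>\<^sub>F F \<circ>\<^sub>F \<alpha>) \<psi>"
    using adjoint_pairE [OF adj(2) B.category_axioms A.category_axioms] .
  then interpret right: adjunction B A G "\<beta> \<circ>\<^sub>F F \<circ>\<^sub>F \<alpha>" \<psi> .
  interpret frobenius_functor A B F G \<phi> \<psi> \<alpha> \<beta>
    by unfold_locales (use assms(5) eq in auto)
  have tf: "\<forall>n\<ge>1. X \<in> torsionfree A n \<longrightarrow> fob F X \<in> torsionfree B n"
    using F_torsionfree by blast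
  then have itf: "X \<in> inf_torsionfree A \<longrightarrow> fob F X \<in> inf_torsionfree B"
    unfolding inf_torsionfree_def by auto
  have rtf: "\<forall>n\<ge>1. fob F X \<in> torsionfree B n \<longrightarrow> X \<in> torsionfree A n" if "faithful A B F"
    using F_reflects_torsionfree [OF that] assms(8) by blast
  then have ritf: "fob F X \<in> inf_torsionfree B \<longrightarrow> X \<in> inf_torsionfree A" if "faithful A B F"
    using that unfolding inf_torsionfree_def by auto
  show ?thesis
    using tf itf rtf ritf F_gorenstein_projective F_reflects_gorenstein_projective assms(2,8) by blast
qed

end
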